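(* Let $\Lambda$ be a finite set. Let $A\in\mathbb{R}^{\Lambda\times\Lambda}$ be a strictly positive definite (symmetric) matrix that is ferromagnetic, i.e. $A_{xy}\le 0$ for all $x\ne y$. For each $x\in\Lambda$ let $V_x:\mathbb{R}\to\mathbb{R}$ be a $C^3$ function that is even ($V_x(-s)=V_x(s)$), unbounded above, and such that its derivative $V_x'$ is convex on $[0,\infty)$. For $u\in\mathbb{R}^\Lambda$ let $\langle\cdot\rangle_u$ denote expectation with respect to the probability measure on $\mathbb{R}^\Lambda$ $$\mu^u_{A,V}(d\sigma)\propto \exp\Big[-\tfrac12(\sigma,A\sigma)+(\sigma,u)-\sum_{x\in\Lambda}V_x(\sigma_x)\Big]\,d\sigma .$$ Then for all $g\in\mathbb{R}^\Lambda$, all $h\in[0,\infty)^\Lambda$ and all $x\in\Lambda$, $$\langle\sigma_x\rangle_{g+h}-\langle\sigma_x\rangle_{g-h}\le\langle\sigma_x\rangle_{h}-\langle\sigma_x\rangle_{-h}.$$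
   Context: $(u,v)=\sum_{x\in\Lambda}u_xv_x$ is the Euclidean inner product on $\mathbb{R}^\Lambda$, $d\sigma$ is Lebesgue measure on $\mathbb{R}^\Lambda$, and $\propto$ means equality up to the normalisation constant making $\mu^u_{A,V}$ a probability measure. *)

theory Defs
  imports "HOL-Analysis.Analysis"
begin

definition pos_definite :: "real^'n^'n \<Rightarrow> bool" where
  "pos_definite A \<longleftrightarrow> transpose A = A \<and> (\<forall>v. v \<noteq> 0 \<longrightarrow> 0 < v \<bullet> (A *v v))"

definition ferromagnetic :: "real^'n^'n \<Rightarrow> bool" where
  "ferromagnetic A \<longleftrightarrow> (\<forall>x y. x \<noteq> y \<longrightarrow> A $ x $ y \<le> 0)"

definition C_diff :: "nat \<Rightarrow> (real \<Rightarrow> real) \<Rightarrow> bool" where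
  "C_diff n f \<longleftrightarrow>
     (\<forall>k<n. (deriv ^^ k) f differentiable_on UNIV) \<and> continuous_on UNIV ((deriv ^^ n) f)"

definition gibbs_weight ::
    "real^'n \<Rightarrow> real^'n^'n \<Rightarrow> ('n \<Rightarrow> real \<Rightarrow> real) \<Rightarrow> real^'n \<Rightarrow> real" where
  "gibbs_weight u A V \<sigma> =
     exp (- (1/2) * (\<sigma> \<bullet> (A *v \<sigma>)) + \<sigma> \<bullet> u - (\<Sum>x\<in>UNIV. V x (\<sigma> $ x)))"

definition gibbs_measure ::
    "real^'n \<Rightarrow> real^'n^'n \<Rightarrow> ('n \<Rightarrow> real \<Rightarrow> real) \<Rightarrow> (real^'n) measure" where
  "gibbs_measure u A V =
     density lborel
       (\<lambda>\<sigma>. ennreal (gibbs_weight u A V \<sigma> / (LINT \<tau>|lborel. gibbs_weight u A V \<tau>)))"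

definition gibbs_expectation ::
    "real^'n \<Rightarrow> real^'n^'n \<Rightarrow> ('n \<Rightarrow> real \<Rightarrow> real) \<Rightarrow> (real^'n \<Rightarrow> real) \<Rightarrow> real" where
  "gibbs_expectation u A V F = (LINT \<sigma>|gibbs_measure u A V. F \<sigma>)"

end

(*
For fields g + h and h - g the claim reads m(h + g) + m(h - g) <= 2 m(h), where m is the mean spin, since m is odd.
Split A = A' + c with A' positive semidefinite, so that the Gibbs measure is exp(-S) times a Gaussian prior with
mean u / c. Give each site y its own prior variance tau_y in [0, 1/c] and let v be minus the gradient of the logarithm
of the smoothed density in the prior mean phi. Each variance tau_y runs its own viscous Burgers equation, and the
second differences D_x = v_x(phi + psi) + v_x(phi - psi) - 2 v_x(phi) satisfy, for every y separately, a linear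
parabolic system in the coordinates of the site y, cooperative because the interaction is ferromagnetic. On phi >= 0
a negative minimum of D is therefore impossible: if phi = 0 then D = 0 by symmetry, and otherwise there is a site y
with phi_y > 0 at which the equation in tau_y can be used away from the boundary phi_y = 0. Sites with tau_y = 0 are
frozen; they act on the others as a nonnegative field, which allows an induction on the number of active sites, and
the convexity of V' on [0, infinity) is the initial condition. The growth bounds needed at infinity hold
when V'' is bounded, and the general case follows by truncating V''.
*)
theory Submission
  imports Defs "HOL-Probability.Distributions"
begin

text \<open>With one common variance the boundary of \<open>\<phi> \<ge> 0\<close> would be in the
  way: the heat equation would then contain second derivatives in every coordinate, also in those
  with \<open>\<phi> $ y = 0\<close>, where a minimum is only one-sided. With one variance per site,
  a single coordinate with \<open>\<phi> $ y > 0\<close> suffices. The minimum is taken over all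
  variances at once, so lowering one of them stays inside the region. Two forms of the same object
  are used. \<open>v\<close>, an expected gradient of the energy, makes sense and is continuous at
  variance 0; \<open>mean\<close> is differentiated by reweighting the prior of one site;
  \<open>mean_eq\<close> links them. The region is unbounded, hence the barrier: quadratic in the
  fields against the linear growth of \<open>v\<close>, and exponential in the total variance with a
  rate \<open>K\<close> above all coefficients of the system. The growth bounds must be uniform in
  the variances. They come from integration by parts and from \<open>f\<close> being increasing up
  to \<open>B\<close>: convexity of \<open>f\<close> on the half line leaves room for a
  \<open>V\<close> that is concave near 0, such as a double well.\<close>

section \<open>Gaussian integrals of functions of exponential growth\<close>

text \<open>A class of test functions, closed under sums and products, that the Gaussian weight
  integrates. Continuity is built in: it gives measurability, and integration by parts asks it of
  the derivative.\<close>

definition exp_growth :: "(real^'n \<Rightarrow> real) \<Rightarrow> bool" where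
  "exp_growth F \<longleftrightarrow> continuous_on UNIV F \<and> (\<exists>C b. \<forall>z. \<bar>F z\<bar> \<le> C * exp (b * norm z))"

lemma exp_growthI:
  fixes F :: "real^'n \<Rightarrow> real"
  assumes "continuous_on UNIV F" "\<And>z. \<bar>F z\<bar> \<le> C * exp (b * norm z)"
  shows "exp_growth F"
  using assms unfolding exp_growth_def by blast

lemma exp_growthE:
  fixes F :: "real^'n \<Rightarrow> real"
  assumes "exp_growth F"
  obtains C b where "continuous_on UNIV F" "C \<ge> 0" "b \<ge> 0" "\<And>z. \<bar>F z\<bar> \<le> C * exp (b * norm z)"
proof -
  from assms obtain C b where F: "continuous_on UNIV F" "\<And>z. \<bar>F z\<bar> \<le> C * exp (b * norm z)"
    unfolding exp_growth_def by blast
  have "\<bar>F z\<bar> \<le> \<bar>C\<bar> * exp (\<bar>b\<bar> * norm z)" for z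
    by (rule order_trans[OF F(2)]) (intro mult_mono, auto intro!: mult_right_mono)
  with F(1) show ?thesis by (intro that[of "\<bar>C\<bar>" "\<bar>b\<bar>"]) auto
qed

lemma exp_growth_bounded:
  fixes F :: "real^'n \<Rightarrow> real"
  assumes "continuous_on UNIV F" "\<And>z. \<bar>F z\<bar> \<le> C"
  shows "exp_growth F"
  using assms by (intro exp_growthI[of _ C 0]) auto

lemma exp_growth_const [simp, intro]: "exp_growth (\<lambda>_. c)"
  by (rule exp_growth_bounded[of _ "\<bar>c\<bar>"]) auto

lemma exp_growth_linear_bound:
  fixes F :: "real^'n \<Rightarrow> real"
  assumes "continuous_on UNIV F" "\<And>z. \<bar>F z\<bar> \<le> C * (1 + norm z)"
  shows "exp_growth F"
proof (rule exp_growthI[of _ "C" 1])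
  fix z :: "real^'n"
  have "0 \<le> C" using order_trans[OF abs_ge_zero assms(2)[of 0]] by simp
  then have "C * (1 + norm z) \<le> C * exp (1 * norm z)"
    by (intro mult_left_mono) (auto simp: exp_ge_add_one_self)
  then show "\<bar>F z\<bar> \<le> C * exp (1 * norm z)" using assms(2)[of z] by linarith
qed fact

lemma exp_growth_component [simp, intro]: "exp_growth (\<lambda>z. z $ i)"
  by (rule exp_growth_linear_bound[of _ 1]) (auto intro!: continuous_intros order_trans[OF component_le_norm_cart])

lemma exp_growth_exp_component [simp, intro]: "exp_growth (\<lambda>z::real^'n. exp (c * z $ i))"
proof (rule exp_growthI[of _ 1 "\<bar>c\<bar>"])
  fix z :: "real^'n"
  have "c * z $ i \<le> \<bar>c\<bar> * norm z"
    by (metis abs_ge_self abs_ge_zero abs_mult component_le_norm_cart mult_left_mono order_trans)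
  then show "\<bar>exp (c * z $ i)\<bar> \<le> 1 * exp (\<bar>c\<bar> * norm z)" by simp
qed (intro continuous_intros)

lemma exp_growth_add [intro]:
  fixes F G :: "real^'n \<Rightarrow> real"
  assumes "exp_growth F" "exp_growth G" shows "exp_growth (\<lambda>z. F z + G z)"
proof -
  obtain C b where F: "continuous_on UNIV F" "C \<ge> 0" "b \<ge> 0" "\<And>z. \<bar>F z\<bar> \<le> C * exp (b * norm z)"
    using exp_growthE[OF assms(1)] by blast
  obtain D c where G: "continuous_on UNIV G" "D \<ge> 0" "c \<ge> 0" "\<And>z. \<bar>G z\<bar> \<le> D * exp (c * norm z)"
    using exp_growthE[OF assms(2)] by blast
  show ?thesis
  proof (rule exp_growthI[of _ "C + D" "max b c"])
    fix z :: "real^'n"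
    have "C * exp (b * norm z) \<le> C * exp (max b c * norm z)" "D * exp (c * norm z) \<le> D * exp (max b c * norm z)"
      using F G by (auto intro!: mult_left_mono mult_right_mono)
    then show "\<bar>F z + G z\<bar> \<le> (C + D) * exp (max b c * norm z)"
      using F(4)[of z] G(4)[of z] by (simp add: distrib_right)
  qed (intro continuous_intros F G)
qed

lemma exp_growth_mult [intro]:
  fixes F G :: "real^'n \<Rightarrow> real"
  assumes "exp_growth F" "exp_growth G" shows "exp_growth (\<lambda>z. F z * G z)"
proof -
  obtain C b where F: "continuous_on UNIV F" "C \<ge> 0" "b \<ge> 0" "\<And>z. \<bar>F z\<bar> \<le> C * exp (b * norm z)"
    using exp_growthE[OF assms(1)] by blast
  obtain D c where G: "continuous_on UNIV G" "D \<ge> 0" "c \<ge> 0" "\<And>z. \<bar>G z\<bar> \<le> D * exp (c * norm z)"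
    using exp_growthE[OF assms(2)] by blast
  show ?thesis
  proof (rule exp_growthI[of _ "C * D" "b + c"])
    fix z :: "real^'n"
    have "\<bar>F z\<bar> * \<bar>G z\<bar> \<le> (C * exp (b * norm z)) * (D * exp (c * norm z))"
      using F G by (intro mult_mono) auto
    then show "\<bar>F z * G z\<bar> \<le> C * D * exp ((b + c) * norm z)"
      by (simp add: abs_mult exp_add algebra_simps)
  qed (intro continuous_intros F G)
qed

lemma exp_growth_uminus [intro]: "exp_growth F \<Longrightarrow> exp_growth (\<lambda>z. - F z)"
  using exp_growth_mult[of "\<lambda>_. -1" F] by simp

lemma exp_growth_diff [intro]: "exp_growth F \<Longrightarrow> exp_growth G \<Longrightarrow> exp_growth (\<lambda>z. F z - G z)"
  using exp_growth_add[of F "\<lambda>z. - G z"] by auto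

lemma exp_growth_divide [intro]: "exp_growth F \<Longrightarrow> exp_growth (\<lambda>z. F z / c)"
  using exp_growth_mult[of F "\<lambda>_. 1 / c"] by auto

lemma exp_growth_power [intro]: "exp_growth F \<Longrightarrow> exp_growth (\<lambda>z. F z ^ k)"
  by (induction k) auto

lemma exp_growth_sum [intro]: "(\<And>i. i \<in> I \<Longrightarrow> exp_growth (F i)) \<Longrightarrow> exp_growth (\<lambda>z. \<Sum>i\<in>I. F i z)"
  by (induction I rule: infinite_finite_induct) auto

lemma exp_growth_abs [intro]: "exp_growth F \<Longrightarrow> exp_growth (\<lambda>z. \<bar>F z\<bar>)"
  by (auto simp: exp_growth_def intro!: continuous_intros)

lemma exp_growth_continuous: "exp_growth F \<Longrightarrow> continuous_on UNIV F"
  by (simp add: exp_growth_def)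

lemma exp_growth_measurable: "exp_growth F \<Longrightarrow> F \<in> borel_measurable borel"
  by (simp add: exp_growth_def borel_measurable_continuous_onI)

section \<open>Affine changes of variables with one scale per coordinate\<close>

lemma continuous_on_vec_times [continuous_intros]:
  fixes f g :: "'a::topological_space \<Rightarrow> real^'n"
  assumes "continuous_on S f" "continuous_on S g"
  shows "continuous_on S (\<lambda>x. f x * g x)"
  unfolding times_vec_def by (intro continuous_intros assms)

text \<open>\<open>*\<close> on vectors is componentwise, so the substitution is diagonal. It later
  serves for reflections of single coordinates, for shifts, and for changing the variance of one
  site.\<close>

lemma lborel_affine_vec:
  fixes t c :: "real^'n"
  assumes c: "\<And>i. c $ i \<noteq> 0"
  shows "lborel = density (distr lborel borel (\<lambda>z. t + c * z)) (\<lambda>_. ennreal (\<Prod>i\<in>UNIV. \<bar>c $ i\<bar>))"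
proof -
  \<comment> \<open>\<open>lborel_affine_euclidean\<close> attaches the scales to basis vectors; the
    sum over \<open>i\<close> reads off \<open>c $ k\<close> at \<open>axis k 1\<close>.\<close>
  define T where "T x = t + (\<Sum>j\<in>Basis. ((\<Sum>i\<in>UNIV. c $ i * (j $ i)) * (x \<bullet> j)) *\<^sub>R j)" for x :: "real^'n"
  have inner_ax: "(\<Sum>i\<in>UNIV. c $ i * (axis k 1 $ i)) = c $ k" for k
    by (simp add: axis_def if_distrib[of "\<lambda>x. _ * x"] cong: if_cong)
  have Basis_eq: "(Basis :: (real^'n) set) = (\<lambda>k. axis k 1) ` UNIV"
    by (auto simp: Basis_vec_def)
  have inj: "inj (\<lambda>k. axis k (1::real) :: real^'n)"
    by (auto simp: inj_def axis_eq_axis)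
  have T: "T x = t + c * x" for x
  proof -
    have "(\<Sum>j\<in>Basis. ((\<Sum>i\<in>UNIV. c $ i * (j $ i)) * (x \<bullet> j)) *\<^sub>R j) = (\<Sum>k\<in>UNIV. (c $ k * x $ k) *\<^sub>R axis k 1)"
      unfolding Basis_eq using inj by (subst sum.reindex) (auto simp: inner_ax inner_axis intro: inj_on_subset)
    also have "\<dots> = c * x"
      by (simp add: vec_eq_iff axis_def if_distrib[of "\<lambda>x. _ * x"] cong: if_cong)
    finally show ?thesis by (simp add: T_def)
  qed
  have [measurable]: "T \<in> borel_measurable borel" unfolding T_def by measurable
  have nz: "(\<Sum>i\<in>UNIV. c $ i * (j $ i)) \<noteq> 0" if "j \<in> Basis" for j
    using that c by (auto simp: Basis_eq inner_ax)
  have "(lborel :: (real^'n) measure) = density (distr lborel borel T) (\<lambda>_. \<Prod>j\<in>Basis. \<bar>\<Sum>i\<in>UNIV. c $ i * (j $ i)\<bar>)"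
    using lborel_affine_euclidean[of "\<lambda>j. \<Sum>i\<in>UNIV. c $ i * (j $ i)" t, OF nz] by (simp add: T_def[abs_def])
  also have "(\<Prod>j\<in>Basis. \<bar>\<Sum>i\<in>UNIV. c $ i * (j $ i)\<bar>) = (\<Prod>k\<in>UNIV. \<bar>c $ k\<bar>)"
    unfolding Basis_eq using inj by (subst prod.reindex) (auto simp: inner_ax intro: inj_on_subset)
  finally show ?thesis
    by (simp add: T[abs_def])
qed

lemma lborel_integral_affine_vec:
  fixes F :: "real^'n \<Rightarrow> real" and t c :: "real^'n"
  assumes c: "\<And>i. c $ i \<noteq> 0" and [measurable]: "F \<in> borel_measurable borel"
  shows "(LINT z|lborel. F z) = (\<Prod>i\<in>UNIV. \<bar>c $ i\<bar>) * (LINT z|lborel. F (t + c * z))"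
proof -
  have [measurable]: "(\<lambda>z. t + c * z) \<in> borel_measurable borel"
    by (intro borel_measurable_continuous_onI continuous_intros)
  have "(LINT z|lborel. F z) = (LINT z|density (distr lborel borel (\<lambda>z. t + c * z)) (\<lambda>_. ennreal (\<Prod>k\<in>UNIV. \<bar>c $ k\<bar>)). F z)"
    using lborel_affine_vec[OF c, of t] by simp
  also have "\<dots> = (LINT z|distr lborel borel (\<lambda>z. t + c * z). (\<Prod>k\<in>UNIV. \<bar>c $ k\<bar>) * F z)"
    by (subst integral_density) (auto intro!: prod_nonneg)
  also have "\<dots> = (LINT z|lborel. (\<Prod>k\<in>UNIV. \<bar>c $ k\<bar>) * F (t + c * z))"
    by (subst integral_distr) auto
  finally show ?thesis by simp
qed

lemma lborel_integrable_affine_vec: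
  fixes F :: "real^'n \<Rightarrow> real" and t c :: "real^'n"
  assumes c: "\<And>i. c $ i \<noteq> 0" and F: "integrable lborel F"
  shows "integrable lborel (\<lambda>z. F (t + c * z))"
proof -
  have [measurable]: "F \<in> borel_measurable borel" using F by auto
  have [measurable]: "(\<lambda>z. t + c * z) \<in> borel_measurable borel"
    by (intro borel_measurable_continuous_onI continuous_intros)
  have pos: "(\<Prod>k\<in>UNIV. \<bar>c $ k\<bar>) > 0" using c by (intro prod_pos) auto
  have "integrable (density (distr lborel borel (\<lambda>z. t + c * z)) (\<lambda>_. ennreal (\<Prod>k\<in>UNIV. \<bar>c $ k\<bar>))) F"
    using F lborel_affine_vec[OF c, of t] by simp
  then have "integrable (distr lborel borel (\<lambda>z. t + c * z)) (\<lambda>z. (\<Prod>k\<in>UNIV. \<bar>c $ k\<bar>) * F z)"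
    using pos by (subst (asm) integrable_density) auto
  then have "integrable lborel (\<lambda>z. (\<Prod>k\<in>UNIV. \<bar>c $ k\<bar>) * F (t + c * z))"
    by (subst (asm) integrable_distr_eq) auto
  then show ?thesis using pos c by simp
qed

section \<open>Gaussian integrability and integration by parts\<close>

lemma integrable_exp_minus_square:
  assumes "(c::real) > 0" shows "integrable lborel (\<lambda>x. exp (- c * x\<^sup>2))"
proof -
  have "integrable lborel (\<lambda>x. normal_density 0 (1 / sqrt (2 * c)) x * sqrt (2 * pi * (1 / sqrt (2 * c))\<^sup>2))"
    using assms by (intro integrable_mult_left integrable_normal_density) auto
  also have "(\<lambda>x. normal_density 0 (1 / sqrt (2 * c)) x * sqrt (2 * pi * (1 / sqrt (2 * c))\<^sup>2)) = (\<lambda>x. exp (- c * x\<^sup>2))"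
    using assms by (auto simp: normal_density_def fun_eq_iff field_simps real_sqrt_divide real_sqrt_mult)
  finally show ?thesis .
qed

lemma integrable_exp_minus_norm_square:
  assumes "(c::real) > 0" shows "integrable lborel (\<lambda>z::real^'n. exp (- c * (norm z)\<^sup>2))"
proof (rule integrableI_nonneg)
  have eq: "exp (- c * (norm z)\<^sup>2) = (\<Prod>b\<in>Basis. exp (- c * (z \<bullet> b)\<^sup>2))" for z :: "real^'n"
  proof -
    have "(norm z)\<^sup>2 = (\<Sum>b\<in>Basis. (z \<bullet> b)\<^sup>2)"
      by (subst power2_norm_eq_inner, subst euclidean_inner) (simp add: power2_eq_square)
    then show ?thesis by (simp add: exp_sum[symmetric] sum_distrib_left sum_negf)
  qed
  have "(\<integral>\<^sup>+z. ennreal (exp (- c * (norm (z::real^'n))\<^sup>2)) \<partial>lborel) = (\<Prod>b\<in>(Basis::(real^'n) set). (\<integral>\<^sup>+x. ennreal (exp (- c * x\<^sup>2)) \<partial>lborel))"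
    unfolding eq by (subst nn_integral_lborel_prod[symmetric]) (auto simp: prod_ennreal)
  also have "\<dots> < \<infinity>"
  proof -
    have "(\<integral>\<^sup>+x. ennreal (exp (- c * x\<^sup>2)) \<partial>lborel) < \<infinity>"
      using integrable_exp_minus_square[OF assms] by (auto simp: integrable_iff_bounded)
    then show ?thesis by (simp add: power_less_top_ennreal)
  qed
  finally show "(\<integral>\<^sup>+z. ennreal (exp (- c * (norm (z::real^'n))\<^sup>2)) \<partial>lborel) < \<infinity>" .
qed auto

definition gauss :: "real^'n \<Rightarrow> real" where
  "gauss z = exp (- ((norm z)\<^sup>2 / 2))"

lemma continuous_gauss [continuous_intros]: "continuous_on A gauss"
  unfolding gauss_def by (intro continuous_intros) auto

lemma gauss_measurable [measurable]: "gauss \<in> borel_measurable borel"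
  by (intro borel_measurable_continuous_onI continuous_gauss)

lemma gauss_pos [simp]: "gauss z > 0" by (simp add: gauss_def)

lemma exp_growth_gauss_bound:
  "exp (b * norm z) * gauss z \<le> exp (b\<^sup>2) * exp (- (1/4) * (norm z)\<^sup>2)"
proof -
  have "0 \<le> (norm z / 2 - b)\<^sup>2" by simp
  then have "b * norm z - (norm z)\<^sup>2 / 2 \<le> b\<^sup>2 - (norm z)\<^sup>2 / 4"
    by (simp add: power2_eq_square algebra_simps)
  then show ?thesis by (simp add: gauss_def exp_add[symmetric])
qed

lemma integrable_exp_gauss: "integrable lborel (\<lambda>z::real^'n. exp (b * norm z) * gauss z)"
  by (rule Bochner_Integration.integrable_bound
        [OF integrable_mult_right[OF integrable_exp_minus_norm_square[of "1/4"], of "exp (b\<^sup>2)"]])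
     (use exp_growth_gauss_bound in \<open>auto simp: abs_mult abs_of_pos\<close>)

lemma integrable_exp_growth:
  fixes F :: "real^'n \<Rightarrow> real"
  assumes "exp_growth F" shows "integrable lborel (\<lambda>z. F z * gauss z)"
proof -
  obtain C b where F: "continuous_on UNIV F" "C \<ge> 0" "b \<ge> 0" "\<And>z. \<bar>F z\<bar> \<le> C * exp (b * norm z)"
    using exp_growthE[OF assms(1)] by blast
  have [measurable]: "F \<in> borel_measurable borel" using assms by (rule exp_growth_measurable)
  show ?thesis
    by (rule Bochner_Integration.integrable_bound
        [OF integrable_mult_right[OF integrable_exp_gauss[of b], of C]])
       (use F in \<open>auto simp: abs_mult abs_of_pos mult.assoc[symmetric] intro!: mult_right_mono\<close>)
qed

text \<open>By translation invariance \<open>F (z + e) - F z\<close> has integral 0. The fundamental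
  theorem of calculus on the segment from \<open>z\<close> to \<open>z + e\<close> and Fubini turn
  this integral into that of \<open>F'\<close>. Integrability of \<open>F\<close> and
  \<open>F'\<close> takes the place of decay at infinity.\<close>

lemma integral_directional_derivative_eq_0:
  fixes F F' :: "'a::euclidean_space \<Rightarrow> real"
  assumes F: "integrable lborel F" and F': "integrable lborel F'" "continuous_on UNIV F'"
    and deriv: "\<And>z. ((\<lambda>t. F (z + t *\<^sub>R e)) has_real_derivative F' z) (at 0)"
  shows "(LINT z|lborel. F' z) = 0"
proof -
  have shift: "integrable lborel (\<lambda>z. H (z + c))" "(LINT z|lborel. H (z + c)) = (LINT z|lborel. H z)"
    if "integrable lborel H" for H :: "'a \<Rightarrow> real" and c
  proof -
    have eq: "lborel = density (distr lborel borel (\<lambda>x::'a. c + x)) (\<lambda>_. 1)"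
      using lborel_affine[of 1 c] by simp
    have eq': "distr lborel borel (\<lambda>x::'a. c + x) = lborel"
      using eq by (simp add: density_1)
    have "integrable (distr lborel borel (\<lambda>x::'a. c + x)) H" using that eq' by simp
    then show "integrable lborel (\<lambda>z. H (z + c))"
      using that by (subst (asm) integrable_distr_eq) (auto simp: add.commute)
    have "(LINT z|distr lborel borel (\<lambda>x::'a. c + x). H z) = (LINT z|lborel. H (c + z))"
      using that by (subst integral_distr) auto
    then show "(LINT z|lborel. H (z + c)) = (LINT z|lborel. H z)" unfolding eq' by (simp add: add.commute)
  qed
  have [measurable]: "F' \<in> borel_measurable borel"
    using F'(2) by (rule borel_measurable_continuous_onI)
  have line: "((\<lambda>t. F (z + t *\<^sub>R e)) has_real_derivative F' (z + t *\<^sub>R e)) (at t)" for z t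
  proof -
    have "((\<lambda>s. F ((z + t *\<^sub>R e) + s *\<^sub>R e)) has_real_derivative F' (z + t *\<^sub>R e)) (at 0)" by (rule deriv)
    then have "((\<lambda>s. F (z + s *\<^sub>R e)) \<circ> (\<lambda>s. t + s) has_real_derivative F' (z + t *\<^sub>R e)) (at 0)"
      by (simp add: o_def algebra_simps)
    then show ?thesis
      using DERIV_shift[of "\<lambda>s. F (z + s *\<^sub>R e)" "F' (z + t *\<^sub>R e)" 0 t] by (simp add: o_def add.commute)
  qed
  have FTC: "(LINT t|lborel. F' (z + t *\<^sub>R e) * indicator {0..1} t) = F (z + e) - F z" for z
  proof -
    have "has_bochner_integral lborel (\<lambda>t. F' (z + t *\<^sub>R e) * indicator {0..1} t)
            ((\<lambda>t. F (z + t *\<^sub>R e)) 1 - (\<lambda>t. F (z + t *\<^sub>R e)) 0)"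
      by (rule has_bochner_integral_FTC_Icc_real)
         (auto intro!: line continuous_on_interior[of UNIV] continuous_intros continuous_on_compose2[OF F'(2)])
    then show ?thesis by (simp add: has_bochner_integral_integral_eq)
  qed
  have int2: "integrable (lborel \<Otimes>\<^sub>M lborel) (\<lambda>(t, z). F' (z + t *\<^sub>R e) * indicator {0..1} t)"
  proof (rule lborel_pair.Fubini_integrable)
    show "(\<lambda>(t, z). F' (z + t *\<^sub>R e) * indicator {0..1} t) \<in> borel_measurable (lborel \<Otimes>\<^sub>M lborel)"
      by measurable
    have "(LINT z|lborel. norm (F' (z + t *\<^sub>R e) * indicator {0..1} t)) = indicator {0..1} t * (LINT z|lborel. norm (F' z))" for t
      using shift(2)[OF integrable_norm[OF F'(1)], of "t *\<^sub>R e"]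
      by (cases "t \<in> {0..1}") (auto simp: abs_mult)
    then show "integrable lborel (\<lambda>t. LINT z|lborel. norm (case (t, z) of (t, z) \<Rightarrow> F' (z + t *\<^sub>R e) * indicator {0..1} t))"
      by simp
    show "AE t in lborel. integrable lborel (\<lambda>z. case (t, z) of (t, z) \<Rightarrow> F' (z + t *\<^sub>R e) * indicator {0..1} t)"
      using shift(1)[OF F'(1)] by (intro AE_I2) simp
  qed
  have const: "(LINT z|lborel. F' (z + t *\<^sub>R e) * indicator {0..1} t) = indicator {0..1} t * (LINT z|lborel. F' z)" for t
    by (simp add: shift(2)[OF F'(1)] mult.commute)
  have "0 = (LINT z|lborel. F (z + e) - F z)"
    using shift[OF F, of e] F by simp
  also have "\<dots> = (LINT z|lborel. LINT t|lborel. F' (z + t *\<^sub>R e) * indicator {0..1} t)"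
    by (simp add: FTC)
  also have "\<dots> = (LINT t|lborel. LINT z|lborel. F' (z + t *\<^sub>R e) * indicator {0..1} t)"
    by (rule lborel_pair.Fubini_integral[OF int2])
  also have "\<dots> = (LINT t|lborel. indicator {0..1::real} t * (LINT z|lborel. F' z))"
    unfolding const ..
  also have "\<dots> = (LINT z|lborel. F' z)" by simp
  finally show ?thesis by simp
qed

text \<open>Stein's identity: the derivative of \<open>gauss\<close> along \<open>axis i 1\<close>
  is \<open>- z $ i * gauss z\<close>.\<close>

lemma gauss_integral_by_parts:
  fixes G G' :: "real^'n \<Rightarrow> real"
  assumes G: "exp_growth G" and G': "exp_growth G'"
    and deriv: "\<And>z. ((\<lambda>t. G (z + t *\<^sub>R axis i 1)) has_real_derivative G' z) (at 0)"
  shows "(LINT z|lborel. G' z * gauss z) = (LINT z|lborel. z $ i * G z * gauss z)"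
proof -
  have "((\<lambda>t. G (z + t *\<^sub>R axis i 1) * gauss (z + t *\<^sub>R axis i 1)) has_real_derivative
          (G' z * gauss z - z $ i * G z * gauss z)) (at 0)" for z
  proof -
    have axis_i: "axis i (1::real) $ i = 1" by (simp add: axis_def)
    have ns: "(norm (z + t *\<^sub>R axis i (1::real)))\<^sup>2 = (norm z)\<^sup>2 + 2 * t * (z $ i) + t\<^sup>2" for t
      unfolding power2_norm_eq_inner inner_add_left inner_add_right
      by (simp add: inner_axis inner_axis' axis_i power2_eq_square)
    have "((\<lambda>t. gauss (z + t *\<^sub>R axis i 1)) has_real_derivative (- (z $ i) * gauss z)) (at 0)"
      unfolding gauss_def ns by (auto intro!: derivative_eq_intros)
    from DERIV_mult[OF deriv this] show ?thesis by (simp add: algebra_simps)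
  qed
  then have "(LINT z|lborel. G' z * gauss z - z $ i * G z * gauss z) = 0"
    using exp_growth_mult[OF exp_growth_component[of i] G]
    by (intro integral_directional_derivative_eq_0[of "\<lambda>z. G z * gauss z" _ "axis i 1"]
          Bochner_Integration.integrable_diff integrable_exp_growth G G' continuous_intros exp_growth_continuous)
  then show ?thesis
    using G G' by (subst (asm) Bochner_Integration.integral_diff) (auto intro!: integrable_exp_growth)
qed

section \<open>Ferromagnetic correlations\<close>

text \<open>For a product \<open>s\<close> of two signs,
  \<open>exp (K * s) = cosh K + sinh K * s\<close>. Removing one pair therefore leaves two sums of
  the same kind with nonnegative coefficients, the second with the exponents at \<open>a\<close> and
  \<open>b\<close> raised by one; hence the arbitrary exponents \<open>m\<close>. Without pairs the
  sum factorises, and each factor \<open>1 + (-1) ^ m i\<close> is nonnegative.\<close>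

lemma sign_sum_exp_nonneg:
  fixes K :: "'n::finite \<times> 'n \<Rightarrow> real" and m :: "'n \<Rightarrow> nat"
  assumes "finite Q" "\<And>p. p \<in> Q \<Longrightarrow> 0 \<le> K p"
  shows "0 \<le> (\<Sum>e\<in>PiE UNIV (\<lambda>_. {1, -1}). (\<Prod>i\<in>UNIV. e i ^ m i) * exp (\<Sum>(a,b)\<in>Q. K (a,b) * (e a * e b)))"
  using assms
proof (induction Q arbitrary: m rule: finite_induct)
  case empty
  have "0 \<le> (\<Prod>i\<in>(UNIV::'n set). \<Sum>y\<in>{1, -1::real}. y ^ m i)"
    by (intro prod_nonneg) (auto simp: minus_one_power_iff)
  also have "\<dots> = (\<Sum>e\<in>PiE UNIV (\<lambda>_. {1, -1}). (\<Prod>i\<in>UNIV. e i ^ m i))"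
    by (subst prod_sum_PiE) auto
  finally show ?case by simp
next
  case (insert p Q)
  obtain a b where p: "p = (a, b)" by fastforce
  define P where "P = PiE (UNIV :: 'n set) (\<lambda>_. {1, -1::real})"
  define m' where "m' i = m i + (if i = a then 1 else 0) + (if i = b then 1 else 0)" for i
  let ?X = "\<lambda>m e. (\<Prod>i\<in>UNIV. e i ^ m i) * exp (\<Sum>(a,b)\<in>Q. K (a,b) * (e a * e b))"
  have m': "(\<Prod>i\<in>UNIV. e i ^ m' i) = (\<Prod>i\<in>UNIV. e i ^ m i) * (e a * e b)" for e :: "'n \<Rightarrow> real"
  proof -
    have "(\<Prod>i\<in>UNIV. e i ^ m' i) = (\<Prod>i\<in>UNIV. e i ^ m i * (if i = a then e i else 1) * (if i = b then e i else 1))"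
      by (intro prod.cong) (auto simp: m'_def power_add)
    then show ?thesis by (simp add: prod.distrib mult.assoc)
  qed
  have "exp (K p * (e a * e b)) = cosh (K p) + sinh (K p) * (e a * e b)" if "e \<in> P" for e
  proof -
    have "e a \<in> {1, -1}" "e b \<in> {1, -1}" using that by (auto simp: P_def)
    then show ?thesis by (auto simp: cosh_def sinh_def field_simps)
  qed
  then have "(\<Sum>e\<in>P. (\<Prod>i\<in>UNIV. e i ^ m i) * exp (\<Sum>(a,b)\<in>insert p Q. K (a,b) * (e a * e b)))
     = (\<Sum>e\<in>P. cosh (K p) * ?X m e + sinh (K p) * ?X m' e)"
    using insert.hyps by (intro sum.cong) (auto simp: p exp_add m' algebra_simps)
  also have "\<dots> = cosh (K p) * (\<Sum>e\<in>P. ?X m e) + sinh (K p) * (\<Sum>e\<in>P. ?X m' e)"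
    by (simp add: sum.distrib sum_distrib_left)
  also have "\<dots> \<ge> 0"
    using insert.IH[of m] insert.IH[of m'] insert.prems
    by (intro add_nonneg_nonneg mult_nonneg_nonneg) (auto simp: P_def)
  finally show ?case by (simp add: P_def)
qed

text \<open>The signs of the \<open>t i\<close> are absorbed into the summation variables
  \<open>e i\<close>. What remains are couplings
  \<open>K a b * \<bar>t a\<bar> * \<bar>t b\<bar>\<close>, which are nonnegative.\<close>

lemma sign_flip_sum_nonneg:
  fixes K :: "'n::finite \<Rightarrow> 'n \<Rightarrow> real" and t :: "'n \<Rightarrow> real"
  assumes "\<And>a b. (a, b) \<in> Q \<Longrightarrow> 0 \<le> K a b"
  shows "0 \<le> (\<Sum>e\<in>PiE UNIV (\<lambda>_. {1, -1}). (e x * t x) * (e y * t y) *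
            exp (\<Sum>(a,b)\<in>Q. K a b * ((e a * t a) * (e b * t b))))"
proof -
  define P where "P = PiE (UNIV :: 'n set) (\<lambda>_. {1, -1::real})"
  define s where "s i = (if t i < 0 then -1 else 1 :: real)" for i
  define m :: "'n \<Rightarrow> nat" where "m i = (if i = x then 1 else 0) + (if i = y then 1 else 0)" for i
  have s: "s i * s i = 1" "s i * t i = \<bar>t i\<bar>" for i by (auto simp: s_def)
  have ss: "e i * s i * s i = e i" for e :: "'n \<Rightarrow> real" and i by (simp add: mult.assoc s(1))
  have sP: "(\<lambda>i. e i * s i) \<in> P" if "e \<in> P" for e
  proof -
    have "e i \<in> {1, -1}" for i using that by (auto simp: P_def)
    then have "e i * s i \<in> {1, -1}" for i by (auto simp: s_def)
    then show ?thesis unfolding P_def by (intro PiE_I) blast+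
  qed
  have m: "(\<Prod>i\<in>UNIV. e i ^ m i) = e x * e y" for e :: "'n \<Rightarrow> real"
  proof -
    have "(\<Prod>i\<in>UNIV. e i ^ m i) = (\<Prod>i\<in>UNIV. (if i = x then e i else 1) * (if i = y then e i else 1))"
      by (intro prod.cong) (auto simp: m_def)
    then show ?thesis by (simp add: prod.distrib)
  qed
  let ?F = "\<lambda>e t. (e x * t x) * (e y * t y) * exp (\<Sum>(a,b)\<in>Q. K a b * ((e a * t a) * (e b * t b)))"
  have "(\<Sum>e\<in>P. ?F e t) = (\<Sum>e\<in>P. ?F (\<lambda>i. e i * s i) t)"
    by (rule sum.reindex_bij_witness[of _ "\<lambda>e i. e i * s i" "\<lambda>e i. e i * s i"])
       (simp_all only: ss sP)
  also have "\<dots> = (\<Sum>e\<in>P. ?F e (\<lambda>i. \<bar>t i\<bar>))" by (simp add: mult.assoc s(2))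
  also have "\<dots> = \<bar>t x\<bar> * \<bar>t y\<bar> * (\<Sum>e\<in>P. (\<Prod>i\<in>UNIV. e i ^ m i) *
        exp (\<Sum>(a,b)\<in>Q. (K a b * (\<bar>t a\<bar> * \<bar>t b\<bar>)) * (e a * e b)))"
    by (simp add: m sum_distrib_left mult_ac)
  also have "\<dots> \<ge> 0"
    using sign_sum_exp_nonneg[of Q "\<lambda>(a,b). K a b * (\<bar>t a\<bar> * \<bar>t b\<bar>)" m] assms
    by (intro mult_nonneg_nonneg) (auto simp: P_def)
  finally show ?thesis by (simp add: P_def)
qed

text \<open>Reflecting single coordinates changes neither Lebesgue measure nor the even weights
  \<open>w i\<close>, so the integrand may be averaged over all sign changes, and the average is
  pointwise nonnegative. A divergent integral has the value 0 by convention.\<close>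

lemma griffiths_first:
  fixes K :: "'n::finite \<Rightarrow> 'n \<Rightarrow> real" and w :: "'n \<Rightarrow> real \<Rightarrow> real"
  assumes K: "\<And>a b. (a, b) \<in> Q \<Longrightarrow> 0 \<le> K a b"
    and w: "\<And>i t. w i (- t) = w i t" "\<And>i t. 0 \<le> w i t"
  shows "0 \<le> (LINT t|lborel. t $ x * t $ y * exp (\<Sum>(a,b)\<in>Q. K a b * (t $ a * t $ b)) * (\<Prod>i\<in>UNIV. w i (t $ i)))"
    (is "0 \<le> (LINT t|lborel. ?F t)")
proof (cases "integrable lborel ?F")
  case True
  define P where "P = PiE (UNIV :: 'n set) (\<lambda>_. {1, -1::real})"
  have [measurable]: "?F \<in> borel_measurable borel" using True by auto
  have finP: "finite P" "card P > 0" by (auto simp: P_def card_PiE intro!: finite_PiE)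
  have flip: "integrable lborel (\<lambda>t. ?F (vec_lambda e * t)) \<and> (LINT t|lborel. ?F (vec_lambda e * t)) = (LINT t|lborel. ?F t)"
    if "e \<in> P" for e
  proof -
    have "e i \<in> {1, -1}" for i using that by (auto simp: P_def)
    then have e: "e i \<noteq> 0" "\<bar>e i\<bar> = 1" for i by (metis abs_minus_cancel abs_one insertE singletonD zero_neq_neg_one zero_neq_one)+
    have "integrable lborel (\<lambda>t. ?F (0 + vec_lambda e * t))"
      by (rule lborel_integrable_affine_vec[OF _ True]) (simp add: e)
    moreover have "(LINT t|lborel. ?F t) = (LINT t|lborel. ?F (0 + vec_lambda e * t))"
      by (subst lborel_integral_affine_vec[of "vec_lambda e" _ 0]) (auto simp: e)
    ultimately show ?thesis by simp
  qed
  have "real (card P) * (LINT t|lborel. ?F t) = (\<Sum>e\<in>P. LINT t|lborel. ?F (vec_lambda e * t))"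
    using flip by simp
  also have "\<dots> = (LINT t|lborel. (\<Sum>e\<in>P. ?F (vec_lambda e * t)))"
    using flip by (intro Bochner_Integration.integral_sum[symmetric]) blast
  also have "\<dots> \<ge> 0"
  proof (rule Bochner_Integration.integral_nonneg)
    fix t :: "real^'n"
    have "w i (e i * t $ i) = w i (t $ i)" if "e \<in> P" for e i
    proof -
      have "e i \<in> {1, -1}" using that by (auto simp: P_def)
      then show ?thesis by (auto simp: w)
    qed
    then have "(\<Sum>e\<in>P. ?F (vec_lambda e * t)) = (\<Sum>e\<in>P. (e x * t $ x) * (e y * t $ y) *
            exp (\<Sum>(a,b)\<in>Q. K a b * ((e a * t $ a) * (e b * t $ b)))) * (\<Prod>i\<in>UNIV. w i (t $ i))"
      by (simp add: sum_distrib_right)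
    also have "\<dots> \<ge> 0"
      using sign_flip_sum_nonneg[of Q K x "\<lambda>i. t $ i" y] K w(2)
      by (intro mult_nonneg_nonneg prod_nonneg) (auto simp: P_def)
    finally show "0 \<le> (\<Sum>e\<in>P. ?F (vec_lambda e * t))" .
  qed
  finally show ?thesis using finP by (auto simp: zero_le_mult_iff)
qed (simp add: not_integrable_integral_eq)

section \<open>Gaussian smoothing with site-dependent variance\<close>

lemma norm_times_vec_le: "norm (a * b :: real^'n) \<le> norm a * norm b"
proof -
  have "norm (a * b) \<le> norm (norm a *\<^sub>R b)"
    by (rule norm_le_componentwise_cart)
       (auto simp: abs_mult intro!: mult_right_mono component_le_norm_cart)
  then show ?thesis by simp
qed

lemma exp_growth_affine_bound:
  fixes \<phi> \<theta> :: "real^'n"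
  assumes cont: "continuous_on UNIV g" and bound: "\<And>\<sigma>. \<bar>g \<sigma>\<bar> \<le> K * (1 + norm \<sigma>)"
  shows "exp_growth (\<lambda>z. g (\<phi> + \<theta> * z))"
proof (rule exp_growth_linear_bound)
  show "continuous_on UNIV (\<lambda>z. g (\<phi> + \<theta> * z))"
    by (intro continuous_on_compose2[OF cont] continuous_intros) auto
  fix z :: "real^'n"
  have K: "K \<ge> 0" using order_trans[OF abs_ge_zero bound[of 0]] by simp
  have "1 + norm (\<phi> + \<theta> * z) \<le> 1 + norm \<phi> + norm \<theta> * norm z"
    using norm_triangle_ineq[of \<phi> "\<theta> * z"] norm_times_vec_le[of \<theta> z] by linarith
  also have "\<dots> \<le> (1 + norm \<phi> + norm \<theta>) * (1 + norm z)"
    by (simp add: algebra_simps)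
  finally have "K * (1 + norm (\<phi> + \<theta> * z)) \<le> K * ((1 + norm \<phi> + norm \<theta>) * (1 + norm z))"
    using K by (rule mult_left_mono)
  then show "\<bar>g (\<phi> + \<theta> * z)\<bar> \<le> K * (1 + norm \<phi> + norm \<theta>) * (1 + norm z)"
    using bound[of "\<phi> + \<theta> * z"] by (simp add: mult.assoc)
qed

text \<open>\<open>V\<close>, \<open>f\<close>, \<open>f'\<close> are the potential and its first two derivatives. The constant \<open>B\<close> makes room for
  potentials that are not convex near the origin.\<close>

locale spin_system =
  fixes A :: "real^'n^'n" and V f f' :: "'n \<Rightarrow> real \<Rightarrow> real" and L B C :: real
  assumes A_sym: "A $ x $ y = A $ y $ x"
    and A_psd: "0 \<le> v \<bullet> (A *v v)"
    and A_ferro: "x \<noteq> y \<Longrightarrow> A $ x $ y \<le> 0"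
    and V_deriv: "(V x has_real_derivative f x s) (at s)"
    and f_deriv: "(f x has_real_derivative f' x s) (at s)"
    and f'_cont: "continuous_on UNIV (f' x)"
    and f'_bound: "\<bar>f' x s\<bar> \<le> L"
    and V_even: "V x (- s) = V x s"
    and V_lower: "- C \<le> V x s"
    and f_lower: "t \<le> s \<Longrightarrow> f x t - B \<le> f x s"
    and f_convex: "convex_on {0..} (f x)"
begin

lemma f_odd: "f x (- s) = - f x s"
proof -
  have "((\<lambda>s. V x (- s)) has_real_derivative f x (- s) * (- 1)) (at s)"
    by (rule DERIV_chain2[OF V_deriv]) (auto intro!: derivative_eq_intros)
  then have "(V x has_real_derivative - f x (- s)) (at s)" by (simp add: V_even)
  from DERIV_unique[OF this V_deriv] show ?thesis by simp
qed

lemma f_0 [simp]: "f x 0 = 0" using f_odd[of x 0] by simp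

lemma f_cont: "continuous_on UNIV (f x)"
  by (meson DERIV_continuous_on f_deriv has_field_derivative_at_within)

lemma V_cont: "continuous_on UNIV (V x)"
  by (meson DERIV_continuous_on V_deriv has_field_derivative_at_within)

lemma L_nonneg: "L \<ge> 0" using order_trans[OF abs_ge_zero f'_bound] .

lemma B_nonneg: "B \<ge> 0" using f_lower[of 0 0] by simp

lemma f_lipschitz: "\<bar>f x s - f x t\<bar> \<le> L * \<bar>s - t\<bar>"
  using field_differentiable_bound[of UNIV "f x" "f' x" L s t] f_deriv f'_bound
  by (auto intro: has_field_derivative_at_within)

lemma f_almost_mono: "- (B * \<bar>s - t\<bar>) \<le> (s - t) * (f x s - f x t)"
proof (cases "t \<le> s")
  case True
  have "(s - t) * (- B) \<le> (s - t) * (f x s - f x t)"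
    using f_lower[OF True, of x] True by (intro mult_left_mono) auto
  then show ?thesis using True by (simp add: algebra_simps)
next
  case False
  have "(t - s) * (- B) \<le> (t - s) * (f x t - f x s)"
    using f_lower[of s t x] False by (intro mult_left_mono) auto
  then show ?thesis using False by (simp add: algebra_simps)
qed

section \<open>The energy and its derivatives along the coordinate axes\<close>

definition S :: "real^'n \<Rightarrow> real" where
  "S \<sigma> = 1/2 * (\<sigma> \<bullet> (A *v \<sigma>)) + (\<Sum>x\<in>UNIV. V x (\<sigma> $ x))"

definition dS :: "'n \<Rightarrow> real^'n \<Rightarrow> real" where
  "dS x \<sigma> = (A *v \<sigma>) $ x + f x (\<sigma> $ x)"

definition ddS :: "'n \<Rightarrow> 'n \<Rightarrow> real^'n \<Rightarrow> real" where
  "ddS x y \<sigma> = A $ x $ y + (if x = y then f' x (\<sigma> $ x) else 0)"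

text \<open>One constant for all sites: a Lipschitz constant of every \<open>dS x\<close> and a
  bound of every \<open>ddS x y\<close>.\<close>

definition lip :: real where "lip = (\<Sum>x\<in>UNIV. \<Sum>y\<in>UNIV. \<bar>A $ x $ y\<bar>) + L"

lemma lip_nonneg: "lip \<ge> 0"
  using L_nonneg by (auto simp: lip_def intro!: add_nonneg_nonneg sum_nonneg)

lemma A_inner: "u \<bullet> (A *v v) = v \<bullet> (A *v u)"
proof -
  have "transpose A = A" by (simp add: vec_eq_iff transpose_def A_sym)
  then show ?thesis by (metis dot_lmul_matrix inner_commute transpose_matrix_vector)
qed

lemma dS_lipschitz: "\<bar>dS x \<sigma> - dS x \<sigma>'\<bar> \<le> lip * norm (\<sigma> - \<sigma>')"
proof -
  have "(A *v \<sigma>) $ x - (A *v \<sigma>') $ x = (\<Sum>y\<in>UNIV. A $ x $ y * (\<sigma> - \<sigma>') $ y)"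
    by (simp add: matrix_vector_mult_def sum_subtractf algebra_simps)
  also have "\<bar>\<dots>\<bar> \<le> (\<Sum>y\<in>UNIV. \<bar>A $ x $ y\<bar> * norm (\<sigma> - \<sigma>'))"
    by (rule order_trans[OF sum_abs]) (auto intro!: sum_mono mult_left_mono component_le_norm_cart simp only: abs_mult abs_ge_zero)
  also have "\<dots> = (\<Sum>y\<in>UNIV. \<bar>A $ x $ y\<bar>) * norm (\<sigma> - \<sigma>')" by (simp add: sum_distrib_right)
  also have "\<dots> \<le> (\<Sum>x\<in>UNIV. \<Sum>y\<in>UNIV. \<bar>A $ x $ y\<bar>) * norm (\<sigma> - \<sigma>')"
    by (intro mult_right_mono member_le_sum) (auto intro!: sum_nonneg)
  finally have 1: "\<bar>(A *v \<sigma>) $ x - (A *v \<sigma>') $ x\<bar> \<le> (\<Sum>x\<in>UNIV. \<Sum>y\<in>UNIV. \<bar>A $ x $ y\<bar>) * norm (\<sigma> - \<sigma>')" .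
  have "L * \<bar>\<sigma> $ x - \<sigma>' $ x\<bar> \<le> L * norm (\<sigma> - \<sigma>')"
    using component_le_norm_cart[of "\<sigma> - \<sigma>'" x] L_nonneg by (intro mult_left_mono) auto
  then show ?thesis using 1 f_lipschitz[of x "\<sigma> $ x" "\<sigma>' $ x"]
    unfolding dS_def lip_def by (simp add: distrib_right)
qed

lemma dS_0 [simp]: "dS x 0 = 0" by (simp add: dS_def)

lemma dS_bound: "\<bar>dS x \<sigma>\<bar> \<le> lip * norm \<sigma>"
  using dS_lipschitz[of x \<sigma> 0] by simp

lemma dS_cont: "continuous_on UNIV (dS x)"
  unfolding dS_def by (intro continuous_intros continuous_on_compose2[OF f_cont]) auto

lemma ddS_cont: "continuous_on UNIV (ddS x y)"
  unfolding ddS_def by (cases "x = y") (auto intro!: continuous_intros continuous_on_compose2[OF f'_cont])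

lemma ddS_bound: "\<bar>ddS x y \<sigma>\<bar> \<le> lip"
proof -
  have "\<bar>A $ x $ y\<bar> \<le> (\<Sum>y\<in>UNIV. \<bar>A $ x $ y\<bar>)" by (rule member_le_sum) auto
  also have "\<dots> \<le> (\<Sum>x\<in>UNIV. \<Sum>y\<in>UNIV. \<bar>A $ x $ y\<bar>)"
    by (rule member_le_sum) (auto intro!: sum_nonneg)
  finally show ?thesis using f'_bound[of x "\<sigma> $ x"] L_nonneg unfolding ddS_def lip_def by auto
qed

lemma S_cont: "continuous_on UNIV S"
  unfolding S_def by (intro continuous_intros continuous_on_compose2[OF V_cont]) auto

lemma S_lower: "- (real CARD('n) * C) \<le> S \<sigma>"
proof -
  have "(\<Sum>x\<in>(UNIV::'n set). - C) \<le> (\<Sum>x\<in>UNIV. V x (\<sigma> $ x))" by (intro sum_mono V_lower)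
  then show ?thesis using A_psd[of \<sigma>] by (simp add: S_def)
qed

lemma A_minus: "A *v (- \<sigma>) = - (A *v \<sigma>)"
  by (simp add: vec_eq_iff matrix_vector_mult_def sum_negf)

lemma S_even: "S (- \<sigma>) = S \<sigma>"
  by (simp add: S_def V_even A_minus)

lemma dS_odd: "dS x (- \<sigma>) = - dS x \<sigma>"
  by (simp add: dS_def f_odd A_minus)

text \<open>The factor \<open>c\<close> is the inner derivative of
  \<open>\<phi> + \<theta> * z\<close>: by \<open>shift_axis\<close>, moving \<open>z\<close> along
  axis \<open>i\<close> moves the spin at rate \<open>\<theta> $ i\<close>.\<close>

lemma S_deriv: "((\<lambda>t. S (\<sigma> + (c * t) *\<^sub>R axis i 1)) has_real_derivative c * dS i \<sigma>) (at 0)"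
proof -
  have quad: "(\<sigma> + t *\<^sub>R axis i 1) \<bullet> (A *v (\<sigma> + t *\<^sub>R axis i 1)) = \<sigma> \<bullet> (A *v \<sigma>) + 2 * t * (A *v \<sigma>) $ i + t\<^sup>2 * A $ i $ i" for t
  proof -
    have "axis i 1 \<bullet> (A *v \<sigma>) = (A *v \<sigma>) $ i" by (simp add: inner_axis')
    moreover have "\<sigma> \<bullet> (A *v axis i 1) = (A *v \<sigma>) $ i" by (subst A_inner) fact
    moreover have "axis i 1 \<bullet> (A *v axis i 1) = A $ i $ i"
      by (simp add: inner_axis' matrix_vector_mul_component inner_axis)
    ultimately show ?thesis
      by (simp add: matrix_vector_right_distrib matrix_vector_mult_scaleR inner_add_left inner_add_right power2_eq_square algebra_simps)
  qed
  have V: "((\<lambda>t. V x ((\<sigma> + (c * t) *\<^sub>R axis i 1) $ x)) has_real_derivative (if x = i then c * f i (\<sigma> $ i) else 0)) (at 0)" for x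
  proof (cases "x = i")
    case True
    have "((\<lambda>t. V i (\<sigma> $ i + c * t)) has_real_derivative f i (\<sigma> $ i + c * 0) * c) (at 0)"
      by (rule DERIV_chain2[OF V_deriv]) (auto intro!: derivative_eq_intros)
    then show ?thesis using True by (simp add: axis_def mult.commute)
  qed (simp add: axis_def)
  have "((\<lambda>t. \<Sum>x\<in>UNIV. V x ((\<sigma> + (c * t) *\<^sub>R axis i 1) $ x)) has_real_derivative (\<Sum>x\<in>UNIV. if x = i then c * f i (\<sigma> $ i) else 0)) (at 0)"
    by (intro DERIV_sum V)
  moreover have "((\<lambda>t. 1/2 * (\<sigma> \<bullet> (A *v \<sigma>) + 2 * (c * t) * (A *v \<sigma>) $ i + (c * t)\<^sup>2 * A $ i $ i)) has_real_derivative c * (A *v \<sigma>) $ i) (at 0)"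
    by (auto intro!: derivative_eq_intros)
  ultimately show ?thesis unfolding S_def quad dS_def
    by (auto dest: DERIV_add simp: algebra_simps)
qed

lemma dS_deriv: "((\<lambda>t. dS x (\<sigma> + (c * t) *\<^sub>R axis i 1)) has_real_derivative c * ddS x i \<sigma>) (at 0)"
proof -
  have lin: "(A *v (\<sigma> + (c * t) *\<^sub>R axis i 1)) $ x = (A *v \<sigma>) $ x + c * t * A $ x $ i" for t
    by (simp add: matrix_vector_right_distrib matrix_vector_mult_scaleR matrix_vector_mul_component inner_axis algebra_simps)
  have "((\<lambda>t. f x ((\<sigma> + (c * t) *\<^sub>R axis i 1) $ x)) has_real_derivative (if x = i then c * f' x (\<sigma> $ x) else 0)) (at 0)"
  proof (cases "x = i")
    case True
    have "((\<lambda>t. f i (\<sigma> $ i + c * t)) has_real_derivative f' i (\<sigma> $ i + c * 0) * c) (at 0)"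
      by (rule DERIV_chain2[OF f_deriv]) (auto intro!: derivative_eq_intros)
    then show ?thesis using True by (simp add: axis_def mult.commute)
  qed (simp add: axis_def)
  then show ?thesis unfolding dS_def ddS_def lin
    by (auto intro!: derivative_eq_intros simp: algebra_simps)
qed

lemma shift_axis: "\<phi> + \<theta> * (z + t *\<^sub>R axis i 1) = (\<phi> + \<theta> * z) + (\<theta> $ i * t) *\<^sub>R axis i (1::real)"
  by (auto simp: vec_eq_iff axis_def algebra_simps)

text \<open>The Boltzmann weight of the spin configuration \<open>\<phi> + \<theta> * z\<close>, where \<open>z\<close> is standard Gaussian: the prior
  of site \<open>i\<close> has mean \<open>\<phi> $ i\<close> and variance \<open>(\<theta> $ i)\<^sup>2\<close>, and \<open>\<theta> $ i = 0\<close> freezes the site at \<open>\<phi> $ i\<close>.\<close>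

definition bw :: "real^'n \<Rightarrow> real^'n \<Rightarrow> real^'n \<Rightarrow> real" where
  "bw \<phi> \<theta> z = exp (- S (\<phi> + \<theta> * z))"

lemma bw_pos [simp]: "bw \<phi> \<theta> z > 0" by (simp add: bw_def)

lemma bw_le: "bw \<phi> \<theta> z \<le> exp (real CARD('n) * C)"
  using S_lower[of "\<phi> + \<theta> * z"] by (simp add: bw_def)

lemma exp_growth_bw: "exp_growth (bw \<phi> \<theta>)"
proof (rule exp_growth_bounded)
  show "continuous_on UNIV (bw \<phi> \<theta>)"
    unfolding bw_def by (intro continuous_intros continuous_on_compose2[OF S_cont]) auto
  show "\<bar>bw \<phi> \<theta> z\<bar> \<le> exp (real CARD('n) * C)" for z
    using bw_le[of \<phi> \<theta> z] bw_pos[of \<phi> \<theta> z] by linarith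
qed

text \<open>Test functions depend on the Gaussian variable \<open>z\<close>, not on the spin. The
  integral is over the whole space for every \<open>\<theta>\<close>, so frozen sites need no
  measure of their own.\<close>

definition gint :: "real^'n \<Rightarrow> real^'n \<Rightarrow> (real^'n \<Rightarrow> real) \<Rightarrow> real" where
  "gint \<phi> \<theta> F = (LINT z|lborel. F z * bw \<phi> \<theta> z * gauss z)"

definition expect :: "real^'n \<Rightarrow> real^'n \<Rightarrow> (real^'n \<Rightarrow> real) \<Rightarrow> real" where
  "expect \<phi> \<theta> F = gint \<phi> \<theta> F / gint \<phi> \<theta> (\<lambda>_. 1)"

lemma integrable_I: "exp_growth F \<Longrightarrow> integrable lborel (\<lambda>z. F z * bw \<phi> \<theta> z * gauss z)"
  by (intro integrable_exp_growth exp_growth_mult exp_growth_bw)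

lemma gint_pos:
  assumes "exp_growth F" "\<And>z. F z > 0" shows "gint \<phi> \<theta> F > 0"
proof -
  have "0 \<le> gint \<phi> \<theta> F"
    unfolding gint_def using assms(2) by (intro Bochner_Integration.integral_nonneg) (auto simp: less_imp_le)
  moreover have "gint \<phi> \<theta> F \<noteq> 0"
  proof
    assume "gint \<phi> \<theta> F = 0"
    then have "AE z in lborel. F z * bw \<phi> \<theta> z * gauss z = 0"
      unfolding gint_def using assms(2)
      by (subst (asm) integral_nonneg_eq_0_iff_AE) (auto simp: less_imp_le integrable_I assms(1))
    moreover have "F z * bw \<phi> \<theta> z * gauss z \<noteq> 0" for z
      using assms(2)[of z] bw_pos[of \<phi> \<theta> z] gauss_pos[of z] by (metis mult_pos_pos less_irrefl)
    ultimately have "AE z in (lborel :: (real^'n) measure). False" by simp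
    then have "emeasure lborel (UNIV :: (real^'n) set) = 0" by (simp add: AE_iff_measurable[OF _ refl])
    then show False by simp
  qed
  ultimately show ?thesis by simp
qed

lemma gint_1_pos: "gint \<phi> \<theta> (\<lambda>_. 1) > 0" by (rule gint_pos) auto

lemma gint_add: "exp_growth F \<Longrightarrow> exp_growth G \<Longrightarrow> gint \<phi> \<theta> (\<lambda>z. F z + G z) = gint \<phi> \<theta> F + gint \<phi> \<theta> G"
  unfolding gint_def by (simp add: distrib_right Bochner_Integration.integral_add integrable_I)

lemma gint_diff: "exp_growth F \<Longrightarrow> exp_growth G \<Longrightarrow> gint \<phi> \<theta> (\<lambda>z. F z - G z) = gint \<phi> \<theta> F - gint \<phi> \<theta> G"
  unfolding gint_def by (simp add: left_diff_distrib Bochner_Integration.integral_diff integrable_I)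

lemma gint_cmult: "gint \<phi> \<theta> (\<lambda>z. c * F z) = c * gint \<phi> \<theta> F"
  unfolding gint_def by (simp add: mult.assoc)

lemma gint_mono: "exp_growth F \<Longrightarrow> exp_growth G \<Longrightarrow> (\<And>z. F z \<le> G z) \<Longrightarrow> gint \<phi> \<theta> F \<le> gint \<phi> \<theta> G"
  unfolding gint_def by (intro integral_mono integrable_I mult_right_mono) (auto simp: less_imp_le)

lemma expect_add: "exp_growth F \<Longrightarrow> exp_growth G \<Longrightarrow> expect \<phi> \<theta> (\<lambda>z. F z + G z) = expect \<phi> \<theta> F + expect \<phi> \<theta> G"
  by (simp add: expect_def gint_add add_divide_distrib)

lemma expect_diff: "exp_growth F \<Longrightarrow> exp_growth G \<Longrightarrow> expect \<phi> \<theta> (\<lambda>z. F z - G z) = expect \<phi> \<theta> F - expect \<phi> \<theta> G"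
  by (simp add: expect_def gint_diff diff_divide_distrib)

lemma expect_cmult: "expect \<phi> \<theta> (\<lambda>z. c * F z) = c * expect \<phi> \<theta> F"
  by (simp add: expect_def gint_cmult)

lemma expect_cmult2: "expect \<phi> \<theta> (\<lambda>z. F z * c) = expect \<phi> \<theta> F * c"
  using expect_cmult[of \<phi> \<theta> c F] by (simp add: mult.commute)

lemma expect_const: "expect \<phi> \<theta> (\<lambda>_. c) = c"
  using gint_cmult[of \<phi> \<theta> c "\<lambda>_. 1"] gint_1_pos[of \<phi> \<theta>] by (simp add: expect_def)

lemma expect_mono: "exp_growth F \<Longrightarrow> exp_growth G \<Longrightarrow> (\<And>z. F z \<le> G z) \<Longrightarrow> expect \<phi> \<theta> F \<le> expect \<phi> \<theta> G"
  unfolding expect_def using gint_1_pos[of \<phi> \<theta>] by (intro divide_right_mono gint_mono) auto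

lemma expect_sum: "(\<And>i. i \<in> J \<Longrightarrow> exp_growth (F i)) \<Longrightarrow> expect \<phi> \<theta> (\<lambda>z. \<Sum>i\<in>J. F i z) = (\<Sum>i\<in>J. expect \<phi> \<theta> (F i))"
  by (induction J rule: infinite_finite_induct) (auto simp: expect_add expect_const exp_growth_sum)

lemma exp_growth_dS [intro, simp]: "exp_growth (\<lambda>z. dS x (\<phi> + \<theta> * z))"
proof (rule exp_growth_affine_bound[OF dS_cont])
  fix \<sigma> :: "real^'n"
  show "\<bar>dS x \<sigma>\<bar> \<le> lip * (1 + norm \<sigma>)"
    using dS_bound[of x \<sigma>] lip_nonneg by (simp add: distrib_left)
qed

lemma exp_growth_ddS [intro, simp]: "exp_growth (\<lambda>z. ddS x y (\<phi> + \<theta> * z))"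
  by (rule exp_growth_bounded[of _ lip]) (auto intro!: continuous_on_compose2[OF ddS_cont] continuous_intros ddS_bound)

text \<open>Stein's identity for the tilted weight, whose logarithmic derivative along axis
  \<open>i\<close> is
  \<open>- (z $ i + \<theta> $ i * dS i (\<phi> + \<theta> * z))\<close>.\<close>

lemma integration_by_parts:
  assumes F: "exp_growth F" "exp_growth F'"
    and deriv: "\<And>z. ((\<lambda>t. F (z + t *\<^sub>R axis i 1)) has_real_derivative F' z) (at 0)"
  shows "expect \<phi> \<theta> F' = expect \<phi> \<theta> (\<lambda>z. F z * (z $ i + \<theta> $ i * dS i (\<phi> + \<theta> * z)))"
proof -
  have bw: "((\<lambda>t. bw \<phi> \<theta> (z + t *\<^sub>R axis i 1)) has_real_derivative - (\<theta> $ i * dS i (\<phi> + \<theta> * z)) * bw \<phi> \<theta> z) (at 0)" for z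
    unfolding bw_def shift_axis
    by (auto intro!: derivative_eq_intros S_deriv)
  have d: "((\<lambda>t. F (z + t *\<^sub>R axis i 1) * bw \<phi> \<theta> (z + t *\<^sub>R axis i 1)) has_real_derivative
     (F' z - F z * (\<theta> $ i * dS i (\<phi> + \<theta> * z))) * bw \<phi> \<theta> z) (at 0)" for z
    using DERIV_mult[OF deriv[of z] bw[of z]] by (simp add: algebra_simps)
  have "(LINT z|lborel. ((F' z - F z * (\<theta> $ i * dS i (\<phi> + \<theta> * z))) * bw \<phi> \<theta> z) * gauss z)
      = (LINT z|lborel. z $ i * (F z * bw \<phi> \<theta> z) * gauss z)"
    by (rule gauss_integral_by_parts[OF _ _ d])
       (intro exp_growth_mult exp_growth_diff exp_growth_bw exp_growth_dS F exp_growth_const)+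
  then have "gint \<phi> \<theta> (\<lambda>z. F' z - F z * (\<theta> $ i * dS i (\<phi> + \<theta> * z))) = gint \<phi> \<theta> (\<lambda>z. F z * z $ i)"
    unfolding gint_def by (simp add: mult_ac)
  then have "gint \<phi> \<theta> F' = gint \<phi> \<theta> (\<lambda>z. F z * z $ i) + gint \<phi> \<theta> (\<lambda>z. F z * (\<theta> $ i * dS i (\<phi> + \<theta> * z)))"
    by (subst (asm) gint_diff) (auto intro!: F exp_growth_mult)
  also have "\<dots> = gint \<phi> \<theta> (\<lambda>z. F z * (z $ i + \<theta> $ i * dS i (\<phi> + \<theta> * z)))"
    by (subst gint_add[symmetric]) (auto intro!: F exp_growth_mult simp: distrib_left)
  finally show ?thesis by (simp add: expect_def)
qed


text \<open>\<open>v\<close> is the gradient in \<open>\<phi>\<close> of minus the logarithm of the smoothed density.\<close>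

definition mean :: "real^'n \<Rightarrow> real^'n \<Rightarrow> 'n \<Rightarrow> real" where
  "mean \<phi> \<theta> x = expect \<phi> \<theta> (\<lambda>z. (\<phi> + \<theta> * z) $ x)"

definition v :: "real^'n \<Rightarrow> real^'n \<Rightarrow> 'n \<Rightarrow> real" where
  "v \<phi> \<theta> x = expect \<phi> \<theta> (\<lambda>z. dS x (\<phi> + \<theta> * z))"

lemma expect_component: "expect \<phi> \<theta> (\<lambda>z. z $ x) = - (\<theta> $ x * v \<phi> \<theta> x)"
proof -
  \<comment> \<open>Integration by parts against the constant 1.\<close>
  have "expect \<phi> \<theta> (\<lambda>_. 0) = expect \<phi> \<theta> (\<lambda>z. 1 * (z $ x + \<theta> $ x * dS x (\<phi> + \<theta> * z)))"
    by (rule integration_by_parts) auto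
  also have "\<dots> = expect \<phi> \<theta> (\<lambda>z. z $ x) + \<theta> $ x * v \<phi> \<theta> x"
    unfolding v_def mult_1 by (subst expect_add) (auto simp: expect_cmult)
  finally show ?thesis by (simp add: expect_const)
qed

text \<open>Tweedie's formula. It carries statements about \<open>v\<close> to statements about
  \<open>mean\<close> wherever \<open>\<theta> $ x\<close> is nonzero, and back.\<close>

lemma mean_eq: "mean \<phi> \<theta> x = \<phi> $ x - (\<theta> $ x)\<^sup>2 * v \<phi> \<theta> x"
proof -
  have "mean \<phi> \<theta> x = expect \<phi> \<theta> (\<lambda>z. \<phi> $ x + \<theta> $ x * z $ x)"
    by (simp add: mean_def)
  also have "\<dots> = \<phi> $ x + \<theta> $ x * expect \<phi> \<theta> (\<lambda>z. z $ x)"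
    by (subst expect_add) (auto simp: expect_cmult expect_const)
  finally show ?thesis by (simp add: expect_component power2_eq_square)
qed

section \<open>Moment bounds, uniform in the prior variances\<close>

lemma dS_monotone_up_to:
  "(\<Sum>i\<in>UNIV. (\<sigma> - \<sigma>') $ i * (dS i \<sigma> - dS i \<sigma>')) \<ge> - (\<Sum>i\<in>UNIV. B * \<bar>(\<sigma> - \<sigma>') $ i\<bar>)"
proof -
  have "(\<Sum>i\<in>UNIV. (\<sigma> - \<sigma>') $ i * (dS i \<sigma> - dS i \<sigma>')) =
      (\<sigma> - \<sigma>') \<bullet> (A *v (\<sigma> - \<sigma>')) + (\<Sum>i\<in>UNIV. (\<sigma> $ i - \<sigma>' $ i) * (f i (\<sigma> $ i) - f i (\<sigma>' $ i)))"
    by (simp add: dS_def inner_vec_def matrix_vector_mult_diff_distrib sum.distrib[symmetric] algebra_simps)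
  also have "\<dots> \<ge> 0 + (\<Sum>i\<in>UNIV. - (B * \<bar>\<sigma> $ i - \<sigma>' $ i\<bar>))"
    by (intro add_mono A_psd sum_mono f_almost_mono)
  finally show ?thesis by (simp add: sum_negf)
qed

text \<open>Integrating by parts against \<open>z $ i - a $ i\<close> gives the expectation of
  \<open>?L\<close>, which is the number of sites. In \<open>?L\<close> the drift at
  \<open>z\<close> is compared with the drift at \<open>a\<close>; their difference is monotone up
  to \<open>B\<close>, and this defect costs half of the square. The point \<open>a\<close> is left
  free: 0 gives second moments, the mean of \<open>z\<close> gives variances.\<close>

lemma second_moment_aux:
  fixes \<phi> \<theta> a :: "real^'n"
  assumes \<theta>: "\<And>i. \<bar>\<theta> $ i\<bar> \<le> \<Theta>"
  shows "1/2 * (\<Sum>i\<in>UNIV. expect \<phi> \<theta> (\<lambda>z. (z $ i - a $ i)\<^sup>2))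
    \<le> CARD('n) * (1 + (B * \<Theta>)\<^sup>2 / 2) - (\<Sum>i\<in>UNIV. (expect \<phi> \<theta> (\<lambda>z. z $ i) - a $ i) * (a $ i + \<theta> $ i * dS i (\<phi> + \<theta> * a)))"
proof -
  have \<Theta>: "\<Theta> \<ge> 0" using order_trans[OF abs_ge_zero \<theta>] .
  have by_parts: "1 = expect \<phi> \<theta> (\<lambda>z. (z $ i - a $ i) * (z $ i + \<theta> $ i * dS i (\<phi> + \<theta> * z)))" for i
  proof -
    have "expect \<phi> \<theta> (\<lambda>_. 1) = expect \<phi> \<theta> (\<lambda>z. (z $ i - a $ i) * (z $ i + \<theta> $ i * dS i (\<phi> + \<theta> * z)))"
    proof (rule integration_by_parts)
      show "((\<lambda>t. (z + t *\<^sub>R axis i 1) $ i - a $ i) has_real_derivative 1) (at 0)" for z :: "real^'n"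
        by (auto simp: axis_def intro!: derivative_eq_intros)
    qed auto
    then show ?thesis by (simp add: expect_const)
  qed
  let ?L = "\<lambda>z::real^'n. \<Sum>i\<in>UNIV. (z $ i - a $ i) * (z $ i + \<theta> $ i * dS i (\<phi> + \<theta> * z))"
  let ?R = "\<lambda>z::real^'n. \<Sum>i\<in>UNIV. (1/2 * (z $ i - a $ i)\<^sup>2 - (B * \<Theta>)\<^sup>2 / 2 + (z $ i - a $ i) * (a $ i + \<theta> $ i * dS i (\<phi> + \<theta> * a)))"
  have "?R z \<le> ?L z" for z
  proof -
    let ?s = "\<phi> + \<theta> * z" and ?t = "\<phi> + \<theta> * a"
    have "(\<Sum>i\<in>UNIV. (?s - ?t) $ i * (dS i ?s - dS i ?t)) \<ge> - (\<Sum>i\<in>UNIV. B * \<bar>(?s - ?t) $ i\<bar>)"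
      by (rule dS_monotone_up_to)
    moreover have "B * \<bar>(?s - ?t) $ i\<bar> \<le> 1/2 * (z $ i - a $ i)\<^sup>2 + (B * \<Theta>)\<^sup>2 / 2" for i
    proof -
      have "B * \<bar>(?s - ?t) $ i\<bar> = (B * \<bar>\<theta> $ i\<bar>) * \<bar>z $ i - a $ i\<bar>"
        by (simp add: right_diff_distrib[symmetric] abs_mult)
      also have "\<dots> \<le> (B * \<Theta>) * \<bar>z $ i - a $ i\<bar>"
        by (intro mult_right_mono mult_left_mono \<theta> B_nonneg) auto
      also have "\<dots> \<le> 1/2 * (z $ i - a $ i)\<^sup>2 + (B * \<Theta>)\<^sup>2 / 2"
        using zero_le_power2[of "B * \<Theta> - \<bar>z $ i - a $ i\<bar>"] by (simp add: power2_diff algebra_simps)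
      finally show ?thesis .
    qed
    then have "(\<Sum>i\<in>UNIV. B * \<bar>(?s - ?t) $ i\<bar>) \<le> (\<Sum>i\<in>UNIV. 1/2 * (z $ i - a $ i)\<^sup>2 + (B * \<Theta>)\<^sup>2 / 2)"
      by (rule sum_mono)
    moreover have "?L z - ?R z = (\<Sum>i\<in>UNIV. (?s - ?t) $ i * (dS i ?s - dS i ?t)) + (\<Sum>i\<in>UNIV. 1/2 * (z $ i - a $ i)\<^sup>2 + (B * \<Theta>)\<^sup>2 / 2)"
      unfolding sum_subtractf[symmetric] sum.distrib[symmetric]
      by (intro sum.cong refl) (simp add: power2_eq_square field_simps)
    ultimately show ?thesis by linarith
  qed
  then have "expect \<phi> \<theta> ?R \<le> expect \<phi> \<theta> ?L"
    by (intro expect_mono) (auto intro!: exp_growth_sum exp_growth_add exp_growth_mult exp_growth_diff exp_growth_power)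
  also have "expect \<phi> \<theta> ?L = CARD('n)"
    by (subst expect_sum) (auto intro!: exp_growth_add exp_growth_mult exp_growth_diff simp: by_parts[symmetric])
  also have "expect \<phi> \<theta> ?R = (\<Sum>i\<in>UNIV. 1/2 * expect \<phi> \<theta> (\<lambda>z. (z $ i - a $ i)\<^sup>2) - (B * \<Theta>)\<^sup>2 / 2 + (expect \<phi> \<theta> (\<lambda>z. z $ i) - a $ i) * (a $ i + \<theta> $ i * dS i (\<phi> + \<theta> * a)))"
  proof (subst expect_sum)
    show "(\<Sum>i\<in>UNIV. expect \<phi> \<theta> (\<lambda>z. 1/2 * (z $ i - a $ i)\<^sup>2 - (B * \<Theta>)\<^sup>2 / 2 + (z $ i - a $ i) * (a $ i + \<theta> $ i * dS i (\<phi> + \<theta> * a))))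
      = (\<Sum>i\<in>UNIV. 1/2 * expect \<phi> \<theta> (\<lambda>z. (z $ i - a $ i)\<^sup>2) - (B * \<Theta>)\<^sup>2 / 2 + (expect \<phi> \<theta> (\<lambda>z. z $ i) - a $ i) * (a $ i + \<theta> $ i * dS i (\<phi> + \<theta> * a)))"
    proof (rule sum.cong[OF refl])
      fix i
      let ?c = "a $ i + \<theta> $ i * dS i (\<phi> + \<theta> * a)"
      have g: "exp_growth (\<lambda>z. 1/2 * (z $ i - a $ i)\<^sup>2)" "exp_growth (\<lambda>z. 1/2 * (z $ i - a $ i)\<^sup>2 - (B * \<Theta>)\<^sup>2 / 2)" "exp_growth (\<lambda>z. (z $ i - a $ i) * ?c)"
        by (auto intro!: exp_growth_mult exp_growth_diff exp_growth_power)
      show "expect \<phi> \<theta> (\<lambda>z. 1/2 * (z $ i - a $ i)\<^sup>2 - (B * \<Theta>)\<^sup>2 / 2 + (z $ i - a $ i) * ?c) =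
        1/2 * expect \<phi> \<theta> (\<lambda>z. (z $ i - a $ i)\<^sup>2) - (B * \<Theta>)\<^sup>2 / 2 + (expect \<phi> \<theta> (\<lambda>z. z $ i) - a $ i) * ?c"
        unfolding expect_add[OF g(2,3)] expect_diff[OF g(1) exp_growth_const] expect_cmult expect_cmult2 expect_const
        unfolding expect_diff[OF exp_growth_component exp_growth_const] expect_const ..
    qed
  qed (auto intro!: exp_growth_add exp_growth_mult exp_growth_diff exp_growth_power)
  finally show ?thesis
    by (simp only: sum.distrib sum_subtractf sum_distrib_left sum_constant) (simp add: algebra_simps)
qed

text \<open>For \<open>a\<close> the mean of \<open>z\<close> the linear term vanishes, and with it
  every dependence on \<open>\<phi>\<close>.\<close>

lemma variance_bound:
  assumes \<theta>: "\<And>i. \<bar>\<theta> $ i\<bar> \<le> \<Theta>" and a: "a = (\<chi> i. expect \<phi> \<theta> (\<lambda>z. z $ i))"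
  shows "(\<Sum>i\<in>UNIV. expect \<phi> \<theta> (\<lambda>z. (z $ i - a $ i)\<^sup>2)) \<le> CARD('n) * (2 + (B * \<Theta>)\<^sup>2)"
  using second_moment_aux[OF \<theta>, where \<phi>=\<phi> and a=a] by (simp add: a field_simps)

text \<open>For \<open>a = 0\<close> the linear term contains the drift at \<open>\<phi>\<close>, of
  size at most \<open>\<Theta> * lip * norm \<phi>\<close>. Half of the available square absorbs it,
  which explains the factor 4.\<close>

lemma second_moment_bound:
  assumes \<theta>: "\<And>i. \<bar>\<theta> $ i\<bar> \<le> \<Theta>"
  shows "(\<Sum>i\<in>UNIV. expect \<phi> \<theta> (\<lambda>z. (z $ i)\<^sup>2)) \<le> 4 * CARD('n) * (1 + (B * \<Theta>)\<^sup>2 / 2 + (\<Theta> * lip)\<^sup>2 * (norm \<phi>)\<^sup>2)"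
proof -
  have \<Theta>: "\<Theta> \<ge> 0" using order_trans[OF abs_ge_zero \<theta>] .
  let ?q = "\<Theta> * (lip * norm \<phi>)"
  have q: "\<bar>\<theta> $ i * dS i \<phi>\<bar> \<le> ?q" for i
    unfolding abs_mult by (intro mult_mono \<theta> dS_bound \<Theta>) auto
  have "- (expect \<phi> \<theta> (\<lambda>z. z $ i) * (\<theta> $ i * dS i \<phi>)) \<le> 1/4 * expect \<phi> \<theta> (\<lambda>z. (z $ i)\<^sup>2) + ?q\<^sup>2" for i
  proof -
    let ?d = "\<theta> $ i * dS i \<phi>"
    have "expect \<phi> \<theta> (\<lambda>z. (- ?d) * z $ i) \<le> expect \<phi> \<theta> (\<lambda>z. 1/4 * (z $ i)\<^sup>2 + ?q\<^sup>2)"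
    proof (rule expect_mono)
      fix z :: "real^'n"
      have "?d\<^sup>2 \<le> ?q\<^sup>2" using q[of i] by (metis abs_ge_zero power2_abs power_mono)
      moreover have "0 \<le> (z $ i / 2 + ?d)\<^sup>2" by simp
      ultimately show "(- ?d) * z $ i \<le> 1/4 * (z $ i)\<^sup>2 + ?q\<^sup>2"
        by (simp add: power2_sum field_simps)
    qed (auto intro!: exp_growth_add exp_growth_mult exp_growth_power)
    also have "expect \<phi> \<theta> (\<lambda>z. 1/4 * (z $ i)\<^sup>2 + ?q\<^sup>2) = 1/4 * expect \<phi> \<theta> (\<lambda>z. (z $ i)\<^sup>2) + ?q\<^sup>2"
      unfolding expect_add[OF exp_growth_mult[OF exp_growth_const exp_growth_power[OF exp_growth_component]] exp_growth_const] expect_cmult expect_const ..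
    finally show ?thesis unfolding expect_cmult by (simp add: mult.commute)
  qed
  then have "(\<Sum>i\<in>UNIV. - (expect \<phi> \<theta> (\<lambda>z. z $ i) * (\<theta> $ i * dS i \<phi>))) \<le> (\<Sum>i\<in>UNIV. 1/4 * expect \<phi> \<theta> (\<lambda>z. (z $ i)\<^sup>2) + ?q\<^sup>2)"
    by (rule sum_mono)
  also have "\<dots> = 1/4 * (\<Sum>i\<in>UNIV. expect \<phi> \<theta> (\<lambda>z. (z $ i)\<^sup>2)) + CARD('n) * ?q\<^sup>2"
    by (simp add: sum.distrib sum_distrib_left)
  finally show ?thesis
    using second_moment_aux[OF \<theta>, where \<phi>=\<phi> and a=0] 
    by (simp add: sum_negf power_mult_distrib field_simps)
qed

text \<open>\<open>dS\<close> grows linearly, so first moments of \<open>z\<close> are needed,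
  linear in \<open>norm \<phi>\<close>. They follow from the quadratic second moments through
  \<open>\<bar>z $ i\<bar> \<le> (z $ i)\<^sup>2 / r + r\<close> with
  \<open>r = 1 + norm \<phi>\<close>.\<close>

lemma v_growth:
  assumes \<Theta>: "\<Theta> \<ge> 0"
  shows "\<exists>K\<ge>0. \<forall>\<phi> \<theta> x. (\<forall>i. \<bar>\<theta> $ i\<bar> \<le> \<Theta>) \<longrightarrow> \<bar>v \<phi> \<theta> x\<bar> \<le> K * (1 + norm \<phi>)"
proof -
  define N where "N = real CARD('n)"
  define K0 where "K0 = 4 * N * (1 + (B * \<Theta>)\<^sup>2 / 2 + (\<Theta> * lip)\<^sup>2)"
  define K where "K = lip * (1 + \<Theta> * (K0 + N))"
  have N: "N \<ge> 0" by (simp add: N_def)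
  have K0: "K0 \<ge> 0" unfolding K0_def using N by (intro mult_nonneg_nonneg add_nonneg_nonneg) auto
  have "\<bar>v \<phi> \<theta> x\<bar> \<le> K * (1 + norm \<phi>)" if \<theta>: "\<And>i. \<bar>\<theta> $ i\<bar> \<le> \<Theta>" for \<phi> \<theta> x
  proof -
    let ?r = "1 + norm \<phi>"
    have r: "?r \<ge> 1" by simp
    have s2: "(\<Sum>i\<in>UNIV. expect \<phi> \<theta> (\<lambda>z. (z $ i)\<^sup>2)) \<le> K0 * ?r\<^sup>2"
    proof -
      have "1 + (B * \<Theta>)\<^sup>2 / 2 + (\<Theta> * lip)\<^sup>2 * (norm \<phi>)\<^sup>2 \<le> (1 + (B * \<Theta>)\<^sup>2 / 2 + (\<Theta> * lip)\<^sup>2) * ?r\<^sup>2"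
      proof -
        have "(norm \<phi>)\<^sup>2 \<le> ?r\<^sup>2" by (intro power_mono) auto
        moreover have "1 \<le> ?r\<^sup>2" using r by (simp add: one_le_power)
        ultimately have "(1 + (B * \<Theta>)\<^sup>2 / 2) * 1 + (\<Theta> * lip)\<^sup>2 * (norm \<phi>)\<^sup>2 \<le> (1 + (B * \<Theta>)\<^sup>2 / 2) * ?r\<^sup>2 + (\<Theta> * lip)\<^sup>2 * ?r\<^sup>2"
          by (intro add_mono mult_left_mono) auto
        then show ?thesis by (simp add: distrib_right)
      qed
      then have "4 * N * (1 + (B * \<Theta>)\<^sup>2 / 2 + (\<Theta> * lip)\<^sup>2 * (norm \<phi>)\<^sup>2) \<le> K0 * ?r\<^sup>2"
        unfolding K0_def mult.assoc using N by (intro mult_left_mono) (auto simp: mult.assoc)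
      then show ?thesis using second_moment_bound[OF \<theta>, where \<phi>=\<phi>] unfolding N_def by linarith
    qed
    have pt: "\<bar>dS x (\<phi> + \<theta> * z)\<bar> \<le> lip * (norm \<phi> + \<Theta> * (\<Sum>i\<in>UNIV. (z $ i)\<^sup>2 / ?r + ?r))" for z
    proof -
      have "norm (\<theta> * z) \<le> (\<Sum>i\<in>UNIV. \<bar>(\<theta> * z) $ i\<bar>)" by (rule norm_le_l1_cart)
      also have "\<dots> \<le> (\<Sum>i\<in>UNIV. \<Theta> * ((z $ i)\<^sup>2 / ?r + ?r))"
      proof (rule sum_mono)
        fix i
        have "\<bar>z $ i\<bar> \<le> (z $ i)\<^sup>2 / ?r + ?r"
        proof -
          have "0 \<le> (\<bar>z $ i\<bar> - ?r)\<^sup>2" by simp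
          then have "2 * \<bar>z $ i\<bar> * ?r \<le> (z $ i)\<^sup>2 + ?r\<^sup>2" by (simp add: power2_diff)
          moreover have "0 \<le> \<bar>z $ i\<bar> * ?r" by simp
          ultimately have "\<bar>z $ i\<bar> * ?r \<le> (z $ i)\<^sup>2 + ?r * ?r" unfolding power2_eq_square by linarith
          moreover have "?r \<noteq> 0" using r by linarith
          then have "((z $ i)\<^sup>2 / ?r) * ?r = (z $ i)\<^sup>2" by simp
          then have "((z $ i)\<^sup>2 / ?r + ?r) * ?r = (z $ i)\<^sup>2 + ?r * ?r" by (simp only: distrib_right)
          ultimately have "\<bar>z $ i\<bar> * ?r \<le> ((z $ i)\<^sup>2 / ?r + ?r) * ?r" by (simp only:)
          moreover have "0 < ?r" using r by linarith
          ultimately show ?thesis by (rule mult_right_le_imp_le)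
        qed
        then show "\<bar>(\<theta> * z) $ i\<bar> \<le> \<Theta> * ((z $ i)\<^sup>2 / ?r + ?r)"
          unfolding vector_mult_component abs_mult using \<theta> \<Theta> by (intro mult_mono) auto
      qed
      finally have "norm (\<phi> + \<theta> * z) \<le> norm \<phi> + \<Theta> * (\<Sum>i\<in>UNIV. (z $ i)\<^sup>2 / ?r + ?r)"
        using norm_triangle_ineq[of \<phi> "\<theta> * z"] unfolding sum_distrib_left by linarith
      then show ?thesis using dS_bound[of x "\<phi> + \<theta> * z"] lip_nonneg
        by (meson mult_left_mono order_trans)
    qed
    have g: "exp_growth (\<lambda>z. lip * (norm \<phi> + \<Theta> * (\<Sum>i\<in>UNIV. (z $ i)\<^sup>2 / ?r + ?r)))"
      by (intro exp_growth_mult exp_growth_add exp_growth_sum exp_growth_divide exp_growth_power exp_growth_const exp_growth_component)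
    have "expect \<phi> \<theta> (\<lambda>z. lip * (norm \<phi> + \<Theta> * (\<Sum>i\<in>UNIV. (z $ i)\<^sup>2 / ?r + ?r))) = lip * (norm \<phi> + \<Theta> * (\<Sum>i\<in>UNIV. expect \<phi> \<theta> (\<lambda>z. (z $ i)\<^sup>2) / ?r + ?r))"
    proof -
      have d: "expect \<phi> \<theta> (\<lambda>z. (z $ i)\<^sup>2 / ?r + ?r) = expect \<phi> \<theta> (\<lambda>z. (z $ i)\<^sup>2) / ?r + ?r" for i
        using expect_cmult[of \<phi> \<theta> "1 / ?r" "\<lambda>z. (z $ i)\<^sup>2"]
        by (subst expect_add) (auto intro!: exp_growth_divide exp_growth_power simp: expect_const)
      have gi: "exp_growth (\<lambda>z. (z $ i)\<^sup>2 / ?r + ?r)" for i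
        by (intro exp_growth_add exp_growth_divide exp_growth_power exp_growth_const exp_growth_component)
      have s: "expect \<phi> \<theta> (\<lambda>z. \<Sum>i\<in>UNIV. (z $ i)\<^sup>2 / ?r + ?r) = (\<Sum>i\<in>UNIV. expect \<phi> \<theta> (\<lambda>z. (z $ i)\<^sup>2) / ?r + ?r)"
        by (subst expect_sum[OF gi]) (simp only: d)
      show ?thesis
        unfolding expect_cmult expect_add[OF exp_growth_const exp_growth_mult[OF exp_growth_const exp_growth_sum[OF gi]]] expect_const s ..
    qed
    also have "\<dots> \<le> lip * (norm \<phi> + \<Theta> * (K0 * ?r + N * ?r))"
    proof (intro mult_left_mono add_left_mono lip_nonneg \<Theta>)
      have "(\<Sum>i\<in>UNIV. expect \<phi> \<theta> (\<lambda>z. (z $ i)\<^sup>2) / ?r + ?r) = (\<Sum>i\<in>UNIV. expect \<phi> \<theta> (\<lambda>z. (z $ i)\<^sup>2)) / ?r + N * ?r"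
        by (simp add: sum.distrib sum_divide_distrib N_def)
      moreover have "(\<Sum>i\<in>UNIV. expect \<phi> \<theta> (\<lambda>z. (z $ i)\<^sup>2)) / ?r \<le> K0 * ?r\<^sup>2 / ?r"
        using r by (intro divide_right_mono s2) auto
      moreover have "K0 * ?r\<^sup>2 / ?r = K0 * ?r" using r by (simp add: power2_eq_square)
      ultimately show "(\<Sum>i\<in>UNIV. expect \<phi> \<theta> (\<lambda>z. (z $ i)\<^sup>2) / ?r + ?r) \<le> K0 * ?r + N * ?r" by simp
    qed
    also have "\<dots> \<le> K * ?r"
    proof -
      have "norm \<phi> + \<Theta> * (K0 * ?r + N * ?r) \<le> (1 + \<Theta> * (K0 + N)) * ?r"
        by (simp add: algebra_simps)
      then have "lip * (norm \<phi> + \<Theta> * (K0 * ?r + N * ?r)) \<le> lip * ((1 + \<Theta> * (K0 + N)) * ?r)"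
        using lip_nonneg by (rule mult_left_mono)
      then show ?thesis by (simp add: K_def mult.assoc)
    qed
    finally have up: "expect \<phi> \<theta> (\<lambda>z. lip * (norm \<phi> + \<Theta> * (\<Sum>i\<in>UNIV. (z $ i)\<^sup>2 / ?r + ?r))) \<le> K * ?r" .
    have "v \<phi> \<theta> x \<le> expect \<phi> \<theta> (\<lambda>z. lip * (norm \<phi> + \<Theta> * (\<Sum>i\<in>UNIV. (z $ i)\<^sup>2 / ?r + ?r)))"
      unfolding v_def by (intro expect_mono g exp_growth_dS order_trans[OF abs_ge_self pt])
    moreover have "(-1) * v \<phi> \<theta> x \<le> expect \<phi> \<theta> (\<lambda>z. lip * (norm \<phi> + \<Theta> * (\<Sum>i\<in>UNIV. (z $ i)\<^sup>2 / ?r + ?r)))"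
      unfolding v_def expect_cmult[symmetric]
      by (intro expect_mono g exp_growth_mult exp_growth_const exp_growth_dS order_trans[OF _ pt]) simp
    ultimately show ?thesis using up by (simp add: abs_le_iff)
  qed
  moreover have "K \<ge> 0" unfolding K_def using lip_nonneg \<Theta> K0 N by (intro mult_nonneg_nonneg add_nonneg_nonneg) auto
  ultimately show ?thesis by blast
qed

end

text \<open>The change of variables \<open>s = (z + z') / 2\<close>,
  \<open>t = (z - z') / 2\<close>, made one variable at a time: \<open>z' = z - 2 t\<close> at fixed
  \<open>z\<close>, with Jacobian \<open>2 ^ DIM('a)\<close>, then \<open>z = s + t\<close> at fixed
  \<open>t\<close>. The product bound justifies the exchanges of integrals.\<close>

lemma double_integral_midpoint_nonneg:
  fixes k :: "'a::euclidean_space \<Rightarrow> 'a \<Rightarrow> real"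
  assumes cont: "continuous_on UNIV (\<lambda>(s, t). k s t)"
    and P: "integrable lborel P" and Q: "integrable lborel Q"
    and bound: "\<And>s t. \<bar>k s t\<bar> \<le> P s * Q t"
    and nonneg: "\<And>s. 0 \<le> (LINT t|lborel. k s t)"
  shows "0 \<le> (LINT z|lborel. LINT z'|lborel. k ((1/2) *\<^sub>R (z + z')) ((1/2) *\<^sub>R (z - z')))"
proof -
  have [measurable]: "(\<lambda>(s, t). k s t) \<in> borel_measurable borel"
    using cont by (rule borel_measurable_continuous_onI)
  have m1 [measurable]: "(\<lambda>(t, s). k s t) \<in> borel_measurable (lborel \<Otimes>\<^sub>M lborel)"
  proof -
    have "continuous_on UNIV (\<lambda>p. (\<lambda>(s, t). k s t) (snd p, fst p))"
      by (intro continuous_on_compose2[OF cont] continuous_intros) auto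
    then have "(\<lambda>p. (\<lambda>(s, t). k s t) (snd p, fst p)) \<in> borel_measurable (borel :: ('a \<times> 'a) measure)"
      by (rule borel_measurable_continuous_onI)
    then show ?thesis by (simp add: case_prod_unfold borel_prod[symmetric])
  qed
  have m2 [measurable]: "(\<lambda>(t, z). k (z - t) t) \<in> borel_measurable (lborel \<Otimes>\<^sub>M lborel)"
  proof -
    have "continuous_on UNIV (\<lambda>p. (\<lambda>(s, t). k s t) (snd p - fst p, fst p))"
      by (intro continuous_on_compose2[OF cont] continuous_intros) auto
    then have "(\<lambda>p. (\<lambda>(s, t). k s t) (snd p - fst p, fst p)) \<in> borel_measurable (borel :: ('a \<times> 'a) measure)"
      by (rule borel_measurable_continuous_onI)
    then show ?thesis by (simp add: case_prod_unfold borel_prod[symmetric])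
  qed
  have mk: "(\<lambda>t. k s t) \<in> borel_measurable borel" "(\<lambda>s. k s t) \<in> borel_measurable borel" for s t
    using continuous_on_compose2[OF cont, of UNIV "\<lambda>t. (s, t)"] continuous_on_compose2[OF cont, of UNIV "\<lambda>s. (s, t)"]
    by (auto intro!: borel_measurable_continuous_onI continuous_intros)
  have shift: "(LINT z|lborel. H (z - c)) = (LINT z|lborel. H z)" "integrable lborel H \<Longrightarrow> integrable lborel (\<lambda>z. H (z - c))"
    if "H \<in> borel_measurable borel" for H :: "'a \<Rightarrow> real" and c
  proof -
    have eq: "distr lborel borel (\<lambda>x::'a. - c + x) = lborel"
      using lborel_affine[of 1 "- c"] by (simp add: density_1)
    have "(LINT z|distr lborel borel (\<lambda>x::'a. - c + x). H z) = (LINT z|lborel. H (- c + z))"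
      using that by (subst integral_distr) auto
    then show "(LINT z|lborel. H (z - c)) = (LINT z|lborel. H z)" unfolding eq by simp
    assume "integrable lborel H"
    then have "integrable (distr lborel borel (\<lambda>x::'a. - c + x)) H" unfolding eq .
    then show "integrable lborel (\<lambda>z. H (z - c))"
      using that by (subst (asm) integrable_distr_eq) auto
  qed
  have int_s: "integrable lborel (\<lambda>s. k s t)" for t
    by (rule Bochner_Integration.integrable_bound[OF integrable_mult_left[OF P, of "Q t"]])
       (use mk in \<open>auto intro!: order_trans[OF bound]\<close>)
  have abs_le: "(LINT s|lborel. \<bar>k s t\<bar>) \<le> (LINT s|lborel. P s) * Q t" for t
  proof -
    have "(LINT s|lborel. \<bar>k s t\<bar>) \<le> (LINT s|lborel. P s * Q t)"
      using int_s P by (intro integral_mono integrable_abs bound) auto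
    then show ?thesis by simp
  qed
  have int_abs: "integrable lborel (\<lambda>t. LINT s|lborel. \<bar>k s t\<bar>)"
  proof (rule Bochner_Integration.integrable_bound[OF integrable_mult_right[OF Q, of "LINT s|lborel. P s"]])
    have "(\<lambda>(t, s). \<bar>k s t\<bar>) \<in> borel_measurable (lborel \<Otimes>\<^sub>M lborel)" by measurable
    then have "(\<lambda>t. LINT s|lborel. \<bar>k s t\<bar>) \<in> borel_measurable lborel"
      by (rule lborel.borel_measurable_lebesgue_integral)
    then show "(\<lambda>t. LINT s|lborel. \<bar>k s t\<bar>) \<in> borel_measurable lborel" .
    show "AE t in lborel. norm (LINT s|lborel. \<bar>k s t\<bar>) \<le> norm ((LINT s|lborel. P s) * Q t)"
    proof (rule AE_I2)
      fix t
      have "0 \<le> (LINT s|lborel. \<bar>k s t\<bar>)" by (rule Bochner_Integration.integral_nonneg) simp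
      with abs_le[of t] show "norm (LINT s|lborel. \<bar>k s t\<bar>) \<le> norm ((LINT s|lborel. P s) * Q t)" by simp
    qed
  qed
  have int1: "integrable (lborel \<Otimes>\<^sub>M lborel) (\<lambda>(t, s). k s t)"
    by (rule lborel_pair.Fubini_integrable) (use m1 int_abs int_s in auto)
  have int2: "integrable (lborel \<Otimes>\<^sub>M lborel) (\<lambda>(t, z). k (z - t) t)"
  proof (rule lborel_pair.Fubini_integrable)
    show "integrable lborel (\<lambda>t. LINT z|lborel. norm (case (t, z) of (t, z) \<Rightarrow> k (z - t) t))"
      using int_abs by (simp add: shift(1)[OF borel_measurable_abs[OF mk(2)]])
    show "AE t in lborel. integrable lborel (\<lambda>z. case (t, z) of (t, z) \<Rightarrow> k (z - t) t)"
      using shift(2)[OF mk(2) int_s] by (intro AE_I2) simp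
  qed (fact m2)
  have inner: "(LINT z'|lborel. k ((1/2) *\<^sub>R (z + z')) ((1/2) *\<^sub>R (z - z'))) = 2 ^ DIM('a) * (LINT t|lborel. k (z - t) t)" for z
  proof -
    have "continuous_on UNIV (\<lambda>z'. (\<lambda>(s, t). k s t) ((1/2) *\<^sub>R (z + z'), (1/2) *\<^sub>R (z - z')))"
      by (intro continuous_on_compose2[OF cont] continuous_intros) auto
    then have [measurable]: "(\<lambda>z'. k ((1/2) *\<^sub>R (z + z')) ((1/2) *\<^sub>R (z - z'))) \<in> borel_measurable borel"
      by (auto intro: borel_measurable_continuous_onI)
    have eq: "lborel = density (distr lborel borel (\<lambda>x::'a. z + (-2) *\<^sub>R x)) (\<lambda>_. ennreal (2 ^ DIM('a)))"
      using lborel_affine[of "-2" z] by simp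
    have "(LINT z'|lborel. k ((1/2) *\<^sub>R (z + z')) ((1/2) *\<^sub>R (z - z'))) =
       (LINT z'|density (distr lborel borel (\<lambda>x::'a. z + (-2) *\<^sub>R x)) (\<lambda>_. ennreal (2 ^ DIM('a))). k ((1/2) *\<^sub>R (z + z')) ((1/2) *\<^sub>R (z - z')))"
      by (subst (1) eq) rule
    also have "\<dots> = (LINT t|lborel. 2 ^ DIM('a) * k ((1/2) *\<^sub>R (z + (z + (-2) *\<^sub>R t))) ((1/2) *\<^sub>R (z - (z + (-2) *\<^sub>R t))))"
      by (subst integral_density) (auto simp: integral_distr)
    also have "\<dots> = 2 ^ DIM('a) * (LINT t|lborel. k (z - t) t)"
      by (simp add: algebra_simps scaleR_2[symmetric])
    finally show ?thesis .
  qed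
  have "(LINT z|lborel. LINT z'|lborel. k ((1/2) *\<^sub>R (z + z')) ((1/2) *\<^sub>R (z - z'))) = 2 ^ DIM('a) * (LINT z|lborel. LINT t|lborel. k (z - t) t)"
    unfolding inner by simp
  also have "(LINT z|lborel. LINT t|lborel. k (z - t) t) = (LINT t|lborel. LINT z|lborel. k (z - t) t)"
    by (rule lborel_pair.Fubini_integral[OF int2])
  also have "\<dots> = (LINT t|lborel. LINT s|lborel. k s t)"
    by (simp only: shift(1)[OF mk(2)])
  also have "\<dots> = (LINT s|lborel. LINT t|lborel. k s t)"
    by (rule lborel_pair.Fubini_integral[OF int1, symmetric])
  finally show ?thesis
    using nonneg by (simp add: Bochner_Integration.integral_nonneg)
qed

section \<open>Covariances of the spins and bounds on the derivative of \<open>v\<close>\<close>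

context spin_system
begin

definition cov_under :: "real^'n \<Rightarrow> real^'n \<Rightarrow> (real^'n \<Rightarrow> real) \<Rightarrow> (real^'n \<Rightarrow> real) \<Rightarrow> real" where
  "cov_under \<phi> \<theta> F G = expect \<phi> \<theta> (\<lambda>z. F z * G z) - expect \<phi> \<theta> F * expect \<phi> \<theta> G"

definition cov :: "real^'n \<Rightarrow> real^'n \<Rightarrow> 'n \<Rightarrow> 'n \<Rightarrow> real" where
  "cov \<phi> \<theta> x y = cov_under \<phi> \<theta> (\<lambda>z. (\<phi> + \<theta> * z) $ x) (\<lambda>z. (\<phi> + \<theta> * z) $ y)"

text \<open>\<open>dv \<phi> \<theta> x y\<close> is the derivative of \<open>v \<phi> \<theta> x\<close> in the direction of \<open>\<phi> $ y\<close>.\<close>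

definition dv :: "real^'n \<Rightarrow> real^'n \<Rightarrow> 'n \<Rightarrow> 'n \<Rightarrow> real" where
  "dv \<phi> \<theta> x y = expect \<phi> \<theta> (\<lambda>z. ddS y x (\<phi> + \<theta> * z))
     - cov_under \<phi> \<theta> (\<lambda>z. dS x (\<phi> + \<theta> * z)) (\<lambda>z. dS y (\<phi> + \<theta> * z))"

lemma cov_eq_component: "cov \<phi> \<theta> x y = \<theta> $ x * \<theta> $ y * cov_under \<phi> \<theta> (\<lambda>z. z $ x) (\<lambda>z. z $ y)"
proof -
  have lin: "expect \<phi> \<theta> (\<lambda>z. (\<phi> + \<theta> * z) $ x) = \<phi> $ x + \<theta> $ x * expect \<phi> \<theta> (\<lambda>z. z $ x)" for x
    by (simp, subst expect_add) (auto simp: expect_const expect_cmult)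
  have "expect \<phi> \<theta> (\<lambda>z. (\<phi> + \<theta> * z) $ x * (\<phi> + \<theta> * z) $ y) =
    expect \<phi> \<theta> (\<lambda>z. \<phi> $ x * \<phi> $ y + (\<theta> $ x * \<phi> $ y) * z $ x + (\<theta> $ y * \<phi> $ x) * z $ y + (\<theta> $ x * \<theta> $ y) * (z $ x * z $ y))"
    by (simp add: algebra_simps)
  also have "\<dots> = \<phi> $ x * \<phi> $ y + (\<theta> $ x * \<phi> $ y) * expect \<phi> \<theta> (\<lambda>z. z $ x) + (\<theta> $ y * \<phi> $ x) * expect \<phi> \<theta> (\<lambda>z. z $ y) + (\<theta> $ x * \<theta> $ y) * expect \<phi> \<theta> (\<lambda>z. z $ x * z $ y)"
  proof -
    have g: "exp_growth (\<lambda>z. (\<theta> $ x * \<phi> $ y) * z $ x)" "exp_growth (\<lambda>z. (\<theta> $ y * \<phi> $ x) * z $ y)" "exp_growth (\<lambda>z. (\<theta> $ x * \<theta> $ y) * (z $ x * z $ y))"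
      by (auto intro!: exp_growth_mult)
    show ?thesis
      unfolding expect_add[OF exp_growth_add[OF exp_growth_add[OF exp_growth_const g(1)] g(2)] g(3)]
        expect_add[OF exp_growth_add[OF exp_growth_const g(1)] g(2)] expect_add[OF exp_growth_const g(1)] expect_const expect_cmult ..
  qed
  finally show ?thesis
    unfolding cov_def cov_under_def lin by (simp add: algebra_simps)
qed

text \<open>Two integrations by parts: in \<open>z $ y\<close> against \<open>z $ x\<close>, which
  leaves the mixed moment of \<open>z $ x\<close> and \<open>dS y\<close>, then in
  \<open>z $ x\<close> against \<open>dS y\<close>.\<close>

lemma cov_component: "cov_under \<phi> \<theta> (\<lambda>z. z $ x) (\<lambda>z. z $ y) = (if x = y then 1 else 0) - \<theta> $ x * \<theta> $ y * dv \<phi> \<theta> x y"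
proof -
  let ?dx = "\<lambda>z. dS x (\<phi> + \<theta> * z)" and ?dy = "\<lambda>z. dS y (\<phi> + \<theta> * z)"
  have gx: "exp_growth (\<lambda>z. z $ x * z $ y)" "exp_growth (\<lambda>z. \<theta> $ y * (z $ x * ?dy z))"
      "exp_growth (\<lambda>z. ?dy z * z $ x)" "exp_growth (\<lambda>z. \<theta> $ x * (?dy z * ?dx z))"
    by (auto intro!: exp_growth_mult)
  have "expect \<phi> \<theta> (\<lambda>_. if x = y then 1 else 0) = expect \<phi> \<theta> (\<lambda>z. z $ x * (z $ y + \<theta> $ y * ?dy z))"
  proof (rule integration_by_parts)
    show "((\<lambda>t. (z + t *\<^sub>R axis y 1) $ x) has_real_derivative (if x = y then 1 else 0)) (at 0)" for z :: "real^'n"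
      by (auto simp: axis_def intro!: derivative_eq_intros)
  qed auto
  also have "\<dots> = expect \<phi> \<theta> (\<lambda>z. z $ x * z $ y + \<theta> $ y * (z $ x * ?dy z))" by (simp add: algebra_simps)
  also have "\<dots> = expect \<phi> \<theta> (\<lambda>z. z $ x * z $ y) + \<theta> $ y * expect \<phi> \<theta> (\<lambda>z. z $ x * ?dy z)"
    unfolding expect_add[OF gx(1,2)] expect_cmult ..
  finally have 1: "expect \<phi> \<theta> (\<lambda>z. z $ x * z $ y) = (if x = y then 1 else 0) - \<theta> $ y * expect \<phi> \<theta> (\<lambda>z. z $ x * ?dy z)"
    by (simp add: expect_const)
  have "expect \<phi> \<theta> (\<lambda>z. \<theta> $ x * ddS y x (\<phi> + \<theta> * z)) = expect \<phi> \<theta> (\<lambda>z. ?dy z * (z $ x + \<theta> $ x * ?dx z))"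
  proof (rule integration_by_parts)
    show "((\<lambda>t. dS y (\<phi> + \<theta> * (z + t *\<^sub>R axis x 1))) has_real_derivative (\<theta> $ x * ddS y x (\<phi> + \<theta> * z))) (at 0)" for z
      unfolding shift_axis by (rule dS_deriv)
  qed (auto intro!: exp_growth_mult)
  also have "\<dots> = expect \<phi> \<theta> (\<lambda>z. ?dy z * z $ x + \<theta> $ x * (?dy z * ?dx z))" by (simp add: algebra_simps)
  also have "\<dots> = expect \<phi> \<theta> (\<lambda>z. z $ x * ?dy z) + \<theta> $ x * expect \<phi> \<theta> (\<lambda>z. ?dx z * ?dy z)"
    unfolding expect_add[OF gx(3,4)] expect_cmult by (simp add: mult.commute)
  finally have 2: "expect \<phi> \<theta> (\<lambda>z. z $ x * ?dy z) = \<theta> $ x * expect \<phi> \<theta> (\<lambda>z. ddS y x (\<phi> + \<theta> * z)) - \<theta> $ x * expect \<phi> \<theta> (\<lambda>z. ?dx z * ?dy z)"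
    by (simp add: expect_cmult)
  show ?thesis
    unfolding cov_under_def 1 2 dv_def expect_component v_def by (simp add: algebra_simps)
qed

text \<open>At two different active sites a nonnegative covariance therefore means
  \<open>dv \<phi> \<theta> x y \<le> 0\<close>, which is the cooperativity of the parabolic
  system.\<close>

lemma cov_eq: "cov \<phi> \<theta> x y = (if x = y then (\<theta> $ x)\<^sup>2 else 0) - (\<theta> $ x)\<^sup>2 * (\<theta> $ y)\<^sup>2 * dv \<phi> \<theta> x y"
  unfolding cov_eq_component cov_component by (auto simp: power2_eq_square algebra_simps)

lemma expect_square_ge:
  assumes g: "exp_growth F" shows "(expect \<phi> \<theta> F)\<^sup>2 \<le> expect \<phi> \<theta> (\<lambda>z. (F z)\<^sup>2)"
proof -
  let ?m = "expect \<phi> \<theta> F"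
  have "expect \<phi> \<theta> (\<lambda>_. 0) \<le> expect \<phi> \<theta> (\<lambda>z. (F z)\<^sup>2 - (2 * ?m) * F z + ?m\<^sup>2)"
  proof (intro expect_mono)
    show "0 \<le> (F z)\<^sup>2 - (2 * ?m) * F z + ?m\<^sup>2" for z
      using zero_le_power2[of "F z - ?m"] by (simp add: power2_diff algebra_simps)
  qed (intro exp_growth_add exp_growth_diff exp_growth_mult exp_growth_power g exp_growth_const)+
  also have "\<dots> = expect \<phi> \<theta> (\<lambda>z. (F z)\<^sup>2) - (2 * ?m) * ?m + ?m\<^sup>2"
    unfolding expect_add[OF exp_growth_diff[OF exp_growth_power[OF g] exp_growth_mult[OF exp_growth_const g]] exp_growth_const]
      expect_diff[OF exp_growth_power[OF g] exp_growth_mult[OF exp_growth_const g]] expect_cmult expect_const ..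
  finally show ?thesis by (simp add: expect_const power2_eq_square)
qed

text \<open>A covariance ignores additive constants. Subtracting values at a well chosen point
  leaves only fluctuations, and \<open>2 a b \<le> a\<^sup>2 + b\<^sup>2\<close> does the
  rest.\<close>

lemma cov_under_bound:
  assumes g: "exp_growth F" "exp_growth G"
  shows "\<bar>cov_under \<phi> \<theta> F G\<bar> \<le> expect \<phi> \<theta> (\<lambda>z. (F z - c)\<^sup>2) + expect \<phi> \<theta> (\<lambda>z. (G z - d)\<^sup>2)"
proof -
  let ?F = "\<lambda>z. F z - c" and ?G = "\<lambda>z. G z - d"
  have g': "exp_growth ?F" "exp_growth ?G" using g by auto
  have eF: "expect \<phi> \<theta> ?F = expect \<phi> \<theta> F - c" by (simp add: expect_diff g expect_const)
  have eG: "expect \<phi> \<theta> ?G = expect \<phi> \<theta> G - d" by (simp add: expect_diff g expect_const)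
  have "expect \<phi> \<theta> (\<lambda>z. ?F z * ?G z) = expect \<phi> \<theta> (\<lambda>z. F z * G z - d * F z - c * G z + c * d)"
    by (simp add: algebra_simps)
  also have "\<dots> = expect \<phi> \<theta> (\<lambda>z. F z * G z) - d * expect \<phi> \<theta> F - c * expect \<phi> \<theta> G + c * d"
  proof -
    have h: "exp_growth (\<lambda>z. F z * G z)" "exp_growth (\<lambda>z. d * F z)" "exp_growth (\<lambda>z. c * G z)"
      using g by (auto intro!: exp_growth_mult)
    show ?thesis
      unfolding expect_add[OF exp_growth_diff[OF exp_growth_diff[OF h(1,2)] h(3)] exp_growth_const]
        expect_diff[OF exp_growth_diff[OF h(1,2)] h(3)] expect_diff[OF h(1,2)] expect_cmult expect_const ..
  qed
  finally have cov: "cov_under \<phi> \<theta> F G = expect \<phi> \<theta> (\<lambda>z. ?F z * ?G z) - expect \<phi> \<theta> ?F * expect \<phi> \<theta> ?G"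
    unfolding cov_under_def eF eG by (simp add: algebra_simps)
  have g2: "exp_growth (\<lambda>z. 1/2 * (?F z)\<^sup>2)" "exp_growth (\<lambda>z. 1/2 * (?G z)\<^sup>2)"
    using g' by (auto intro!: exp_growth_mult exp_growth_power)
  have up: "expect \<phi> \<theta> (\<lambda>z. 1/2 * (?F z)\<^sup>2 + 1/2 * (?G z)\<^sup>2) = 1/2 * expect \<phi> \<theta> (\<lambda>z. (?F z)\<^sup>2) + 1/2 * expect \<phi> \<theta> (\<lambda>z. (?G z)\<^sup>2)"
    unfolding expect_add[OF g2] expect_cmult ..
  have am: "a * b \<le> 1/2 * a\<^sup>2 + 1/2 * b\<^sup>2" "(-1) * (a * b) \<le> 1/2 * a\<^sup>2 + 1/2 * b\<^sup>2" for a b :: real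
    using zero_le_power2[of "a - b"] zero_le_power2[of "a + b"] by (auto simp: power2_diff power2_sum)
  have "expect \<phi> \<theta> (\<lambda>z. ?F z * ?G z) \<le> expect \<phi> \<theta> (\<lambda>z. 1/2 * (?F z)\<^sup>2 + 1/2 * (?G z)\<^sup>2)"
    by (intro expect_mono am exp_growth_add g2 exp_growth_mult g')
  moreover have "(-1) * expect \<phi> \<theta> (\<lambda>z. ?F z * ?G z) \<le> expect \<phi> \<theta> (\<lambda>z. 1/2 * (?F z)\<^sup>2 + 1/2 * (?G z)\<^sup>2)"
    unfolding expect_cmult[symmetric] by (intro expect_mono am exp_growth_add g2 exp_growth_mult g' exp_growth_const)
  moreover have "\<bar>expect \<phi> \<theta> ?F * expect \<phi> \<theta> ?G\<bar> \<le> 1/2 * (expect \<phi> \<theta> ?F)\<^sup>2 + 1/2 * (expect \<phi> \<theta> ?G)\<^sup>2"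
    using am[of "expect \<phi> \<theta> ?F" "expect \<phi> \<theta> ?G"] by (simp add: abs_le_iff)
  ultimately show ?thesis
    unfolding cov up using expect_square_ge[OF g'(1), of \<phi> \<theta>] expect_square_ge[OF g'(2), of \<phi> \<theta>] by linarith
qed

lemma dv_bound:
  assumes \<Theta>: "\<Theta> \<ge> 0"
  shows "\<exists>K\<ge>0. \<forall>\<phi> \<theta> x y. (\<forall>i. \<bar>\<theta> $ i\<bar> \<le> \<Theta>) \<longrightarrow> \<bar>dv \<phi> \<theta> x y\<bar> \<le> K"
proof -
  define K where "K = lip + 2 * ((lip * \<Theta>)\<^sup>2 * (CARD('n) * (2 + (B * \<Theta>)\<^sup>2)))"
  have "\<bar>dv \<phi> \<theta> x y\<bar> \<le> K" if \<theta>: "\<And>i. \<bar>\<theta> $ i\<bar> \<le> \<Theta>" for \<phi> \<theta> x y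
  proof -
    \<comment> \<open>Comparing \<open>dS\<close> with its value at the mean of \<open>z\<close>
      brings in \<open>variance_bound\<close>, so the resulting constant is free of
      \<open>\<phi>\<close>.\<close>
    define a where "a = (\<chi> i. expect \<phi> \<theta> (\<lambda>z. z $ i))"
    have sq: "expect \<phi> \<theta> (\<lambda>z. (dS x (\<phi> + \<theta> * z) - dS x (\<phi> + \<theta> * a))\<^sup>2) \<le> (lip * \<Theta>)\<^sup>2 * (CARD('n) * (2 + (B * \<Theta>)\<^sup>2))" for x
    proof -
      have "expect \<phi> \<theta> (\<lambda>z. (dS x (\<phi> + \<theta> * z) - dS x (\<phi> + \<theta> * a))\<^sup>2) \<le> expect \<phi> \<theta> (\<lambda>z. (lip * \<Theta>)\<^sup>2 * (\<Sum>i\<in>UNIV. (z $ i - a $ i)\<^sup>2))"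
      proof (intro expect_mono)
        fix z :: "real^'n"
        have "norm ((\<phi> + \<theta> * z) - (\<phi> + \<theta> * a)) \<le> norm (\<Theta> *\<^sub>R (z - a))"
          using \<theta> \<Theta> by (intro norm_le_componentwise_cart) (auto simp: right_diff_distrib[symmetric] abs_mult intro!: mult_right_mono)
        also have "\<dots> = \<Theta> * norm (z - a)" using \<Theta> by simp
        finally have "\<bar>dS x (\<phi> + \<theta> * z) - dS x (\<phi> + \<theta> * a)\<bar> \<le> (lip * \<Theta>) * norm (z - a)"
          using dS_lipschitz[of x "\<phi> + \<theta> * z" "\<phi> + \<theta> * a"] lip_nonneg
          by (metis (no_types, lifting) mult.assoc mult_left_mono order_trans)
        then have "(dS x (\<phi> + \<theta> * z) - dS x (\<phi> + \<theta> * a))\<^sup>2 \<le> ((lip * \<Theta>) * norm (z - a))\<^sup>2"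
          by (metis abs_ge_zero power2_abs power_mono)
        also have "\<dots> = (lip * \<Theta>)\<^sup>2 * (\<Sum>i\<in>UNIV. (z $ i - a $ i)\<^sup>2)"
          unfolding power_mult_distrib by (simp add: norm_vec_def L2_set_def sum_nonneg)
        finally show "(dS x (\<phi> + \<theta> * z) - dS x (\<phi> + \<theta> * a))\<^sup>2 \<le> (lip * \<Theta>)\<^sup>2 * (\<Sum>i\<in>UNIV. (z $ i - a $ i)\<^sup>2)" .
      qed (intro exp_growth_mult exp_growth_const exp_growth_sum exp_growth_power exp_growth_diff exp_growth_component exp_growth_dS)+
      also have "\<dots> = (lip * \<Theta>)\<^sup>2 * (\<Sum>i\<in>UNIV. expect \<phi> \<theta> (\<lambda>z. (z $ i - a $ i)\<^sup>2))"
        unfolding expect_cmult by (subst expect_sum) (auto intro!: exp_growth_power)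
      also have "\<dots> \<le> (lip * \<Theta>)\<^sup>2 * (CARD('n) * (2 + (B * \<Theta>)\<^sup>2))"
        by (intro mult_left_mono variance_bound \<theta>) (auto simp: a_def)
      finally show ?thesis .
    qed
    have "\<bar>cov_under \<phi> \<theta> (\<lambda>z. dS x (\<phi> + \<theta> * z)) (\<lambda>z. dS y (\<phi> + \<theta> * z))\<bar> \<le> 2 * ((lip * \<Theta>)\<^sup>2 * (CARD('n) * (2 + (B * \<Theta>)\<^sup>2)))"
      using cov_under_bound[of "\<lambda>z. dS x (\<phi> + \<theta> * z)" "\<lambda>z. dS y (\<phi> + \<theta> * z)" \<phi> \<theta> "dS x (\<phi> + \<theta> * a)" "dS y (\<phi> + \<theta> * a)"] sq[of x] sq[of y]
      by simp
    moreover have "\<bar>expect \<phi> \<theta> (\<lambda>z. ddS y x (\<phi> + \<theta> * z))\<bar> \<le> lip"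
    proof -
      have "expect \<phi> \<theta> (\<lambda>z. ddS y x (\<phi> + \<theta> * z)) \<le> expect \<phi> \<theta> (\<lambda>_. lip)"
        by (intro expect_mono exp_growth_ddS exp_growth_const order_trans[OF abs_ge_self ddS_bound])
      moreover have "expect \<phi> \<theta> (\<lambda>_. - lip) \<le> expect \<phi> \<theta> (\<lambda>z. ddS y x (\<phi> + \<theta> * z))"
      proof (intro expect_mono exp_growth_ddS exp_growth_const)
        show "- lip \<le> ddS y x (\<phi> + \<theta> * z)" for z using ddS_bound[of y x "\<phi> + \<theta> * z"] by linarith
      qed
      ultimately show ?thesis by (simp add: expect_const)
    qed
    ultimately show ?thesis unfolding dv_def K_def by linarith
  qed
  moreover have "K \<ge> 0" unfolding K_def using lip_nonneg by (intro add_nonneg_nonneg mult_nonneg_nonneg) auto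
  ultimately show ?thesis by blast
qed

end

lemma norm_square_midpoint: "(norm (s + t))\<^sup>2 + (norm (s - t))\<^sup>2 = 2 * (norm s)\<^sup>2 + 2 * (norm (t::'a::real_inner))\<^sup>2"
  by (simp add: power2_norm_eq_inner inner_add_left inner_add_right inner_diff_left inner_diff_right)

context spin_system
begin

lemma S_midpoint:
  "S (a + b) + S (a - b) = a \<bullet> (A *v a) + b \<bullet> (A *v b) + (\<Sum>i\<in>UNIV. V i (a $ i + b $ i) + V i (a $ i - b $ i))"
  unfolding S_def by (simp add: matrix_vector_right_distrib matrix_vector_mult_diff_distrib inner_add_left inner_add_right
      inner_diff_left inner_diff_right sum.distrib algebra_simps)

text \<open>Diagonal terms are even in a single coordinate and join the one-site weights; the pair
  interactions that are left have the ferromagnetic sign.\<close>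

lemma quadratic_off_diagonal:
  "b \<bullet> (A *v b) = (\<Sum>(i,j)\<in>{p. fst p \<noteq> snd p}. A $ i $ j * (b $ i * b $ j)) + (\<Sum>i\<in>UNIV. A $ i $ i * (b $ i)\<^sup>2)"
proof -
  have "b \<bullet> (A *v b) = (\<Sum>i\<in>UNIV. \<Sum>j\<in>UNIV. A $ i $ j * (b $ i * b $ j))"
    by (simp add: inner_vec_def matrix_vector_mult_def sum_distrib_left mult_ac)
  also have "\<dots> = (\<Sum>(i,j)\<in>UNIV. A $ i $ j * (b $ i * b $ j))"
    by (simp add: sum.cartesian_product)
  also have "\<dots> = (\<Sum>(i,j)\<in>{p. fst p \<noteq> snd p}. A $ i $ j * (b $ i * b $ j)) + (\<Sum>(i,j)\<in>{p. fst p = snd p}. A $ i $ j * (b $ i * b $ j))"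
    by (subst sum.union_disjoint[symmetric]) (auto intro!: sum.cong)
  also have "(\<Sum>(i,j)\<in>{p. fst p = snd p}. A $ i $ j * (b $ i * b $ j)) = (\<Sum>i\<in>UNIV. A $ i $ i * (b $ i)\<^sup>2)"
    by (rule sum.reindex_bij_witness[of _ "\<lambda>i. (i, i)" fst]) (auto simp: power2_eq_square)
  finally show ?thesis .
qed

text \<open>For two copies \<open>s + t\<close> and \<open>s - t\<close> of the field, the joint weight at fixed \<open>s\<close> is a product of even
  functions of the \<open>t $ i\<close> and of ferromagnetic pair interactions.\<close>

lemma cov_component_nonneg:
  assumes \<theta>: "\<And>i. 0 \<le> \<theta> $ i" and xy: "x \<noteq> y"
  shows "0 \<le> cov_under \<phi> \<theta> (\<lambda>z. z $ x) (\<lambda>z. z $ y)"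
proof -
  define W where "W z = bw \<phi> \<theta> z * gauss z" for z
  \<comment> \<open>With \<open>z = s + t\<close> and \<open>z' = s - t\<close> the prefactor is
    \<open>(z $ x - z' $ x) * (z $ y - z' $ y)\<close>. Its double integral is twice the covariance,
    up to the square of the normalisation.\<close>
  define k where "k s t = 4 * (t $ x * t $ y) * (W (s + t) * W (s - t))" for s t :: "real^'n"
  define N where "N = real CARD('n) * C"
  have Wcont: "continuous_on UNIV W"
    unfolding W_def by (intro continuous_intros exp_growth_continuous[OF exp_growth_bw])
  have gg: "gauss (s + t) * gauss (s - t) = exp (- (norm s)\<^sup>2) * exp (- (norm t)\<^sup>2)" for s t :: "real^'n"
    using norm_square_midpoint[of s t] by (simp add: gauss_def exp_add[symmetric] field_simps)
  have g2: "exp (- (norm s)\<^sup>2) = gauss s * gauss s" for s :: "real^'n"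
    by (simp add: gauss_def exp_add[symmetric])
  have ggrow: "exp_growth (gauss :: real^'n \<Rightarrow> real)"
    by (rule exp_growth_bounded[of _ 1]) (auto intro!: continuous_gauss, simp add: gauss_def)
  have Wbound: "W (s + t) * W (s - t) \<le> exp (2 * N) * (exp (- (norm s)\<^sup>2) * exp (- (norm t)\<^sup>2))" for s t
  proof -
    have "bw \<phi> \<theta> (s + t) * bw \<phi> \<theta> (s - t) \<le> exp N * exp N"
      unfolding N_def by (intro mult_mono bw_le) (auto simp: less_imp_le)
    then have "(bw \<phi> \<theta> (s + t) * bw \<phi> \<theta> (s - t)) * (gauss (s + t) * gauss (s - t)) \<le> (exp N * exp N) * (gauss (s + t) * gauss (s - t))"
      by (intro mult_right_mono) (auto simp: less_imp_le)
    moreover have "W (s + t) * W (s - t) = (bw \<phi> \<theta> (s + t) * bw \<phi> \<theta> (s - t)) * (gauss (s + t) * gauss (s - t))"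
      by (simp add: W_def)
    moreover have "exp (2 * N) = exp N * exp N" using exp_add[of N N] by (simp only: mult_2)
    ultimately show ?thesis by (simp only: gg)
  qed
  have Wpos: "0 < W z" for z by (simp add: W_def)
  have main: "0 \<le> (LINT z|lborel. LINT z'|lborel. k ((1/2) *\<^sub>R (z + z')) ((1/2) *\<^sub>R (z - z')))"
  proof (rule double_integral_midpoint_nonneg)
    have "continuous_on UNIV (\<lambda>p::(real^'n) \<times> (real^'n). 4 * (snd p $ x * snd p $ y) * (W (fst p + snd p) * W (fst p - snd p)))"
      by (intro continuous_intros continuous_on_compose2[OF Wcont]) auto
    then show "continuous_on UNIV (\<lambda>(s, t). k s t)" by (simp add: k_def case_prod_unfold)
    show "integrable lborel (\<lambda>s::real^'n. 4 * exp (2 * N) * exp (- (norm s)\<^sup>2))"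
      unfolding g2 by (intro integrable_mult_right integrable_exp_growth ggrow)
    show "integrable lborel (\<lambda>t::real^'n. \<bar>t $ x * t $ y\<bar> * exp (- (norm t)\<^sup>2))"
      unfolding g2 mult.assoc[symmetric]
      by (intro integrable_exp_growth exp_growth_mult exp_growth_abs ggrow exp_growth_component)
    fix s t :: "real^'n"
    have "\<bar>k s t\<bar> = 4 * \<bar>t $ x * t $ y\<bar> * (W (s + t) * W (s - t))"
      unfolding k_def abs_mult using Wpos by (simp add: abs_of_pos)
    also have "\<dots> \<le> 4 * \<bar>t $ x * t $ y\<bar> * (exp (2 * N) * (exp (- (norm s)\<^sup>2) * exp (- (norm t)\<^sup>2)))"
      by (intro mult_left_mono Wbound) auto
    finally show "\<bar>k s t\<bar> \<le> 4 * exp (2 * N) * exp (- (norm s)\<^sup>2) * (\<bar>t $ x * t $ y\<bar> * exp (- (norm t)\<^sup>2))"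
      by (simp add: mult_ac)
  next
    fix s :: "real^'n"
    define a where "a = \<phi> + \<theta> * s"
    \<comment> \<open>All factors that contain a single coordinate of \<open>t\<close>. The sign
      change \<open>r \<mapsto> - r\<close> exchanges the two copies of \<open>V i\<close>, so
      \<open>w i\<close> is even although \<open>a $ i\<close> need not vanish.\<close>
    define w where "w i r = exp (- (A $ i $ i * (\<theta> $ i)\<^sup>2 * r\<^sup>2) - r\<^sup>2 - V i (a $ i + \<theta> $ i * r) - V i (a $ i - \<theta> $ i * r))" for i r
    define c where "c = 4 * exp (- (a \<bullet> (A *v a)) - (norm s)\<^sup>2)"
    have k: "k s t = c * (t $ x * t $ y * exp (\<Sum>(i,j)\<in>{p. fst p \<noteq> snd p}. (- A $ i $ j * \<theta> $ i * \<theta> $ j) * (t $ i * t $ j)) * (\<Prod>i\<in>UNIV. w i (t $ i)))" for t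
    proof -
      have ab: "\<phi> + \<theta> * (s + t) = a + \<theta> * t" "\<phi> + \<theta> * (s - t) = a - \<theta> * t"
        by (auto simp: a_def vec_eq_iff algebra_simps)
      have "(norm t)\<^sup>2 = (\<Sum>i\<in>UNIV. (t $ i)\<^sup>2)"
        by (simp add: norm_vec_def L2_set_def sum_nonneg)
      moreover have "S (a + \<theta> * t) + S (a - \<theta> * t) = a \<bullet> (A *v a) + (\<Sum>(i,j)\<in>{p. fst p \<noteq> snd p}. A $ i $ j * \<theta> $ i * \<theta> $ j * (t $ i * t $ j))
          + (\<Sum>i\<in>UNIV. A $ i $ i * (\<theta> $ i)\<^sup>2 * (t $ i)\<^sup>2) + (\<Sum>i\<in>UNIV. V i (a $ i + \<theta> $ i * t $ i) + V i (a $ i - \<theta> $ i * t $ i))"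
        unfolding S_midpoint quadratic_off_diagonal[of "\<theta> * t"] by (simp add: mult_ac power_mult_distrib case_prod_unfold)
      ultimately have "exp (- S (a + \<theta> * t)) * exp (- S (a - \<theta> * t)) * (exp (- (norm s)\<^sup>2) * exp (- (norm t)\<^sup>2)) =
        exp (- (a \<bullet> (A *v a)) - (norm s)\<^sup>2) * (exp (\<Sum>(i,j)\<in>{p. fst p \<noteq> snd p}. (- A $ i $ j * \<theta> $ i * \<theta> $ j) * (t $ i * t $ j)) * (\<Prod>i\<in>UNIV. w i (t $ i)))"
        unfolding w_def exp_sum[OF finite, symmetric] exp_add[symmetric]
        by (simp add: sum.distrib sum_subtractf sum_negf case_prod_unfold algebra_simps)
      moreover have "W (s + t) * W (s - t) = exp (- S (a + \<theta> * t)) * exp (- S (a - \<theta> * t)) * (gauss (s + t) * gauss (s - t))"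
        unfolding W_def bw_def ab by (simp only: mult_ac)
      ultimately show ?thesis
        unfolding k_def c_def gg by (simp only: mult_ac)
    qed
    have "0 \<le> (LINT t|lborel. t $ x * t $ y * exp (\<Sum>(i,j)\<in>{p. fst p \<noteq> snd p}. (- A $ i $ j * \<theta> $ i * \<theta> $ j) * (t $ i * t $ j)) * (\<Prod>i\<in>UNIV. w i (t $ i)))"
    proof (rule griffiths_first)
      show "0 \<le> - A $ i $ j * \<theta> $ i * \<theta> $ j" if "(i, j) \<in> {p. fst p \<noteq> snd p}" for i j
      proof (intro mult_nonneg_nonneg \<theta>)
        show "0 \<le> - A $ i $ j" using A_ferro[of i j] that by simp
      qed
    qed (auto simp: w_def)
    then show "0 \<le> (LINT t|lborel. k s t)" unfolding k by (simp add: c_def)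
  qed
  have keq: "k ((1/2) *\<^sub>R (z + z')) ((1/2) *\<^sub>R (z - z')) = W z * ((z $ x * z $ y - z $ x * z' $ y - z $ y * z' $ x + z' $ x * z' $ y) * W z')" for z z'
  proof -
    have "(1/2) *\<^sub>R (z + z') + (1/2) *\<^sub>R (z - z') = z" "(1/2) *\<^sub>R (z + z') - (1/2) *\<^sub>R (z - z') = z'"
      by (simp_all add: vec_eq_iff field_simps)
    then show ?thesis unfolding k_def by (simp add: algebra_simps)
  qed
  have ieq: "(LINT z'|lborel. W z * ((z $ x * z $ y - z $ x * z' $ y - z $ y * z' $ x + z' $ x * z' $ y) * W z')) =
      W z * (z $ x * z $ y * gint \<phi> \<theta> (\<lambda>_. 1) - z $ x * gint \<phi> \<theta> (\<lambda>z. z $ y) - z $ y * gint \<phi> \<theta> (\<lambda>z. z $ x) + gint \<phi> \<theta> (\<lambda>z. z $ x * z $ y))" for z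
  proof -
    have g: "exp_growth (\<lambda>z'. z $ x * z $ y * 1)" "exp_growth (\<lambda>z'. z $ x * z' $ y)" "exp_growth (\<lambda>z'. z $ y * z' $ x)" "exp_growth (\<lambda>z'. z' $ x * z' $ y)"
      by (auto intro!: exp_growth_mult)
    have "(LINT z'|lborel. (z $ x * z $ y - z $ x * z' $ y - z $ y * z' $ x + z' $ x * z' $ y) * W z') =
      gint \<phi> \<theta> (\<lambda>z'. z $ x * z $ y * 1 - z $ x * z' $ y - z $ y * z' $ x + z' $ x * z' $ y)"
      unfolding gint_def W_def by (simp add: mult.assoc)
    also have "\<dots> = z $ x * z $ y * gint \<phi> \<theta> (\<lambda>_. 1) - z $ x * gint \<phi> \<theta> (\<lambda>z. z $ y) - z $ y * gint \<phi> \<theta> (\<lambda>z. z $ x) + gint \<phi> \<theta> (\<lambda>z. z $ x * z $ y)"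
      unfolding gint_add[OF exp_growth_diff[OF exp_growth_diff[OF g(1,2)] g(3)] g(4)]
        gint_diff[OF exp_growth_diff[OF g(1,2)] g(3)] gint_diff[OF g(1,2)] gint_cmult ..
    finally show ?thesis by simp
  qed
  have feq: "(LINT z|lborel. W z * (z $ x * z $ y * gint \<phi> \<theta> (\<lambda>_. 1) - z $ x * gint \<phi> \<theta> (\<lambda>z. z $ y) - z $ y * gint \<phi> \<theta> (\<lambda>z. z $ x) + gint \<phi> \<theta> (\<lambda>z. z $ x * z $ y)))
    = 2 * (gint \<phi> \<theta> (\<lambda>z. z $ x * z $ y) * gint \<phi> \<theta> (\<lambda>_. 1) - gint \<phi> \<theta> (\<lambda>z. z $ x) * gint \<phi> \<theta> (\<lambda>z. z $ y))"
  proof -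
    let ?a = "gint \<phi> \<theta> (\<lambda>_. 1)" and ?b = "gint \<phi> \<theta> (\<lambda>z. z $ y)" and ?c = "gint \<phi> \<theta> (\<lambda>z. z $ x)" and ?d = "gint \<phi> \<theta> (\<lambda>z. z $ x * z $ y)"
    have g: "exp_growth (\<lambda>z::real^'n. ?a * (z $ x * z $ y))" "exp_growth (\<lambda>z. ?b * z $ x)" "exp_growth (\<lambda>z. ?c * z $ y)" "exp_growth (\<lambda>z::real^'n. ?d * 1)"
      by (auto intro!: exp_growth_mult)
    have "(LINT z|lborel. W z * (z $ x * z $ y * ?a - z $ x * ?b - z $ y * ?c + ?d)) = gint \<phi> \<theta> (\<lambda>z. ?a * (z $ x * z $ y) - ?b * z $ x - ?c * z $ y + ?d * 1)"
      unfolding W_def by (subst (5) gint_def) (simp add: mult_ac)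
    also have "\<dots> = ?a * ?d - ?b * ?c - ?c * ?b + ?d * ?a"
      unfolding gint_add[OF exp_growth_diff[OF exp_growth_diff[OF g(1,2)] g(3)] g(4)]
        gint_diff[OF exp_growth_diff[OF g(1,2)] g(3)] gint_diff[OF g(1,2)] gint_cmult ..
    finally show ?thesis by (simp add: algebra_simps)
  qed
  have "0 \<le> gint \<phi> \<theta> (\<lambda>z. z $ x * z $ y) * gint \<phi> \<theta> (\<lambda>_. 1) - gint \<phi> \<theta> (\<lambda>z. z $ x) * gint \<phi> \<theta> (\<lambda>z. z $ y)"
    using main unfolding keq ieq feq by simp
  then have "0 \<le> (gint \<phi> \<theta> (\<lambda>z. z $ x * z $ y) * gint \<phi> \<theta> (\<lambda>_. 1) - gint \<phi> \<theta> (\<lambda>z. z $ x) * gint \<phi> \<theta> (\<lambda>z. z $ y)) / (gint \<phi> \<theta> (\<lambda>_. 1) * gint \<phi> \<theta> (\<lambda>_. 1))"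
    using gint_1_pos[of \<phi> \<theta>] by simp
  also have "\<dots> = cov_under \<phi> \<theta> (\<lambda>z. z $ x) (\<lambda>z. z $ y)"
    unfolding cov_under_def expect_def using gint_1_pos[of \<phi> \<theta>] by (simp add: field_simps)
  finally show ?thesis .
qed

lemma cov_nonneg:
  assumes "\<And>i. 0 \<le> \<theta> $ i" "x \<noteq> y" shows "0 \<le> cov \<phi> \<theta> x y"
  unfolding cov_eq_component using cov_component_nonneg[OF assms] assms(1) by simp

section \<open>Oddness and joint continuity of \<open>v\<close>\<close>

lemma v_uminus: "v (- \<phi>) \<theta> x = - v \<phi> \<theta> x"
proof -
  \<comment> \<open>The substitution of \<open>- z\<close> for \<open>z\<close> carries the weight
    at \<open>\<phi>\<close> to the weight at \<open>- \<phi>\<close>, because the energy is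
    even.\<close>
  have refl: "- \<phi> + \<theta> * z = - (\<phi> + \<theta> * (0 + (- 1) * z))" for z by (simp add: vec_eq_iff)
  have gint_refl: "gint (- \<phi>) \<theta> (\<lambda>z. F (- \<phi> + \<theta> * z)) = gint \<phi> \<theta> (\<lambda>z. F (- (\<phi> + \<theta> * z)))" if F: "continuous_on UNIV F" for F
  proof -
    have "continuous_on UNIV (\<lambda>z. F (- (\<phi> + \<theta> * z)) * bw \<phi> \<theta> z * gauss z)"
      by (intro continuous_intros continuous_on_compose2[OF F] exp_growth_continuous[OF exp_growth_bw]) auto
    then have "(\<lambda>z. F (- (\<phi> + \<theta> * z)) * bw \<phi> \<theta> z * gauss z) \<in> borel_measurable borel"
      by (rule borel_measurable_continuous_onI)
    then have "gint \<phi> \<theta> (\<lambda>z. F (- (\<phi> + \<theta> * z))) = (LINT z|lborel. F (- (\<phi> + \<theta> * (0 + (- 1) * z))) * bw \<phi> \<theta> (0 + (- 1) * z) * gauss (0 + (- 1) * z))"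
      unfolding gint_def by (subst lborel_integral_affine_vec[of "- 1" _ 0]) auto
    also have "\<dots> = (LINT z|lborel. F (- \<phi> + \<theta> * z) * bw (- \<phi>) \<theta> z * gauss z)"
    proof -
      have "gauss (0 + (- 1) * z) = gauss z" for z :: "real^'n"
      proof -
        have "0 + (- 1) * z = - z" by (simp add: vec_eq_iff)
        then show ?thesis by (simp only: gauss_def norm_minus_cancel)
      qed
      moreover have "bw (- \<phi>) \<theta> z = bw \<phi> \<theta> (0 + (- 1) * z)" for z
        unfolding bw_def refl S_even ..
      ultimately show ?thesis by (simp only: refl)
    qed
    finally show ?thesis by (simp add: gint_def)
  qed
  have "gint (- \<phi>) \<theta> (\<lambda>z. dS x (- \<phi> + \<theta> * z)) = - gint \<phi> \<theta> (\<lambda>z. dS x (\<phi> + \<theta> * z))"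
    using gint_refl[OF dS_cont[of x]] gint_cmult[of \<phi> \<theta> "-1"] by (simp only: dS_odd) simp
  moreover have "gint (- \<phi>) \<theta> (\<lambda>_. 1) = gint \<phi> \<theta> (\<lambda>_. 1)"
    using gint_refl[of "\<lambda>_. 1"] by simp
  ultimately show ?thesis by (simp add: v_def expect_def)
qed

lemma v_0: "v 0 \<theta> x = 0"
  using v_uminus[of 0 \<theta> x] by simp

text \<open>Dominated convergence along a convergent, hence bounded, sequence of parameters.
  Continuity is joint and includes \<open>\<theta> $ i = 0\<close>, since the compact set of the
  minimum argument contains frozen sites.\<close>

lemma gint_continuous:
  assumes g: "continuous_on UNIV g" and bound: "\<And>\<sigma>. \<bar>g \<sigma>\<bar> \<le> K * (1 + norm \<sigma>)"
  shows "continuous_on UNIV (\<lambda>p. gint (fst p) (snd p) (\<lambda>z. g (fst p + snd p * z)))"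
  unfolding continuous_on_sequentially
proof safe
  fix q :: "nat \<Rightarrow> (real^'n) \<times> (real^'n)" and \<phi> \<theta>
  assume q: "q \<longlonglongrightarrow> (\<phi>, \<theta>)"
  have K: "K \<ge> 0" using order_trans[OF abs_ge_zero bound[of 0]] by simp
  obtain R where R: "\<And>n. norm (q n) \<le> R"
    using convergent_imp_Bseq[of q] q by (auto simp: Bseq_def convergent_def)
  have R0: "R \<ge> 0" using order_trans[OF norm_ge_zero R] .
  define D where "D = exp (real CARD('n) * C)"
  have "(\<lambda>n. LINT z|lborel. g (fst (q n) + snd (q n) * z) * bw (fst (q n)) (snd (q n)) z * gauss z)
     \<longlonglongrightarrow> (LINT z|lborel. g (\<phi> + \<theta> * z) * bw \<phi> \<theta> z * gauss z)"
  proof (rule integral_dominated_convergence)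
    have gr: "exp_growth (\<lambda>z. g (a + b * z))" for a b
      by (rule exp_growth_affine_bound[OF g bound])
    show "(\<lambda>z. g (\<phi> + \<theta> * z) * bw \<phi> \<theta> z * gauss z) \<in> borel_measurable lborel"
      using integrable_I[OF gr] by auto
    show "(\<lambda>z. g (fst (q n) + snd (q n) * z) * bw (fst (q n)) (snd (q n)) z * gauss z) \<in> borel_measurable lborel" for n
      using integrable_I[OF gr] by auto
    show "integrable lborel (\<lambda>z::real^'n. (K * (1 + R + R * (norm z)) * D) * gauss z)"
    proof (intro integrable_exp_growth exp_growth_mult exp_growth_const)
      show "exp_growth (\<lambda>z::real^'n. 1 + R + R * norm z)"
        by (rule exp_growth_linear_bound[of _ "1 + R"]) (use R0 in \<open>auto intro!: continuous_intros simp: algebra_simps\<close>)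
    qed
    have cont: "continuous_on UNIV (\<lambda>p. g (fst p + snd p * z) * bw (fst p) (snd p) z * gauss z)" for z
      unfolding bw_def by (intro continuous_intros continuous_on_compose2[OF g] continuous_on_compose2[OF S_cont]) auto
    show "AE z in lborel. (\<lambda>n. g (fst (q n) + snd (q n) * z) * bw (fst (q n)) (snd (q n)) z * gauss z) \<longlonglongrightarrow> g (\<phi> + \<theta> * z) * bw \<phi> \<theta> z * gauss z"
    proof (rule AE_I2)
      fix z
      show "(\<lambda>n. g (fst (q n) + snd (q n) * z) * bw (fst (q n)) (snd (q n)) z * gauss z) \<longlonglongrightarrow> g (\<phi> + \<theta> * z) * bw \<phi> \<theta> z * gauss z"
        using cont[of z] q unfolding continuous_on_sequentially by (auto simp: o_def)
    qed
    show "AE z in lborel. norm (g (fst (q n) + snd (q n) * z) * bw (fst (q n)) (snd (q n)) z * gauss z) \<le> (K * (1 + R + R * (norm z)) * D) * gauss z" for n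
    proof (rule AE_I2)
      fix z
      have "norm (fst (q n)) \<le> R" "norm (snd (q n)) \<le> R"
        using R[of n] norm_fst_le[of "fst (q n)" "snd (q n)"] norm_snd_le[of "snd (q n)" "fst (q n)"] by auto
      then have "norm (fst (q n) + snd (q n) * z) \<le> R + R * norm z"
        using norm_triangle_ineq[of "fst (q n)" "snd (q n) * z"] norm_times_vec_le[of "snd (q n)" z]
          mult_right_mono[of "norm (snd (q n))" R "norm z"] by (smt (verit) norm_ge_zero)
      then have "K * (1 + norm (fst (q n) + snd (q n) * z)) \<le> K * (1 + R + R * norm z)"
        using K by (intro mult_left_mono) auto
      then have "\<bar>g (fst (q n) + snd (q n) * z)\<bar> \<le> K * (1 + R + R * norm z)"
        using bound[of "fst (q n) + snd (q n) * z"] by linarith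
      then have "\<bar>g (fst (q n) + snd (q n) * z)\<bar> * bw (fst (q n)) (snd (q n)) z * gauss z \<le> (K * (1 + R + R * (norm z)) * D) * gauss z"
        unfolding D_def by (intro mult_right_mono mult_mono bw_le) (auto simp: less_imp_le)
      then show "norm (g (fst (q n) + snd (q n) * z) * bw (fst (q n)) (snd (q n)) z * gauss z) \<le> (K * (1 + R + R * (norm z)) * D) * gauss z"
        by (simp add: abs_mult abs_of_pos)
    qed
  qed
  then show "((\<lambda>p. gint (fst p) (snd p) (\<lambda>z. g (fst p + snd p * z))) \<circ> q) \<longlonglongrightarrow> gint (fst (\<phi>, \<theta>)) (snd (\<phi>, \<theta>)) (\<lambda>z. g (fst (\<phi>, \<theta>) + snd (\<phi>, \<theta>) * z))"
    by (simp add: o_def gint_def)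
qed

lemma v_continuous: "continuous_on UNIV (\<lambda>p. v (fst p) (snd p) x)"
proof -
  have "\<bar>dS x \<sigma>\<bar> \<le> lip * (1 + norm \<sigma>)" for \<sigma>
    using dS_bound[of x \<sigma>] lip_nonneg by (simp add: distrib_left)
  then show ?thesis
    unfolding v_def expect_def using gint_1_pos
    by (intro continuous_on_divide gint_continuous[OF dS_cont] gint_continuous[of "\<lambda>_. 1" 1])
       (auto simp: less_imp_neq[symmetric])
qed

end

text \<open>The factor \<open>max 1 (exp x)\<close> keeps the remainder bounded whenever
  \<open>exp x\<close> is, even for arguments unbounded below.\<close>

lemma exp_taylor_bound: "\<bar>exp x - 1 - x\<bar> \<le> x\<^sup>2 * max 1 (exp (x::real))"
proof -
  have 1: "exp x - 1 \<le> x * exp x"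
  proof -
    have "exp x * (1 - x) \<le> exp x * exp (- x)"
      using exp_ge_add_one_self[of "- x"] by (intro mult_left_mono) auto
    then show ?thesis by (simp add: exp_minus algebra_simps)
  qed
  have 2: "0 \<le> exp x - 1 - x" using exp_ge_add_one_self[of x] by linarith
  have "exp x - 1 - x \<le> x * (exp x - 1)" using 1 by (simp add: algebra_simps)
  also have "\<dots> \<le> x * (x * max 1 (exp x))"
  proof (cases "x \<ge> 0")
    case True
    have "exp x - 1 \<le> x * max 1 (exp x)" using 1 mult_left_mono[OF max.cobounded2[of "exp x" 1] True] by linarith
    then show ?thesis using True by (rule mult_left_mono)
  next
    case False
    then have "max 1 (exp x) = 1" by auto
    then have "x * max 1 (exp x) \<le> exp x - 1"
      using exp_ge_add_one_self[of x] by (simp only: mult_1_right)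
    then show ?thesis using False by (intro mult_left_mono_neg) auto
  qed
  finally show ?thesis using 2 by (simp add: power2_eq_square mult.assoc)
qed

context spin_system
begin

section \<open>Dependence on the prior of a single site\<close>

text \<open>The frozen spins act on the active ones as an external field, which a translation of \<open>\<phi>\<close> absorbs;
  the translation is nonnegative for a ferromagnet if the frozen spins are.\<close>

lemma mean_frozen:
  fixes \<phi> \<theta> :: "real^'n"
  defines "b \<equiv> A *v (\<chi> i. if \<theta> $ i = 0 then \<phi> $ i else 0)"
  assumes y: "\<theta> $ y \<noteq> 0"
  shows "mean \<phi> \<theta> y = mean (\<chi> i. if \<theta> $ i = 0 then 0 else \<phi> $ i - (\<theta> $ i)\<^sup>2 * b $ i) \<theta> y"
proof -
  define \<phi>F where "\<phi>F = (\<chi> i. if \<theta> $ i = 0 then \<phi> $ i else 0)"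
  define \<phi>h where "\<phi>h = (\<chi> i. if \<theta> $ i = 0 then 0 else \<phi> $ i - (\<theta> $ i)\<^sup>2 * b $ i)"
  have b: "b = A *v \<phi>F" by (simp add: b_def \<phi>F_def)
  define t where "t = - (\<theta> * b)"
  define \<kappa> where "\<kappa> = exp (- (\<phi>h \<bullet> b) - 1/2 * (\<phi>F \<bullet> b) - (\<Sum>i\<in>UNIV. if \<theta> $ i = 0 then V i (\<phi>F $ i) - V i 0 else 0) - (norm (\<theta> * b))\<^sup>2 / 2)"
  have \<kappa>: "\<kappa> > 0" by (simp add: \<kappa>_def)
  have site: "\<phi> + \<theta> * (t + 1 * z) = (\<phi>h + \<theta> * z) + \<phi>F" for z
    by (simp add: vec_eq_iff t_def \<phi>h_def \<phi>F_def power2_eq_square algebra_simps)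
  have weight: "bw \<phi> \<theta> (t + 1 * z) * gauss (t + 1 * z) = \<kappa> * (bw \<phi>h \<theta> z * gauss z)" for z
  proof -
    let ?s = "\<phi>h + \<theta> * z"
    have quad: "(?s + \<phi>F) \<bullet> (A *v (?s + \<phi>F)) = ?s \<bullet> (A *v ?s) + 2 * (?s \<bullet> b) + \<phi>F \<bullet> b"
      using A_inner[of \<phi>F ?s] by (simp add: b matrix_vector_right_distrib inner_add_left inner_add_right)
    have "V i ((?s + \<phi>F) $ i) = V i (?s $ i) + (if \<theta> $ i = 0 then V i (\<phi>F $ i) - V i 0 else 0)" for i
      by (simp add: \<phi>h_def \<phi>F_def)
    then have SS: "S (?s + \<phi>F) = S ?s + ?s \<bullet> b + 1/2 * (\<phi>F \<bullet> b) + (\<Sum>i\<in>UNIV. if \<theta> $ i = 0 then V i (\<phi>F $ i) - V i 0 else 0)"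
      unfolding S_def quad by (simp add: sum.distrib)
    have sb: "?s \<bullet> b = \<phi>h \<bullet> b + z \<bullet> (\<theta> * b)"
      by (simp add: inner_vec_def sum.distrib algebra_simps)
    have "t + 1 * z = z - \<theta> * b" by (simp add: vec_eq_iff t_def)
    then have nn: "(norm (t + 1 * z))\<^sup>2 = (norm z)\<^sup>2 - 2 * (z \<bullet> (\<theta> * b)) + (norm (\<theta> * b))\<^sup>2"
      by (simp add: power2_norm_eq_inner inner_diff_left inner_diff_right inner_commute)
    show ?thesis
      unfolding bw_def gauss_def site SS sb nn \<kappa>_def exp_add[symmetric] by (simp add: field_simps)
  qed
  have gint_eq: "gint \<phi> \<theta> F = \<kappa> * gint \<phi>h \<theta> (\<lambda>z. F (t + 1 * z))" if F: "exp_growth F" for F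
  proof -
    have "gint \<phi> \<theta> F = (LINT z|lborel. F (t + 1 * z) * bw \<phi> \<theta> (t + 1 * z) * gauss (t + 1 * z))"
      unfolding gint_def using integrable_I[OF F, of \<phi> \<theta>]
      by (subst lborel_integral_affine_vec[of 1 _ t]) auto
    also have "\<dots> = (LINT z|lborel. \<kappa> * (F (t + 1 * z) * bw \<phi>h \<theta> z * gauss z))"
      using weight by (simp only: mult.assoc mult.left_commute[of "F _"])
    finally show ?thesis by (simp add: gint_def)
  qed
  have g: "exp_growth (\<lambda>z. (\<phi> + \<theta> * z) $ y)" by (auto intro!: exp_growth_add exp_growth_mult)
  have "gint \<phi> \<theta> (\<lambda>z. (\<phi> + \<theta> * z) $ y) = \<kappa> * gint \<phi>h \<theta> (\<lambda>z. (\<phi>h + \<theta> * z) $ y)"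
    unfolding gint_eq[OF g] site using y by (simp add: \<phi>F_def)
  moreover have "gint \<phi> \<theta> (\<lambda>_. 1) = \<kappa> * gint \<phi>h \<theta> (\<lambda>_. 1)"
    by (rule gint_eq) simp
  ultimately show ?thesis using \<kappa> by (simp add: mean_def expect_def \<phi>h_def)
qed

text \<open>Changing the prior of the site \<open>y\<close> multiplies the weight by the ratio of
  two Gaussian densities in the spin at \<open>y\<close>, which is \<open>exp q\<close> up to a
  constant. The Gaussian variable is rescaled so that the spin configuration stays the same.\<close>

lemma mean_reweight:
  fixes \<phi> \<theta> :: "real^'n" and a r :: real
  assumes y: "\<theta> $ y > 0" and r: "r > 0"
  defines "\<phi>' \<equiv> \<phi> + a *\<^sub>R axis y 1" and "\<theta>' \<equiv> (\<chi> i. if i = y then r else \<theta> $ i)"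
    and "q \<equiv> (\<lambda>s. - (s - (\<phi> $ y + a))\<^sup>2 / (2 * r\<^sup>2) + (s - \<phi> $ y)\<^sup>2 / (2 * (\<theta> $ y)\<^sup>2))"
  shows "mean \<phi>' \<theta>' x = gint \<phi> \<theta> (\<lambda>z. (\<phi> + \<theta> * z) $ x * exp (q ((\<phi> + \<theta> * z) $ y))) / gint \<phi> \<theta> (\<lambda>z. exp (q ((\<phi> + \<theta> * z) $ y)))"
proof -
  define t where "t = (\<chi> i. if i = y then - a / r else 0)"
  define c where "c = (\<chi> i. if i = y then \<theta> $ y / r else 1)"
  have c: "c $ i \<noteq> 0" for i using y r by (simp add: c_def)
  define \<kappa> where "\<kappa> = (\<Prod>i\<in>UNIV. \<bar>c $ i\<bar>)"
  have \<kappa>: "\<kappa> > 0" unfolding \<kappa>_def using c by (intro prod_pos) auto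
  have site: "\<phi>' + \<theta>' * (t + c * z) = \<phi> + \<theta> * z" for z
    using r by (auto simp: vec_eq_iff \<phi>'_def \<theta>'_def t_def c_def axis_def field_simps)
  have gauss: "gauss (t + c * z) = exp (q ((\<phi> + \<theta> * z) $ y)) * gauss z" for z
  proof -
    have sq: "(norm w)\<^sup>2 = (w $ y)\<^sup>2 + (\<Sum>i\<in>UNIV - {y}. (w $ i)\<^sup>2)" for w :: "real^'n"
      by (simp add: norm_vec_def L2_set_def sum_nonneg sum.remove[of UNIV y])
    have "(\<Sum>i\<in>UNIV - {y}. ((t + c * z) $ i)\<^sup>2) = (\<Sum>i\<in>UNIV - {y}. (z $ i)\<^sup>2)"
      by (intro sum.cong) (auto simp: t_def c_def)
    moreover have "(t + c * z) $ y = (\<theta> $ y * z $ y - a) / r" using r by (simp add: t_def c_def field_simps)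
    moreover have "q ((\<phi> + \<theta> * z) $ y) = - ((\<theta> $ y * z $ y - a) / r)\<^sup>2 / 2 + (z $ y)\<^sup>2 / 2"
      using y r by (simp add: q_def power_divide power_mult_distrib field_simps)
    ultimately show ?thesis
      unfolding gauss_def sq[of "t + c * z"] sq[of z] exp_add[symmetric] by (simp add: field_simps)
  qed
  have gint_eq: "gint \<phi>' \<theta>' F = \<kappa> * gint \<phi> \<theta> (\<lambda>z. F (t + c * z) * exp (q ((\<phi> + \<theta> * z) $ y)))" if F: "exp_growth F" for F
  proof -
    have "gint \<phi>' \<theta>' F = \<kappa> * (LINT z|lborel. F (t + c * z) * bw \<phi>' \<theta>' (t + c * z) * gauss (t + c * z))"
      unfolding gint_def \<kappa>_def using integrable_I[OF F, of \<phi>' \<theta>']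
      by (subst lborel_integral_affine_vec[of c _ t]) (auto simp: c)
    also have "(\<lambda>z. F (t + c * z) * bw \<phi>' \<theta>' (t + c * z) * gauss (t + c * z)) = (\<lambda>z. F (t + c * z) * exp (q ((\<phi> + \<theta> * z) $ y)) * bw \<phi> \<theta> z * gauss z)"
      unfolding gauss bw_def site by (simp add: mult_ac)
    finally show ?thesis by (simp add: gint_def)
  qed
  have g: "exp_growth (\<lambda>z. (\<phi>' + \<theta>' * z) $ x)" by (auto intro!: exp_growth_add exp_growth_mult)
  show ?thesis
    unfolding mean_def expect_def gint_eq[OF g] gint_eq[OF exp_growth_const] site using \<kappa> by simp
qed

text \<open>Differentiation under the integral by a second order Taylor bound. The set
  \<open>U\<close> can restrict the sign of \<open>t\<close>: for a quadratic
  \<open>q \<le> 0\<close> the factor \<open>exp (t * q z)\<close> is at most 1 for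
  \<open>t \<ge> 0\<close>, but may have Gaussian growth for \<open>t < 0\<close>.\<close>

lemma gint_exp_deriv_within:
  assumes F: "exp_growth F" and q: "exp_growth q" and H: "exp_growth H"
    and H1: "\<And>z. 1 \<le> H z" and qH: "\<And>z t. t \<in> U \<Longrightarrow> \<bar>t\<bar> < 1 \<Longrightarrow> exp (t * q z) \<le> H z"
  shows "((\<lambda>t. gint \<phi> \<theta> (\<lambda>z. F z * exp (t * q z))) has_real_derivative gint \<phi> \<theta> (\<lambda>z. F z * q z)) (at 0 within U)"
proof -
  define K where "K = gint \<phi> \<theta> (\<lambda>z. \<bar>F z\<bar> * ((q z)\<^sup>2 * H z))"
  have bound: "\<bar>gint \<phi> \<theta> (\<lambda>z. F z * exp (t * q z)) - gint \<phi> \<theta> F - t * gint \<phi> \<theta> (\<lambda>z. F z * q z)\<bar> \<le> t\<^sup>2 * K"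
    if t: "t \<in> U" "\<bar>t\<bar> < 1" for t
  proof -
    have cont: "continuous_on UNIV (\<lambda>z. F z * exp (t * q z))"
      using F q by (intro continuous_intros) (auto simp: exp_growth_def)
    obtain C1 b1 where C1: "\<And>z. \<bar>F z * H z\<bar> \<le> C1 * exp (b1 * norm z)"
      using exp_growthE[OF exp_growth_mult[OF F H]] by blast
    have ge: "exp_growth (\<lambda>z. F z * exp (t * q z))"
    proof (rule exp_growthI[OF cont, of C1 b1])
      fix z
      have "\<bar>F z * exp (t * q z)\<bar> \<le> \<bar>F z\<bar> * H z" unfolding abs_mult using qH[OF t, of z] by (intro mult_left_mono) auto
      also have "\<dots> \<le> \<bar>F z * H z\<bar>" unfolding abs_mult by (intro mult_left_mono) auto
      finally show "\<bar>F z * exp (t * q z)\<bar> \<le> C1 * exp (b1 * norm z)" using C1[of z] by linarith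
    qed
    have gq: "exp_growth (\<lambda>z. t * (F z * q z))" using F q by (intro exp_growth_mult exp_growth_const)
    let ?R = "\<lambda>z. F z * exp (t * q z) - F z - t * (F z * q z)"
    have R: "gint \<phi> \<theta> (\<lambda>z. F z * exp (t * q z)) - gint \<phi> \<theta> F - t * gint \<phi> \<theta> (\<lambda>z. F z * q z) = gint \<phi> \<theta> ?R"
      unfolding gint_diff[OF exp_growth_diff[OF ge F] gq] gint_diff[OF ge F] gint_cmult ..
    have gR: "exp_growth ?R" by (intro exp_growth_diff ge F gq)
    have gK: "exp_growth (\<lambda>z. t\<^sup>2 * (\<bar>F z\<bar> * ((q z)\<^sup>2 * H z)))"
      by (intro exp_growth_mult exp_growth_const exp_growth_abs exp_growth_power F q H)
    have pt: "\<bar>?R z\<bar> \<le> t\<^sup>2 * (\<bar>F z\<bar> * ((q z)\<^sup>2 * H z))" for z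
    proof -
      have "?R z = F z * (exp (t * q z) - 1 - t * q z)" by (simp add: algebra_simps)
      then have "\<bar>?R z\<bar> = \<bar>F z\<bar> * \<bar>exp (t * q z) - 1 - t * q z\<bar>" by (simp add: abs_mult)
      also have "\<dots> \<le> \<bar>F z\<bar> * ((t * q z)\<^sup>2 * max 1 (exp (t * q z)))"
        by (intro mult_left_mono exp_taylor_bound) auto
      also have "\<dots> \<le> \<bar>F z\<bar> * ((t * q z)\<^sup>2 * H z)"
        using qH[OF t, of z] H1[of z] by (intro mult_left_mono) auto
      finally show ?thesis by (simp add: power_mult_distrib mult_ac)
    qed
    have "gint \<phi> \<theta> ?R \<le> t\<^sup>2 * K"
      unfolding K_def gint_cmult[symmetric] by (intro gint_mono gR gK order_trans[OF abs_ge_self pt])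
    moreover have "(-1) * gint \<phi> \<theta> ?R \<le> t\<^sup>2 * K"
      unfolding K_def gint_cmult[symmetric]
      by (intro gint_mono exp_growth_mult exp_growth_const gR gK order_trans[OF _ pt]) simp
    ultimately show ?thesis unfolding R by (simp add: abs_le_iff)
  qed
  have K: "K \<ge> 0"
  proof -
    have "gint \<phi> \<theta> (\<lambda>_. 0) \<le> K" unfolding K_def
      using order_trans[OF zero_le_one H1] by (intro gint_mono) (auto intro!: exp_growth_mult exp_growth_abs exp_growth_power F q H mult_nonneg_nonneg)
    then show ?thesis by (simp add: gint_def)
  qed
  show ?thesis
    unfolding has_field_derivative_iff
  proof (rule LIM_zero_cancel, rule Lim_null_comparison)
    show "\<forall>\<^sub>F t in at 0 within U. norm ((gint \<phi> \<theta> (\<lambda>z. F z * exp (t * q z)) - gint \<phi> \<theta> (\<lambda>z. F z * exp (0 * q z))) / (t - 0) - gint \<phi> \<theta> (\<lambda>z. F z * q z)) \<le> \<bar>t\<bar> * K"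
      unfolding eventually_at
    proof (intro exI[of _ 1] conjI ballI impI)
      fix t assume t: "t \<in> U" "t \<noteq> 0 \<and> dist t 0 < 1"
      let ?X = "gint \<phi> \<theta> (\<lambda>z. F z * exp (t * q z)) - gint \<phi> \<theta> F"
      have "?X / t - gint \<phi> \<theta> (\<lambda>z. F z * q z) = (?X - t * gint \<phi> \<theta> (\<lambda>z. F z * q z)) / t"
        using t by (simp add: field_simps)
      also have "\<bar>\<dots>\<bar> \<le> (t\<^sup>2 * K) / \<bar>t\<bar>"
        unfolding abs_divide using bound[of t] t by (intro divide_right_mono) (auto simp: dist_real_def)
      also have "\<dots> = \<bar>t\<bar> * K" using t by (simp add: power2_eq_square field_simps abs_if)
      finally show "norm ((gint \<phi> \<theta> (\<lambda>z. F z * exp (t * q z)) - gint \<phi> \<theta> (\<lambda>z. F z * exp (0 * q z))) / (t - 0) - gint \<phi> \<theta> (\<lambda>z. F z * q z)) \<le> \<bar>t\<bar> * K"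
        by simp
    qed simp
    show "((\<lambda>t. \<bar>t\<bar> * K) \<longlongrightarrow> 0) (at 0 within U)"
      by (rule tendsto_eq_intros refl | simp)+
  qed
qed

lemma exp_growth_site [intro, simp]: "exp_growth (\<lambda>z. (\<phi> + \<theta> * z) $ x)"
  by (auto intro!: exp_growth_add exp_growth_mult)

lemma exp_growth_exp_site [intro, simp]: "exp_growth (\<lambda>z. exp (t * (\<phi> + \<theta> * z) $ y))"
proof -
  have "exp (t * (\<phi> + \<theta> * z) $ y) = exp (t * \<phi> $ y) * exp ((t * \<theta> $ y) * z $ y)" for z
    by (simp add: exp_add[symmetric] algebra_simps)
  then show ?thesis by (auto intro!: exp_growth_mult)
qed

text \<open>The derivative at \<open>t\<close> is the one at 0 after \<open>exp (t * ...)\<close>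
  has been moved into \<open>F\<close>. For increments below 1, \<open>1 + exp q + exp (- q)\<close>
  dominates.\<close>

lemma gint_exp_site_deriv:
  assumes F: "exp_growth F"
  shows "((\<lambda>t. gint \<phi> \<theta> (\<lambda>z. F z * exp (t * (\<phi> + \<theta> * z) $ y))) has_real_derivative
      gint \<phi> \<theta> (\<lambda>z. (F z * (\<phi> + \<theta> * z) $ y) * exp (t * (\<phi> + \<theta> * z) $ y))) (at t)"
proof -
  let ?s = "\<lambda>z. (\<phi> + \<theta> * z) $ y"
  let ?H = "\<lambda>z. 1 + exp (1 * ?s z) + exp ((-1) * ?s z)"
  have H: "exp (u * q) \<le> 1 + exp (1 * q) + exp ((-1) * q)" if "\<bar>u\<bar> < 1" for u q :: real
  proof -
    have "u * q \<le> \<bar>q\<bar>" using that mult_right_mono[of "\<bar>u\<bar>" 1 "\<bar>q\<bar>"] abs_ge_self[of "u * q"] by (simp add: abs_mult)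
    then have "exp (u * q) \<le> exp \<bar>q\<bar>" by simp
    also have "\<dots> \<le> 1 + exp (1 * q) + exp ((-1) * q)" by (cases "q \<ge> 0") (auto simp: add_nonneg_nonneg)
    finally show ?thesis .
  qed
  have "((\<lambda>u. gint \<phi> \<theta> (\<lambda>z. (F z * exp (t * ?s z)) * exp (u * ?s z))) has_real_derivative gint \<phi> \<theta> (\<lambda>z. (F z * exp (t * ?s z)) * ?s z)) (at 0)"
  proof (rule gint_exp_deriv_within[where H = ?H])
    show "exp (u * ?s z) \<le> ?H z" if "\<bar>u\<bar> < 1" for u z using H[OF that] .
    show "1 \<le> ?H z" for z by (simp add: add_nonneg_nonneg)
  qed (intro exp_growth_add exp_growth_mult exp_growth_const F exp_growth_site exp_growth_exp_site)+
  then have "((\<lambda>u. gint \<phi> \<theta> (\<lambda>z. F z * exp ((u + t) * ?s z))) has_real_derivative gint \<phi> \<theta> (\<lambda>z. (F z * ?s z) * exp (t * ?s z))) (at 0)"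
    by (simp add: distrib_right exp_add mult_ac)
  then show ?thesis
    using DERIV_shift[of "\<lambda>u. gint \<phi> \<theta> (\<lambda>z. F z * exp (u * ?s z))" "gint \<phi> \<theta> (\<lambda>z. (F z * ?s z) * exp (t * ?s z))" 0 t] by simp
qed


text \<open>The third cumulant of the spins at \<open>x\<close>, \<open>y\<close>, \<open>y\<close>.\<close>

definition third :: "real^'n \<Rightarrow> real^'n \<Rightarrow> 'n \<Rightarrow> 'n \<Rightarrow> real" where
  "third \<phi> \<theta> x y = (let \<sigma> = (\<lambda>i z. (\<phi> + \<theta> * z) $ i); E = expect \<phi> \<theta> in
     E (\<lambda>z. \<sigma> x z * \<sigma> y z * \<sigma> y z) - 2 * E (\<sigma> y) * E (\<lambda>z. \<sigma> x z * \<sigma> y z)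
     - E (\<sigma> x) * E (\<lambda>z. \<sigma> y z * \<sigma> y z) + 2 * E (\<sigma> x) * (E (\<sigma> y))\<^sup>2)"

text \<open>Moving the prior mean of the site \<open>y\<close> by \<open>s\<close> tilts the weight
  by \<open>exp (k * s * ...)\<close> in the spin at \<open>y\<close>, with \<open>k\<close> the
  precision, since the quadratic parts cancel. The derivatives are thus cumulants times powers of
  \<open>k\<close>. \<open>M1\<close> is given on the whole line so that it can be differentiated
  again.\<close>

lemma mean_deriv_phi:
  fixes \<phi> \<theta> :: "real^'n"
  assumes y: "\<theta> $ y > 0"
  shows "\<exists>M1. (\<forall>s. ((\<lambda>s. mean (\<phi> + s *\<^sub>R axis y 1) \<theta> x) has_real_derivative M1 s) (at s)) \<and>
     M1 0 = cov \<phi> \<theta> x y / (\<theta> $ y)\<^sup>2 \<and>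
     (M1 has_real_derivative third \<phi> \<theta> x y / (\<theta> $ y)^4) (at 0)"
proof -
  let ?s = "\<lambda>i z. (\<phi> + \<theta> * z) $ i"
  define N where "N G t = gint \<phi> \<theta> (\<lambda>z. G z * exp (t * ?s y z))" for G t
  define k where "k = 1 / (\<theta> $ y)\<^sup>2"
  have k: "k > 0" using y by (simp add: k_def)
  have dN: "(N G has_real_derivative N (\<lambda>z. G z * ?s y z) t) (at t)" if "exp_growth G" for G t
    unfolding N_def using gint_exp_site_deriv[OF that] by simp
  define N0 where "N0 = N (?s x)"
  define N1 where "N1 = N (\<lambda>z. ?s x z * ?s y z)"
  define N2 where "N2 = N (\<lambda>z. ?s x z * ?s y z * ?s y z)"
  define D0 where "D0 = N (\<lambda>z. 1)"
  define D1 where "D1 = N (\<lambda>z. 1 * ?s y z)"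
  define D2 where "D2 = N (\<lambda>z. 1 * ?s y z * ?s y z)"
  have g: "exp_growth (\<lambda>z. ?s x z * ?s y z)" "exp_growth (\<lambda>z. 1 * ?s y z)"
    by (intro exp_growth_mult exp_growth_site exp_growth_const)+
  note dd = dN[OF exp_growth_site[of \<phi> \<theta> x], folded N0_def N1_def]
    dN[OF g(1), folded N1_def N2_def] dN[OF exp_growth_const[of 1], folded D0_def D1_def] dN[OF g(2), folded D1_def D2_def]
  have D0: "D0 t > 0" for t
    unfolding D0_def N_def by (rule gint_pos, intro exp_growth_mult exp_growth_const exp_growth_exp_site) simp
  have mean: "mean (\<phi> + s *\<^sub>R axis y 1) \<theta> x = N0 (k * s) / D0 (k * s)" for s
  proof -
    have th: "(\<chi> i. if i = y then \<theta> $ y else \<theta> $ i) = \<theta>" by (simp add: vec_eq_iff)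
    have q: "- (u - (\<phi> $ y + s))\<^sup>2 / (2 * (\<theta> $ y)\<^sup>2) + (u - \<phi> $ y)\<^sup>2 / (2 * (\<theta> $ y)\<^sup>2) = (k * s) * u + (- k * s * \<phi> $ y - k * s\<^sup>2 / 2)" for u
    proof -
      have "- (u - (\<phi> $ y + s))\<^sup>2 + (u - \<phi> $ y)\<^sup>2 = 2 * s * u - 2 * s * \<phi> $ y - s\<^sup>2"
        by (simp add: power2_eq_square algebra_simps)
      then have "(- (u - (\<phi> $ y + s))\<^sup>2 + (u - \<phi> $ y)\<^sup>2) * (k / 2) = (2 * s * u - 2 * s * \<phi> $ y - s\<^sup>2) * (k / 2)" by simp
      moreover have half: "- a / (2 * w) + b / (2 * w) = (- a + b) * (1 / w / 2)" for a b w :: real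
        by (cases "w = 0") (auto simp: field_simps)
      ultimately show ?thesis unfolding half k_def[symmetric] by (simp only:) (simp add: algebra_simps)
    qed
    let ?c = "exp (- k * s * \<phi> $ y - k * s\<^sup>2 / 2)"
    have "gint \<phi> \<theta> (\<lambda>z. F z * exp ((k * s) * ?s y z + (- k * s * \<phi> $ y - k * s\<^sup>2 / 2))) = ?c * N F (k * s)" for F
      unfolding N_def gint_cmult[symmetric] exp_add by (simp add: mult_ac)
    from this[of "?s x"] this[of "\<lambda>_. 1"] show ?thesis
      using mean_reweight[OF y y, of \<phi> s x] unfolding th q N0_def D0_def by simp
  qed
  define R1 where "R1 t = (N1 t * D0 t - N0 t * D1 t) / (D0 t * D0 t)" for t
  have R: "((\<lambda>t. N0 t / D0 t) has_real_derivative R1 t) (at t)" for t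
    unfolding R1_def using D0[of t] by (intro DERIV_divide dd) auto
  have RS: "((\<lambda>s. mean (\<phi> + s *\<^sub>R axis y 1) \<theta> x) has_real_derivative k * R1 (k * s)) (at s)" for s
  proof -
    have "((\<lambda>s. N0 (k * s) / D0 (k * s)) has_real_derivative R1 (k * s) * k) (at s)"
      by (rule DERIV_chain2[OF R]) (auto intro!: derivative_eq_intros)
    then show ?thesis by (simp add: mean mult.commute)
  qed
  have N_0: "N G 0 = D0 0 * expect \<phi> \<theta> G" for G
    using gint_1_pos[of \<phi> \<theta>] by (simp add: N_def expect_def D0_def)
  have vals: "N0 0 = D0 0 * expect \<phi> \<theta> (?s x)" "N1 0 = D0 0 * expect \<phi> \<theta> (\<lambda>z. ?s x z * ?s y z)"
     "N2 0 = D0 0 * expect \<phi> \<theta> (\<lambda>z. ?s x z * ?s y z * ?s y z)" "D1 0 = D0 0 * expect \<phi> \<theta> (?s y)"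
     "D2 0 = D0 0 * expect \<phi> \<theta> (\<lambda>z. ?s y z * ?s y z)"
    unfolding N0_def N1_def N2_def D1_def D2_def using N_0 by (simp_all only: mult_1)
  have R10: "R1 0 = cov \<phi> \<theta> x y"
    unfolding R1_def vals cov_def cov_under_def using D0[of 0] by (simp add: field_simps)
  have "(R1 has_real_derivative third \<phi> \<theta> x y) (at 0)"
  proof -
    let ?n = "N1 0 * D0 0 - N0 0 * D1 0"
    have "((\<lambda>t. N1 t * D0 t - N0 t * D1 t) has_real_derivative (N2 0 * D0 0 + D1 0 * N1 0 - (N1 0 * D1 0 + D2 0 * N0 0))) (at 0)"
      by (intro DERIV_diff DERIV_mult dd)
    moreover have "((\<lambda>t. D0 t * D0 t) has_real_derivative (D1 0 * D0 0 + D1 0 * D0 0)) (at 0)"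
      by (intro DERIV_mult dd)
    ultimately have "(R1 has_real_derivative ((N2 0 * D0 0 + D1 0 * N1 0 - (N1 0 * D1 0 + D2 0 * N0 0)) * (D0 0 * D0 0) - ?n * (D1 0 * D0 0 + D1 0 * D0 0)) / ((D0 0 * D0 0) * (D0 0 * D0 0))) (at 0)"
      unfolding R1_def[abs_def] using D0[of 0] by (intro DERIV_divide) auto
    moreover have "((N2 0 * D0 0 + D1 0 * N1 0 - (N1 0 * D1 0 + D2 0 * N0 0)) * (D0 0 * D0 0) - ?n * (D1 0 * D0 0 + D1 0 * D0 0)) / ((D0 0 * D0 0) * (D0 0 * D0 0)) = third \<phi> \<theta> x y"
      unfolding vals third_def Let_def using D0[of 0] by (simp add: field_simps power2_eq_square)
    ultimately show ?thesis by simp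
  qed
  then have R1d: "(R1 has_real_derivative third \<phi> \<theta> x y) (at (k * 0))" by simp
  have "((\<lambda>s. R1 (k * s)) has_real_derivative third \<phi> \<theta> x y * k) (at 0)"
  proof (rule DERIV_chain2[where f = R1 and g = "\<lambda>s. k * s"])
    show "((\<lambda>s. k * s) has_real_derivative k) (at 0)" by (auto intro!: derivative_eq_intros)
  qed (fact R1d)
  then have "((\<lambda>s. k * R1 (k * s)) has_real_derivative k * (third \<phi> \<theta> x y * k)) (at 0)"
    by (rule DERIV_cmult)
  moreover have "k * (third \<phi> \<theta> x y * k) = third \<phi> \<theta> x y / (\<theta> $ y)^4"
    by (simp add: k_def power4_eq_xxxx power2_eq_square)
  ultimately show ?thesis using RS R10 by (intro exI[of _ "\<lambda>s. k * R1 (k * s)"]) (auto simp: k_def)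
qed

text \<open>Only the derivative from the right in the precision \<open>1 / (\<theta> $ y)\<^sup>2\<close> is computed: there the reweighting factor
  is bounded.\<close>

lemma mean_deriv_k:
  fixes \<phi> \<theta> :: "real^'n"
  assumes y: "\<theta> $ y > 0"
  shows "((\<lambda>t. mean \<phi> (\<chi> i. if i = y then 1 / sqrt (1 / (\<theta> $ y)\<^sup>2 + t) else \<theta> $ i) x) has_real_derivative
     (- third \<phi> \<theta> x y / 2 + (\<phi> $ y - mean \<phi> \<theta> y) * cov \<phi> \<theta> x y)) (at 0 within {0..})"
proof -
  let ?s = "\<lambda>i z. (\<phi> + \<theta> * z) $ i"
  define k where "k = 1 / (\<theta> $ y)\<^sup>2"
  have k: "k > 0" using y by (simp add: k_def)
  \<comment> \<open>Up to a constant, raising the precision by \<open>t\<close> multiplies the prior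
    density of the spin at \<open>y\<close> by \<open>exp (t * q z)\<close>.\<close>
  define q where "q z = - (?s y z - \<phi> $ y)\<^sup>2 / 2" for z
  define N where "N G t = gint \<phi> \<theta> (\<lambda>z. G z * exp (t * q z))" for G t
  have gq: "exp_growth q" unfolding q_def
    by (intro exp_growth_divide exp_growth_uminus exp_growth_power exp_growth_diff exp_growth_site exp_growth_const)
  have dN: "(N G has_real_derivative gint \<phi> \<theta> (\<lambda>z. G z * q z)) (at 0 within {0..})" if "exp_growth G" for G
    unfolding N_def
    by (rule gint_exp_deriv_within[OF that gq exp_growth_const[of 1]]) (auto simp: q_def mult_nonneg_nonpos)
  have mean: "mean \<phi> (\<chi> i. if i = y then 1 / sqrt (k + t) else \<theta> $ i) x = N (?s x) t / N (\<lambda>_. 1) t" if t: "t \<ge> 0" for t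
  proof -
    have r: "1 / sqrt (k + t) > 0" using k t by simp
    have r2: "(1 / sqrt (k + t))\<^sup>2 = 1 / (k + t)" using k t by (simp add: power_divide)
    have k': "(\<theta> $ y)\<^sup>2 = 1 / k" by (simp add: k_def)
    have q: "- (u - (\<phi> $ y + 0))\<^sup>2 / (2 * (1 / sqrt (k + t))\<^sup>2) + (u - \<phi> $ y)\<^sup>2 / (2 * (\<theta> $ y)\<^sup>2) = t * (- (u - \<phi> $ y)\<^sup>2 / 2)" for u
      unfolding r2 k' using k t by (simp add: field_simps)
    show ?thesis
      using mean_reweight[OF y r, of \<phi> 0 x] unfolding q unfolding N_def q_def by simp
  qed
  have N0: "N G 0 = gint \<phi> \<theta> (\<lambda>_. 1) * expect \<phi> \<theta> G" for G
    using gint_1_pos[of \<phi> \<theta>] by (simp add: N_def expect_def)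
  have Iq: "gint \<phi> \<theta> (\<lambda>z. G z * q z) = gint \<phi> \<theta> (\<lambda>_. 1) * expect \<phi> \<theta> (\<lambda>z. G z * q z)" for G
    using gint_1_pos[of \<phi> \<theta>] by (simp add: expect_def)
  have Exq: "expect \<phi> \<theta> (\<lambda>z. G z * q z) = - 1/2 * expect \<phi> \<theta> (\<lambda>z. G z * ?s y z * ?s y z) + \<phi> $ y * expect \<phi> \<theta> (\<lambda>z. G z * ?s y z) - (\<phi> $ y)\<^sup>2 / 2 * expect \<phi> \<theta> G" if G: "exp_growth G" for G
  proof -
    have g: "exp_growth (\<lambda>z. - 1/2 * (G z * ?s y z * ?s y z))" "exp_growth (\<lambda>z. \<phi> $ y * (G z * ?s y z))" "exp_growth (\<lambda>z. (\<phi> $ y)\<^sup>2 / 2 * G z)"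
      by (intro exp_growth_mult G exp_growth_site exp_growth_const)+
    have "(\<lambda>z. G z * q z) = (\<lambda>z. - 1/2 * (G z * ?s y z * ?s y z) + \<phi> $ y * (G z * ?s y z) - (\<phi> $ y)\<^sup>2 / 2 * G z)"
      unfolding q_def by (simp add: fun_eq_iff power2_eq_square field_simps)
    then show ?thesis
      unfolding expect_diff[OF exp_growth_add[OF g(1,2)] g(3), symmetric] expect_add[OF g(1,2), symmetric] expect_cmult[symmetric] by simp
  qed
  have pos: "N (\<lambda>_. 1) 0 > 0" using gint_1_pos[of \<phi> \<theta>] by (simp add: N_def)
  have "((\<lambda>t. N (?s x) t / N (\<lambda>_. 1) t) has_real_derivative
      (gint \<phi> \<theta> (\<lambda>z. ?s x z * q z) * N (\<lambda>_. 1) 0 - N (?s x) 0 * gint \<phi> \<theta> (\<lambda>z. 1 * q z)) / (N (\<lambda>_. 1) 0 * N (\<lambda>_. 1) 0)) (at 0 within {0..})"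
    using pos by (intro DERIV_divide dN exp_growth_site exp_growth_const) auto
  also have "(gint \<phi> \<theta> (\<lambda>z. ?s x z * q z) * N (\<lambda>_. 1) 0 - N (?s x) 0 * gint \<phi> \<theta> (\<lambda>z. 1 * q z)) / (N (\<lambda>_. 1) 0 * N (\<lambda>_. 1) 0)
     = expect \<phi> \<theta> (\<lambda>z. ?s x z * q z) - expect \<phi> \<theta> (?s x) * expect \<phi> \<theta> (\<lambda>z. 1 * q z)"
    unfolding N0 Iq expect_const using gint_1_pos[of \<phi> \<theta>] by (simp add: field_simps)
  also have "\<dots> = - third \<phi> \<theta> x y / 2 + (\<phi> $ y - mean \<phi> \<theta> y) * cov \<phi> \<theta> x y"
    unfolding Exq[OF exp_growth_site] Exq[OF exp_growth_const] unfolding expect_const mult_1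
    by (simp add: third_def Let_def mean_def cov_def cov_under_def power2_eq_square field_simps)
  finally have "((\<lambda>t. N (?s x) t / N (\<lambda>_. 1) t) has_real_derivative - third \<phi> \<theta> x y / 2 + (\<phi> $ y - mean \<phi> \<theta> y) * cov \<phi> \<theta> x y) (at 0 within {0..})" .
  then show ?thesis
    by (rule has_field_derivative_transform_within[of _ _ _ _ 1]) (auto simp: mean[unfolded k_def])
qed

end

section \<open>The maximum principle\<close>

lemma second_derivative_nonneg_at_min:
  fixes F :: "real \<Rightarrow> real"
  assumes F: "\<And>s. (F has_real_derivative G s) (at s)" and G: "(G has_real_derivative l) (at 0)"
    and d: "0 < d" and min: "\<And>s. \<bar>s\<bar> < d \<Longrightarrow> F 0 \<le> F s"
  shows "G 0 = 0" "0 \<le> l"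
proof -
  show G0: "G 0 = 0" by (rule DERIV_local_min[OF F d]) (use min in auto)
  show "0 \<le> l"
  proof (rule ccontr)
    assume "\<not> 0 \<le> l"
    then obtain e where e: "e > 0" "\<And>h. 0 < h \<Longrightarrow> h < e \<Longrightarrow> G h < 0"
      using DERIV_neg_dec_right[OF G] G0 by auto
    define b where "b = min d e / 2"
    have b: "0 < b" "b < d" "b < e" using d e by (auto simp: b_def)
    have "F b < F 0"
      using b e(2) F by (intro DERIV_neg_imp_decreasing_open[of 0 b F])
        (auto intro!: exI[of _ "G _"] continuous_at_imp_continuous_on DERIV_isCont)
    with min[of b] b show False by auto
  qed
qed

lemma right_derivative_nonneg_at_min:
  fixes F :: "real \<Rightarrow> real"
  assumes F: "(F has_real_derivative l) (at 0 within {0..})" and min: "\<And>t. 0 \<le> t \<Longrightarrow> F 0 \<le> F t"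
  shows "0 \<le> l"
proof (rule tendsto_lowerbound)
  show "((\<lambda>t. (F t - F 0) / (t - 0)) \<longlongrightarrow> l) (at 0 within {0..})"
    using F by (simp add: has_field_derivative_iff)
  show "\<forall>\<^sub>F t in at 0 within {0..}. 0 \<le> (F t - F 0) / (t - 0)"
    unfolding eventually_at by (intro exI[of _ 1]) (use min in auto)
  show "at (0::real) within {0..} \<noteq> bot"
    by (simp add: at_within_Ici_at_right)
qed

context spin_system
begin

definition second_diff :: "real^'n \<Rightarrow> real^'n \<Rightarrow> real^'n \<Rightarrow> 'n \<Rightarrow> real" where
  "second_diff \<phi> \<psi> \<theta> x = v (\<phi> + \<psi>) \<theta> x + v (\<phi> - \<psi>) \<theta> x - 2 * v \<phi> \<theta> x"

text \<open>Quadratic growth in the fields lets \<open>second_diff / barrier\<close> tend to 0 at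
  infinity. The derivative in each single variance is \<open>K\<close> times the barrier, which is
  to outweigh all other terms of the system.\<close>

definition barrier :: "real \<Rightarrow> real^'n \<Rightarrow> real^'n \<Rightarrow> real^'n \<Rightarrow> real" where
  "barrier K \<phi> \<psi> \<theta> = exp (K * (\<Sum>i\<in>UNIV. (\<theta> $ i)\<^sup>2)) * (1 + (norm \<phi>)\<^sup>2 + (norm \<psi>)\<^sup>2)"

lemma barrier_pos: "barrier K \<phi> \<psi> \<theta> > 0"
  unfolding barrier_def by (intro mult_pos_pos add_pos_nonneg) auto

text \<open>The terms linear in \<open>\<phi>\<close> cancel in a second difference, and
  \<open>v\<close> enters \<open>mean\<close> with a minus sign: convexity of \<open>v\<close> is
  concavity of the mean spin.\<close>

lemma mean_second_difference:
  "2 * mean \<phi> \<theta> x - mean (\<phi> + \<psi>) \<theta> x - mean (\<phi> - \<psi>) \<theta> x = (\<theta> $ x)\<^sup>2 * second_diff \<phi> \<psi> \<theta> x"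
  unfolding mean_eq second_diff_def by (simp add: algebra_simps)

text \<open>Write \<open>k = 1 / (\<theta> $ y)\<^sup>2\<close> and \<open>\<tau> = 1 / k\<close>. With \<open>p\<close>, \<open>q\<close> the half sum and half difference of \<open>v (\<phi> \<plusminus> \<psi>) \<theta> y\<close>,
  the second difference \<open>D x = second_diff \<phi> \<psi> \<theta> x\<close> satisfies the parabolic system
  \<open>\<partial>\<^sub>\<tau> D x = 1/2 \<partial>\<^sub>\<phi>\<^sup>2 D x - p \<partial>\<^sub>\<phi> D x - q \<partial>\<^sub>\<psi> D x - dv x y * D y\<close> in the coordinates at \<open>y\<close>.
  It is cooperative because \<open>dv x y \<le> 0\<close> for \<open>x \<noteq> y\<close>, so \<open>D x\<close> cannot touch \<open>- \<epsilon> * barrier\<close> from above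
  for the first time at a point where \<open>\<phi> $ y\<close> and \<open>\<theta> $ y\<close> are positive.\<close>

lemma no_negative_touch:
  fixes \<phi> \<psi> \<theta> :: "real^'n"
  assumes vb: "\<And>\<phi> \<theta> x. (\<And>i. \<bar>\<theta> $ i\<bar> \<le> \<Theta>) \<Longrightarrow> \<bar>v \<phi> \<theta> x\<bar> \<le> Kv * (1 + norm \<phi>)"
    and Tb: "\<And>\<phi> \<theta> x y. (\<And>i. \<bar>\<theta> $ i\<bar> \<le> \<Theta>) \<Longrightarrow> \<bar>dv \<phi> \<theta> x y\<bar> \<le> KT"
    and Kv: "Kv \<ge> 0" and K: "K > 1 + 6 * Kv + KT"
    and \<theta>: "\<And>i. 0 \<le> \<theta> $ i" "\<And>i. \<theta> $ i \<le> \<Theta>"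
    and x: "\<theta> $ x > 0" and y: "\<theta> $ y > 0" "\<phi> $ y > 0" and \<epsilon>: "\<epsilon> > 0"
    and eq: "second_diff \<phi> \<psi> \<theta> x + \<epsilon> * barrier K \<phi> \<psi> \<theta> = 0"
    and h1: "\<And>s. - \<phi> $ y \<le> s \<Longrightarrow> 0 \<le> second_diff (\<phi> + s *\<^sub>R axis y 1) \<psi> \<theta> x + \<epsilon> * barrier K (\<phi> + s *\<^sub>R axis y 1) \<psi> \<theta>"
    and h2: "\<And>s. 0 \<le> second_diff \<phi> (\<psi> + s *\<^sub>R axis y 1) \<theta> x + \<epsilon> * barrier K \<phi> (\<psi> + s *\<^sub>R axis y 1) \<theta>"
    and h3: "\<And>t. 0 \<le> t \<Longrightarrow> 0 \<le> second_diff \<phi> \<psi> (\<chi> i. if i = y then 1 / sqrt (1 / (\<theta> $ y)\<^sup>2 + t) else \<theta> $ i) x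
        + \<epsilon> * barrier K \<phi> \<psi> (\<chi> i. if i = y then 1 / sqrt (1 / (\<theta> $ y)\<^sup>2 + t) else \<theta> $ i)"
    and h4: "0 \<le> second_diff \<phi> \<psi> \<theta> y + \<epsilon> * barrier K \<phi> \<psi> \<theta>"
  shows False
proof -
  define k where "k = 1 / (\<theta> $ y)\<^sup>2"
  define kx where "kx = 1 / (\<theta> $ x)\<^sup>2"
  have k: "k > 0" "(\<theta> $ y)\<^sup>2 = 1 / k" and kx: "kx > 0" "(\<theta> $ x)\<^sup>2 = 1 / kx" using x y by (auto simp: k_def kx_def)
  have \<theta>4: "(\<theta> $ y)^4 = 1 / k\<^sup>2" using y by (simp add: k_def power_divide power_mult[symmetric])
  have abs\<theta>: "\<bar>\<theta> $ i\<bar> \<le> \<Theta>" for i using \<theta> by simp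
  define W where "W = exp (K * (\<Sum>i\<in>UNIV. (\<theta> $ i)\<^sup>2))"
  define X where "X = \<epsilon> * W"
  have X: "X > 0" using \<epsilon> by (simp add: X_def W_def)
  define N where "N = 1 + (norm \<phi>)\<^sup>2 + (norm \<psi>)\<^sup>2"
  have N: "N \<ge> 1" by (simp add: N_def)
  have barrier: "\<epsilon> * barrier K \<phi> \<psi> \<theta> = X * N" by (simp add: barrier_def X_def W_def N_def)
  have nsq: "(norm (a + s *\<^sub>R axis y (1::real)))\<^sup>2 = (norm a)\<^sup>2 + 2 * s * a $ y + s\<^sup>2" for a :: "real^'n" and s
  proof -
    have "axis y (1::real) $ y = 1" by (simp add: axis_def)
    then show ?thesis unfolding power2_norm_eq_inner inner_add_left inner_add_right
      by (simp add: inner_axis inner_axis' power2_eq_square)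
  qed
  have E_mean: "second_diff a b \<theta> x = kx * (2 * mean a \<theta> x - mean (a + b) \<theta> x - mean (a - b) \<theta> x)" for a b
    unfolding mean_second_difference using kx by (simp add: field_simps)
  define c0 where "c0 = cov \<phi> \<theta> x y"
  define cp where "cp = cov (\<phi> + \<psi>) \<theta> x y"
  define cm where "cm = cov (\<phi> - \<psi>) \<theta> x y"
  define t0 where "t0 = third \<phi> \<theta> x y"
  define tp where "tp = third (\<phi> + \<psi>) \<theta> x y"
  define tm where "tm = third (\<phi> - \<psi>) \<theta> x y"
  define v0 where "v0 = v \<phi> \<theta> y"
  define vp where "vp = v (\<phi> + \<psi>) \<theta> y"
  define vm where "vm = v (\<phi> - \<psi>) \<theta> y"
  define T0 where "T0 = dv \<phi> \<theta> x y"
  obtain M0 where M0: "\<And>s. ((\<lambda>s. mean (\<phi> + s *\<^sub>R axis y 1) \<theta> x) has_real_derivative M0 s) (at s)"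
      "M0 0 = k * c0" "(M0 has_real_derivative k\<^sup>2 * t0) (at 0)"
    using mean_deriv_phi[where \<phi>=\<phi> and x=x, OF y(1)] unfolding \<theta>4 k(2) by (auto simp: c0_def t0_def mult.commute)
  obtain Mp where Mp: "\<And>s. ((\<lambda>s. mean ((\<phi> + \<psi>) + s *\<^sub>R axis y 1) \<theta> x) has_real_derivative Mp s) (at s)"
      "Mp 0 = k * cp" "(Mp has_real_derivative k\<^sup>2 * tp) (at 0)"
    using mean_deriv_phi[where \<phi>="\<phi> + \<psi>" and x=x, OF y(1)] unfolding \<theta>4 k(2) by (auto simp: cp_def tp_def mult.commute)
  obtain Mm where Mm: "\<And>s. ((\<lambda>s. mean ((\<phi> - \<psi>) + s *\<^sub>R axis y 1) \<theta> x) has_real_derivative Mm s) (at s)"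
      "Mm 0 = k * cm" "(Mm has_real_derivative k\<^sup>2 * tm) (at 0)"
    using mean_deriv_phi[where \<phi>="\<phi> - \<psi>" and x=x, OF y(1)] unfolding \<theta>4 k(2) by (auto simp: cm_def tm_def mult.commute)
  define F1 where "F1 s = second_diff (\<phi> + s *\<^sub>R axis y 1) \<psi> \<theta> x + \<epsilon> * barrier K (\<phi> + s *\<^sub>R axis y 1) \<psi> \<theta>" for s
  define G1 where "G1 s = kx * (2 * M0 s - Mp s - Mm s) + X * (2 * \<phi> $ y + 2 * s)" for s
  have F1: "(F1 has_real_derivative G1 s) (at s)" for s
  proof -
    have "F1 = (\<lambda>s. kx * (2 * mean (\<phi> + s *\<^sub>R axis y 1) \<theta> x - mean ((\<phi> + \<psi>) + s *\<^sub>R axis y 1) \<theta> x - mean ((\<phi> - \<psi>) + s *\<^sub>R axis y 1) \<theta> x)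
        + X * (1 + ((norm \<phi>)\<^sup>2 + 2 * s * \<phi> $ y + s\<^sup>2) + (norm \<psi>)\<^sup>2))"
      by (simp add: F1_def fun_eq_iff E_mean barrier_def nsq X_def W_def algebra_simps)
    then show ?thesis unfolding G1_def
      by (auto intro!: derivative_eq_intros M0 Mp Mm)
  qed
  have G1: "(G1 has_real_derivative (kx * (2 * (k\<^sup>2 * t0) - k\<^sup>2 * tp - k\<^sup>2 * tm) + X * 2)) (at 0)"
    unfolding G1_def by (auto intro!: derivative_eq_intros M0 Mp Mm)
  have F10: "F1 0 = 0" using eq by (simp add: F1_def)
  \<comment> \<open>Here \<open>\<phi> $ y > 0\<close> is used: the interval is two-sided and stays
    in \<open>\<phi> \<ge> 0\<close>, so both the first and the second order condition hold.\<close>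
  have F1min: "F1 0 \<le> F1 s" if "\<bar>s\<bar> < \<phi> $ y" for s
  proof -
    have "0 \<le> F1 s" unfolding F1_def by (rule h1) (use that in auto)
    then show ?thesis by (simp add: F10)
  qed
  have e1: "kx * k * (2 * c0 - cp - cm) = - 2 * X * \<phi> $ y"
    using second_derivative_nonneg_at_min(1)[OF F1 G1 y(2) F1min] M0(2) Mp(2) Mm(2) by (simp add: G1_def algebra_simps)
  have e3: "kx * k\<^sup>2 * (2 * t0 - tp - tm) \<ge> - 2 * X"
    using second_derivative_nonneg_at_min(2)[OF F1 G1 y(2) F1min] by (simp add: algebra_simps)
  \<comment> \<open>A first order condition suffices in the direction of \<open>\<psi>\<close>: it
    controls the drift term with \<open>q\<close>, and the equation contains no second derivative in
    \<open>\<psi>\<close>.\<close>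
  define F2 where "F2 s = second_diff \<phi> (\<psi> + s *\<^sub>R axis y 1) \<theta> x + \<epsilon> * barrier K \<phi> (\<psi> + s *\<^sub>R axis y 1) \<theta>" for s
  have e2: "kx * k * (cm - cp) = - 2 * X * \<psi> $ y"
  proof -
    have Mm': "((\<lambda>s. mean ((\<phi> - \<psi>) + (- s) *\<^sub>R axis y 1) \<theta> x) has_real_derivative (k * cm) * (- 1)) (at 0)"
    proof (rule DERIV_chain2[where g = uminus and f = "\<lambda>s. mean ((\<phi> - \<psi>) + s *\<^sub>R axis y 1) \<theta> x"])
      show "((\<lambda>s. mean ((\<phi> - \<psi>) + s *\<^sub>R axis y 1) \<theta> x) has_real_derivative k * cm) (at (- 0))" using Mm(1)[of 0] Mm(2) by simp
    qed (auto intro!: derivative_eq_intros)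
    then have Mm': "((\<lambda>s. mean (\<phi> - \<psi> - s *\<^sub>R axis y 1) \<theta> x) has_real_derivative - (k * cm)) (at 0)" by simp
    have Mp': "((\<lambda>s. mean ((\<phi> + \<psi>) + s *\<^sub>R axis y 1) \<theta> x) has_real_derivative (k * cp)) (at 0)" using Mp(1)[of 0] Mp(2) by simp
    have "F2 = (\<lambda>s. kx * (2 * mean \<phi> \<theta> x - mean ((\<phi> + \<psi>) + s *\<^sub>R axis y 1) \<theta> x - mean ((\<phi> - \<psi>) + (- s) *\<^sub>R axis y 1) \<theta> x)
        + X * (1 + (norm \<phi>)\<^sup>2 + ((norm \<psi>)\<^sup>2 + 2 * s * \<psi> $ y + s\<^sup>2)))"
      by (simp add: F2_def fun_eq_iff E_mean barrier_def nsq X_def W_def algebra_simps)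
    then have "(F2 has_real_derivative (kx * (- (k * cp) - (k * cm) * (- 1)) + X * (2 * \<psi> $ y))) (at 0)"
      using Mm' by (auto intro!: derivative_eq_intros Mp')
    moreover have "F2 0 = 0" using eq by (simp add: F2_def)
    moreover have "0 \<le> F2 s" for s unfolding F2_def by (rule h2)
    ultimately have "kx * (- (k * cp) - (k * cm) * (- 1)) + X * (2 * \<psi> $ y) = 0"
      by (intro DERIV_local_min[of F2 _ 0 1]) auto
    then show ?thesis by (simp add: algebra_simps)
  qed
  have beta: "\<phi> $ y - mean \<phi> \<theta> y = v0 / k" "(\<phi> + \<psi>) $ y - mean (\<phi> + \<psi>) \<theta> y = vp / k" "(\<phi> - \<psi>) $ y - mean (\<phi> - \<psi>) \<theta> y = vm / k"
    unfolding mean_eq k(2) v0_def vp_def vm_def by simp_all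
  define \<theta>t where "\<theta>t t = (\<chi> i. if i = y then 1 / sqrt (k + t) else \<theta> $ i)" for t
  define d where "d = 2 * (- t0 / 2 + v0 / k * c0) - (- tp / 2 + vp / k * cp) - (- tm / 2 + vm / k * cm)"
  define D where "D = 2 * mean \<phi> \<theta> x - mean (\<phi> + \<psi>) \<theta> x - mean (\<phi> - \<psi>) \<theta> x"
  \<comment> \<open>Growing \<open>t\<close> lowers the variance at \<open>y\<close>, that is, goes
    back in time, where \<open>h3\<close> still holds; hence the sign of the right derivative. For
    \<open>x = y\<close> the factor \<open>1 / (\<theta> $ x)\<^sup>2\<close> in front of the means
    varies too, which adds \<open>D\<close>.\<close>
  have e4: "kx * d + (if x = y then D else 0) - X * K * N / k\<^sup>2 \<ge> 0"
  proof -
    define F3 where "F3 t = second_diff \<phi> \<psi> (\<theta>t t) x + \<epsilon> * barrier K \<phi> \<psi> (\<theta>t t)" for t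
    let ?D = "\<lambda>t. 2 * mean \<phi> (\<theta>t t) x - mean (\<phi> + \<psi>) (\<theta>t t) x - mean (\<phi> - \<psi>) (\<theta>t t) x"
    have th0: "\<theta>t 0 = \<theta>" using y by (simp add: \<theta>t_def vec_eq_iff k_def real_sqrt_divide)
    note md = mean_deriv_k[where x=x, OF y(1), folded k_def, folded \<theta>t_def]
    have "(?D has_real_derivative d) (at 0 within {0..})"
      unfolding d_def t0_def tp_def tm_def c0_def cp_def cm_def beta[symmetric]
      by (intro DERIV_diff DERIV_cmult md)
    moreover have "((\<lambda>t. if x = y then k + t else kx) has_real_derivative (if x = y then 1 else 0)) (at 0 within {0..})"
      by (auto intro!: derivative_eq_intros)
    ultimately have "((\<lambda>t. (if x = y then k + t else kx) * ?D t) has_real_derivative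
        ((if x = y then 1 else 0) * ?D 0 + d * (if x = y then k + 0 else kx))) (at 0 within {0..})"
      by (intro DERIV_mult)
    moreover have "(if x = y then 1 else 0) * ?D 0 + d * (if x = y then k + 0 else kx) = kx * d + (if x = y then D else 0)"
      unfolding th0 D_def by (auto simp: kx_def k_def)
    moreover have "((\<lambda>t. \<epsilon> * (exp (K * ((\<Sum>i\<in>UNIV - {y}. (\<theta> $ i)\<^sup>2) + 1 / (k + t))) * N)) has_real_derivative
        - (X * K * N / k\<^sup>2)) (at 0 within {0..})"
    proof -
      have s: "(\<Sum>i\<in>UNIV - {y}. (\<theta> $ i)\<^sup>2) + 1 / k = (\<Sum>i\<in>UNIV. (\<theta> $ i)\<^sup>2)"
        unfolding k(2)[symmetric] by (simp add: sum.remove[of UNIV y])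
      have "((\<lambda>t. 1 / (k + t)) has_real_derivative - (1 / k\<^sup>2)) (at 0 within {0..})"
        using k by (auto intro!: derivative_eq_intros simp: power2_eq_square)
      then have "((\<lambda>t. \<epsilon> * (exp (K * ((\<Sum>i\<in>UNIV - {y}. (\<theta> $ i)\<^sup>2) + 1 / (k + t))) * N)) has_real_derivative
         \<epsilon> * (exp (K * ((\<Sum>i\<in>UNIV - {y}. (\<theta> $ i)\<^sup>2) + 1 / (k + 0))) * (K * (0 + - (1 / k\<^sup>2))) * N)) (at 0 within {0..})"
        by (intro DERIV_cmult DERIV_cmult_right DERIV_chain2[OF DERIV_exp] DERIV_add DERIV_const)
      then show ?thesis by (simp add: s X_def W_def mult_ac)
    qed
    ultimately have "((\<lambda>t. (if x = y then k + t else kx) * ?D t + \<epsilon> * (exp (K * ((\<Sum>i\<in>UNIV - {y}. (\<theta> $ i)\<^sup>2) + 1 / (k + t))) * N))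
       has_real_derivative ((kx * d + (if x = y then D else 0)) + - (X * K * N / k\<^sup>2))) (at 0 within {0..})"
      by (intro DERIV_add) simp_all
    moreover have F3: "F3 t = (if x = y then k + t else kx) * ?D t + \<epsilon> * (exp (K * ((\<Sum>i\<in>UNIV - {y}. (\<theta> $ i)\<^sup>2) + 1 / (k + t))) * N)" if t: "0 \<le> t" for t
    proof -
      have "((\<theta>t t) $ y)\<^sup>2 = 1 / (k + t)" using k t by (simp add: \<theta>t_def power_divide)
      moreover have "(\<Sum>i\<in>UNIV - {y}. ((\<theta>t t) $ i)\<^sup>2) = (\<Sum>i\<in>UNIV - {y}. (\<theta> $ i)\<^sup>2)" by (intro sum.cong) (auto simp: \<theta>t_def)
      ultimately have s: "(\<Sum>i\<in>UNIV. (\<theta>t t $ i)\<^sup>2) = (\<Sum>i\<in>UNIV - {y}. (\<theta> $ i)\<^sup>2) + 1 / (k + t)"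
        by (simp add: sum.remove[of UNIV y])
      have "(\<theta>t t $ x)\<^sup>2 = 1 / (if x = y then k + t else kx)" using k t kx by (auto simp: \<theta>t_def power_divide)
      moreover have "(if x = y then k + t else kx) > 0" using k t kx by auto
      ultimately have "second_diff \<phi> \<psi> (\<theta>t t) x = (if x = y then k + t else kx) * ?D t"
        unfolding mean_second_difference by (metis less_irrefl mult.assoc mult_1 nonzero_eq_divide_eq mult.commute)
      then show ?thesis by (simp add: F3_def barrier_def s N_def)
    qed
    ultimately have "(F3 has_real_derivative ((kx * d + (if x = y then D else 0)) + - (X * K * N / k\<^sup>2))) (at 0 within {0..})"
      by (auto elim!: has_field_derivative_transform_within[of _ _ _ _ 1])
    moreover have "F3 0 = 0" using eq by (simp add: F3_def th0)
    moreover have "0 \<le> F3 t" if "0 \<le> t" for t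
      unfolding F3_def \<theta>t_def k_def by (rule h3[OF that])
    ultimately have "0 \<le> (kx * d + (if x = y then D else 0)) + - (X * K * N / k\<^sup>2)"
      by (intro right_derivative_nonneg_at_min[of F3]) auto
    then show ?thesis by simp
  qed
  define p where "p = (vp + vm) / 2"
  define q where "q = (vp - vm) / 2"
  have Ey: "vp + vm - 2 * v0 \<ge> - X * N"
    using h4 barrier by (simp add: second_diff_def vp_def vm_def v0_def)
  \<comment> \<open>The factor \<open>k\<^sup>2\<close> turns a derivative in the precision into
    minus the derivative in the variance. Half sum and half difference of \<open>vp\<close>,
    \<open>vm\<close> arrange the first order terms so that \<open>e1\<close> and \<open>e2\<close>
    apply.\<close>
  have kkd: "k\<^sup>2 * (kx * d) = - (kx * k\<^sup>2 * (2 * t0 - tp - tm)) / 2 - 2 * X * \<phi> $ y * p - 2 * X * \<psi> $ y * q - (vp + vm - 2 * v0) * (k * kx * c0)"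
  proof -
    have "k\<^sup>2 * (kx * d) = - (kx * k\<^sup>2 * (2 * t0 - tp - tm)) / 2 + (kx * k * (2 * c0 - cp - cm)) * p + (kx * k * (cm - cp)) * q - (vp + vm - 2 * v0) * (k * kx * c0)"
      unfolding d_def p_def q_def using k by (simp add: power2_eq_square field_simps)
    then show ?thesis unfolding e1 e2 by simp
  qed
  have T0: "\<bar>T0\<bar> \<le> KT" unfolding T0_def by (rule Tb) (rule abs\<theta>)
  \<comment> \<open>The zero order term. For \<open>x \<noteq> y\<close> its coefficient
    \<open>k * kx * c0 = - T0\<close> is nonnegative, so the one-sided bound \<open>h4\<close> at
    the site \<open>y\<close> is enough. For \<open>x = y\<close> the second difference is known
    exactly at the touching point, and the extra \<open>D\<close> cancels the part of
    \<open>k * k * c0\<close> that is not \<open>- T0\<close>.\<close>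
  have last: "- (vp + vm - 2 * v0) * (k * kx * c0) + k\<^sup>2 * (if x = y then D else 0) \<le> X * N * KT"
  proof (cases "x = y")
    case False
    have c0: "k * kx * c0 = - T0"
      unfolding c0_def cov_eq k(2) kx(2) T0_def using False k kx by simp
    have "0 \<le> c0" unfolding c0_def by (rule cov_nonneg[OF \<theta>(1) False])
    then have nn: "0 \<le> k * kx * c0" using k kx by simp
    then have "(- (vp + vm - 2 * v0)) * (k * kx * c0) \<le> (X * N) * (k * kx * c0)"
      using Ey by (intro mult_right_mono) auto
    also have "\<dots> \<le> (X * N) * KT" using T0 c0 X N by (intro mult_left_mono) auto
    finally show ?thesis using False by simp
  next
    case True
    have kk: "kx = k" using True by (simp add: k_def kx_def)
    have "c0 = 1 / k - 1 / k * (1 / k) * T0"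
      unfolding c0_def cov_eq T0_def by (simp add: True k(2))
    then have c0: "k * k * c0 = k - T0" using k(1) by (simp add: field_simps)
    have EX: "second_diff \<phi> \<psi> \<theta> x = - X * N" using eq barrier by linarith
    have ExN: "vp + vm - 2 * v0 = - X * N" using EX unfolding second_diff_def vp_def vm_def v0_def True .
    have "D = 1 / k * (- X * N)" unfolding D_def mean_second_difference EX unfolding True k(2) ..
    then have D: "k * D = - X * N" using k(1) by simp
    have "k\<^sup>2 * D = k * (- X * N)" unfolding D[symmetric] by (simp add: power2_eq_square)
    then have "- (vp + vm - 2 * v0) * (k * kx * c0) + k\<^sup>2 * D = - (X * N * T0)"
      unfolding kk c0 ExN by (simp add: algebra_simps)
    also have "\<dots> \<le> X * N * KT"
    proof -
      have "X * N * (- T0) \<le> X * N * KT" using T0 X N by (intro mult_left_mono) auto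
      then show ?thesis by simp
    qed
    finally show ?thesis using True by simp
  qed
  have drift: "- 2 * X * \<phi> $ y * p - 2 * X * \<psi> $ y * q \<le> X * (6 * Kv * N)"
  proof -
    let ?a = "norm \<phi>" and ?b = "norm \<psi>"
    have v_le: "\<bar>vp\<bar> \<le> Kv * (1 + ?a + ?b)" "\<bar>vm\<bar> \<le> Kv * (1 + ?a + ?b)"
    proof -
      have "\<bar>vp\<bar> \<le> Kv * (1 + norm (\<phi> + \<psi>))" "\<bar>vm\<bar> \<le> Kv * (1 + norm (\<phi> - \<psi>))"
        unfolding vp_def vm_def by (rule vb, rule abs\<theta>)+
      moreover have "Kv * (1 + norm (\<phi> + \<psi>)) \<le> Kv * (1 + ?a + ?b)" "Kv * (1 + norm (\<phi> - \<psi>)) \<le> Kv * (1 + ?a + ?b)"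
        using norm_triangle_ineq[of \<phi> \<psi>] norm_triangle_ineq4[of \<phi> \<psi>] Kv by (auto intro!: mult_left_mono)
      ultimately show "\<bar>vp\<bar> \<le> Kv * (1 + ?a + ?b)" "\<bar>vm\<bar> \<le> Kv * (1 + ?a + ?b)" by linarith+
    qed
    then have pq: "\<bar>p\<bar> \<le> Kv * (1 + ?a + ?b)" "\<bar>q\<bar> \<le> Kv * (1 + ?a + ?b)" by (auto simp: p_def q_def)
    have "\<bar>\<phi> $ y\<bar> * \<bar>p\<bar> \<le> ?a * (Kv * (1 + ?a + ?b))" "\<bar>\<psi> $ y\<bar> * \<bar>q\<bar> \<le> ?b * (Kv * (1 + ?a + ?b))"
      by (intro mult_mono pq component_le_norm_cart; simp)+
    then have "- (\<phi> $ y * p) \<le> ?a * (Kv * (1 + ?a + ?b))" "- (\<psi> $ y * q) \<le> ?b * (Kv * (1 + ?a + ?b))"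
      by (auto simp: abs_mult[symmetric])
    then have "- 2 * \<phi> $ y * p - 2 * \<psi> $ y * q \<le> 2 * (?a * (Kv * (1 + ?a + ?b)) + ?b * (Kv * (1 + ?a + ?b)))" by simp
    also have "\<dots> = Kv * (2 * ((?a + ?b) * (1 + ?a + ?b)))" by (simp add: algebra_simps)
    also have "\<dots> \<le> Kv * (6 * N)"
    proof (intro mult_left_mono Kv)
      have "2 * ((a + b) * (1 + a + b)) \<le> 6 * (1 + a\<^sup>2 + b\<^sup>2)" for a b :: real
      proof -
        have "0 \<le> 2 * (a - b)\<^sup>2 + (a - 1)\<^sup>2 + (b - 1)\<^sup>2 + a\<^sup>2 + b\<^sup>2 + 4" by simp
        then show ?thesis by (simp add: power2_eq_square algebra_simps)
      qed
      then show "2 * ((?a + ?b) * (1 + ?a + ?b)) \<le> 6 * N" unfolding N_def by blast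
    qed
    finally have "X * (- 2 * \<phi> $ y * p - 2 * \<psi> $ y * q) \<le> X * (Kv * (6 * N))"
      using X by (intro mult_left_mono) auto
    then show ?thesis by (simp add: algebra_simps)
  qed
  have "0 \<le> k\<^sup>2 * (kx * d + (if x = y then D else 0) - X * K * N / k\<^sup>2)"
    using e4 by (intro mult_nonneg_nonneg) auto
  also have "\<dots> = k\<^sup>2 * (kx * d) + k\<^sup>2 * (if x = y then D else 0) - X * K * N"
    using k by (simp add: algebra_simps)
  \<comment> \<open>This is where the condition on \<open>K\<close> comes from: the second
    derivative of the barrier contributes 1, the drift \<open>6 * Kv\<close>, and the zero order
    term \<open>KT\<close>.\<close>
  also have "\<dots> \<le> X + X * (6 * Kv * N) + X * N * KT - X * K * N"
    using kkd last drift e3 by linarith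
  also have "\<dots> \<le> X * N + X * (6 * Kv * N) + X * N * KT - X * K * N"
    using X N by simp
  also have "\<dots> = X * N * (1 + 6 * Kv + KT - K)" by (simp add: algebra_simps)
  also have "\<dots> < 0" using X N K by (intro mult_pos_neg) auto
  finally show False by simp
qed


section \<open>The initial condition: all variances zero\<close>

lemma f_superadditive: "0 \<le> a \<Longrightarrow> 0 \<le> b \<Longrightarrow> f x a + f x b \<le> f x (a + b)"
proof (cases "a + b = 0")
  case False
  assume ab: "0 \<le> a" "0 \<le> b"
  then have pos: "a + b > 0" using False by simp
  have *: "f x c \<le> c / (a + b) * f x (a + b)" if "0 \<le> c" "c \<le> a + b" for c
  proof -
    have "f x ((1 - c / (a + b)) *\<^sub>R 0 + (c / (a + b)) *\<^sub>R (a + b)) \<le> (1 - c / (a + b)) * f x 0 + c / (a + b) * f x (a + b)"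
      using that pos by (intro convex_onD[OF f_convex]) auto
    then show ?thesis using pos by simp
  qed
  have "a / (a + b) * f x (a + b) + b / (a + b) * f x (a + b) = f x (a + b)"
    using pos by (simp add: add_divide_distrib[symmetric] distrib_right[symmetric])
  then show ?thesis using *[of a] *[of b] ab by linarith
next
  case True
  assume "0 \<le> a" "0 \<le> b"
  then have "a = 0" "b = 0" using True by auto
  then show ?thesis by simp
qed

text \<open>If \<open>s - u\<close> is negative, oddness turns the claim into
  \<open>f (u - s) + 2 f s \<le> f (u + s)\<close>, which is superadditivity used twice; otherwise
  it is midpoint convexity.\<close>

lemma f_second_difference_nonneg:
  assumes s: "0 \<le> s" shows "2 * f x s \<le> f x (s + u) + f x (s - u)"
proof -
  have *: "2 * f x s \<le> f x (s + u) + f x (s - u)" if u: "0 \<le> u" for u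
  proof (cases "u \<le> s")
    case True
    have "f x ((1 - 1/2) *\<^sub>R (s + u) + (1/2) *\<^sub>R (s - u)) \<le> (1 - 1/2) * f x (s + u) + 1/2 * f x (s - u)"
      using True s u by (intro convex_onD[OF f_convex]) auto
    moreover have "(1 - 1/2) *\<^sub>R (s + u) + (1/2) *\<^sub>R (s - u) = s" by (simp add: field_simps)
    ultimately show ?thesis by simp
  next
    case False
    have "f x (u - s) + f x (2 * s) \<le> f x (u + s)" "f x s + f x s \<le> f x (2 * s)"
      using f_superadditive[of "u - s" "2 * s" x] f_superadditive[of s s x] False s by (auto simp: add.commute[of u s])
    moreover have "f x (s - u) = - f x (u - s)" using f_odd[of x "u - s"] by simp
    ultimately show ?thesis unfolding add.commute[of s u] by linarith
  qed
  show ?thesis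
    using *[of u] *[of "- u"] by (cases "u \<ge> 0") auto
qed

section \<open>Existence of a minimum and its exclusion\<close>

lemma second_diff_continuous: "continuous_on UNIV (\<lambda>p. second_diff (fst p) (fst (snd p)) (snd (snd p)) x)"
proof -
  have v: "continuous_on UNIV (\<lambda>p. v (a p) (b p) x)" if "continuous_on UNIV a" "continuous_on UNIV b"
    for a b :: "(real^'n) \<times> (real^'n) \<times> (real^'n) \<Rightarrow> real^'n"
    using continuous_on_compose2[OF v_continuous[of x], of UNIV "\<lambda>p. (a p, b p)"] that
    by (auto intro: continuous_on_Pair)
  show ?thesis unfolding second_diff_def by (intro continuous_intros v)
qed

lemma barrier_continuous: "continuous_on UNIV (\<lambda>p. barrier K (fst p) (fst (snd p)) (snd (snd p)))"
  unfolding barrier_def by (intro continuous_intros)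

lemma second_diff_bound:
  assumes vb: "\<And>\<phi>. \<bar>v \<phi> \<theta> x\<bar> \<le> Kv * (1 + norm \<phi>)" and Kv: "Kv \<ge> 0"
  shows "\<bar>second_diff \<phi> \<psi> \<theta> x\<bar> \<le> 4 * Kv * (1 + norm \<phi> + norm \<psi>)"
proof -
  have "Kv * (1 + norm (\<phi> + \<psi>)) \<le> Kv * (1 + norm \<phi> + norm \<psi>)" "Kv * (1 + norm (\<phi> - \<psi>)) \<le> Kv * (1 + norm \<phi> + norm \<psi>)"
       "Kv * (1 + norm \<phi>) \<le> Kv * (1 + norm \<phi> + norm \<psi>)"
    using norm_triangle_ineq[of \<phi> \<psi>] norm_triangle_ineq4[of \<phi> \<psi>] Kv by (auto intro!: mult_left_mono)
  then show ?thesis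
    using vb[of "\<phi> + \<psi>"] vb[of "\<phi> - \<psi>"] vb[of \<phi>] unfolding second_diff_def by linarith
qed

text \<open>A minimum point of \<open>second_diff / barrier\<close> with fewer active sites is excluded by \<open>IH\<close>, the point \<open>\<phi> = 0\<close> by
  oddness of \<open>v\<close>, and every other one by the maximum principle at a site with \<open>\<phi> $ y > 0\<close>.\<close>

lemma second_diff_nonneg_active:
  fixes \<theta>1 \<phi>1 \<psi>1 :: "real^'n"
  assumes IH: "\<And>\<theta> \<phi> \<psi> x. (\<And>i. 0 \<le> \<theta> $ i \<and> \<theta> $ i \<le> \<Theta>) \<Longrightarrow> {i. \<theta> $ i \<noteq> 0} \<subset> Y \<Longrightarrow> (\<And>i. 0 \<le> \<phi> $ i) \<Longrightarrow> 0 \<le> second_diff \<phi> \<psi> \<theta> x"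
    and \<theta>1: "\<And>i. 0 \<le> \<theta>1 $ i \<and> \<theta>1 $ i \<le> \<Theta>" and \<phi>1: "\<And>i. 0 \<le> \<phi>1 $ i"
    and supp: "\<And>i. i \<notin> Y \<Longrightarrow> \<phi>1 $ i = 0 \<and> \<psi>1 $ i = 0 \<and> \<theta>1 $ i = 0" and x1: "x1 \<in> Y"
  shows "0 \<le> second_diff \<phi>1 \<psi>1 \<theta>1 x1"
proof (rule ccontr)
  assume neg: "\<not> 0 \<le> second_diff \<phi>1 \<psi>1 \<theta>1 x1"
  have \<Theta>: "\<Theta> \<ge> 0" using \<theta>1 order_trans by blast
  obtain Kv where Kv: "Kv \<ge> 0" and vb: "\<And>\<phi> \<theta> x. (\<And>i. \<bar>\<theta> $ i\<bar> \<le> \<Theta>) \<Longrightarrow> \<bar>v \<phi> \<theta> x\<bar> \<le> Kv * (1 + norm \<phi>)"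
    using v_growth[OF \<Theta>] by blast
  obtain KT where KT: "KT \<ge> 0" and Tb: "\<And>\<phi> \<theta> x y. (\<And>i. \<bar>\<theta> $ i\<bar> \<le> \<Theta>) \<Longrightarrow> \<bar>dv \<phi> \<theta> x y\<bar> \<le> KT"
    using dv_bound[OF \<Theta>] by blast
  define K where "K = 2 + 6 * Kv + KT"
  have K: "K > 1 + 6 * Kv + KT" "K \<ge> 0" using Kv KT by (auto simp: K_def)
  define Q :: "((real^'n) \<times> (real^'n) \<times> (real^'n)) set" where "Q = {(\<phi>, \<psi>, \<theta>). (\<forall>i. 0 \<le> \<phi> $ i) \<and> (\<forall>i. 0 \<le> \<theta> $ i \<and> \<theta> $ i \<le> \<Theta>) \<and>
      (\<forall>i. i \<notin> Y \<longrightarrow> \<phi> $ i = 0 \<and> \<psi> $ i = 0 \<and> \<theta> $ i = 0)}"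
  define g where "g x p = second_diff (fst p) (fst (snd p)) (snd (snd p)) x / barrier K (fst p) (fst (snd p)) (snd (snd p))" for x p
  have g_cont: "continuous_on UNIV (g x)" for x
    unfolding g_def using barrier_pos
    by (intro continuous_on_divide second_diff_continuous barrier_continuous) (auto simp: less_imp_neq[symmetric])
  define p1 where "p1 = (\<phi>1, \<psi>1, \<theta>1)"
  have p1: "p1 \<in> Q" using \<theta>1 \<phi>1 supp by (auto simp: p1_def Q_def)
  define \<delta> where "\<delta> = - g x1 p1"
  have \<delta>: "\<delta> > 0" using neg barrier_pos[of K \<phi>1 \<psi>1 \<theta>1] by (simp add: \<delta>_def g_def p1_def divide_neg_pos)
  \<comment> \<open>Let \<open>s = norm \<phi> + norm \<psi>\<close>. For \<open>s > 1\<close> the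
    second difference is at most \<open>8 * Kv * s\<close> in absolute value, and the barrier is at
    least \<open>s\<^sup>2 / 2\<close>. So the quotient stays above \<open>- \<delta>\<close> once
    \<open>s > 16 * Kv / \<delta>\<close>.\<close>
  define R where "R = max 1 (16 * Kv / \<delta>)"
  define QR where "QR = Q \<inter> {p. norm (fst p) \<le> R \<and> norm (fst (snd p)) \<le> R}"
  have far: "g x (\<phi>, \<psi>, \<theta>) > - \<delta>" if p: "(\<phi>, \<psi>, \<theta>) \<in> Q" and out: "(\<phi>, \<psi>, \<theta>) \<notin> QR" for x \<phi> \<psi> \<theta>
  proof -
    let ?a = "norm \<phi>" and ?b = "norm \<psi>"
    let ?s = "?a + ?b"
    have s: "?s > R" using p out norm_ge_zero[of \<phi>] norm_ge_zero[of \<psi>] unfolding QR_def by (auto simp del: norm_ge_zero)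
    then have s1: "?s > 1" "16 * Kv / \<delta> < ?s" by (auto simp: R_def)
    have "\<bar>\<theta> $ i\<bar> \<le> \<Theta>" for i using p by (auto simp: Q_def)
    then have "\<bar>second_diff \<phi> \<psi> \<theta> x\<bar> \<le> 4 * Kv * (1 + ?a + ?b)" by (intro second_diff_bound vb Kv)
    also have "\<dots> \<le> 4 * Kv * (2 * ?s)" using s1 Kv by (intro mult_left_mono) auto
    also have "\<dots> = (8 * Kv) * ?s" by simp
    also have "\<dots> < (\<delta> * ?s / 2) * ?s"
    proof (rule mult_strict_right_mono)
      show "8 * Kv < \<delta> * ?s / 2" using s1(2) \<delta> by (simp add: field_simps)
      show "0 < ?s" using s1 by linarith
    qed
    also have "\<dots> \<le> \<delta> * (1 + ?a\<^sup>2 + ?b\<^sup>2)"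
    proof -
      have "?s * ?s / 2 \<le> 1 + ?a\<^sup>2 + ?b\<^sup>2"
      proof -
        have "0 \<le> (?a - ?b)\<^sup>2 + 2" by simp
        then show ?thesis by (simp add: power2_eq_square algebra_simps)
      qed
      then have "\<delta> * (?s * ?s / 2) \<le> \<delta> * (1 + ?a\<^sup>2 + ?b\<^sup>2)" using \<delta> by (intro mult_left_mono) auto
      then show ?thesis by simp
    qed
    also have "\<dots> \<le> \<delta> * barrier K \<phi> \<psi> \<theta>"
    proof -
      have "1 * (1 + ?a\<^sup>2 + ?b\<^sup>2) \<le> barrier K \<phi> \<psi> \<theta>"
        unfolding barrier_def using K(2) by (intro mult_right_mono) (auto intro!: mult_nonneg_nonneg sum_nonneg)
      then show ?thesis using \<delta> by (intro mult_left_mono) auto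
    qed
    finally have "- (\<delta> * barrier K \<phi> \<psi> \<theta>) < second_diff \<phi> \<psi> \<theta> x" by linarith
    then show ?thesis using barrier_pos[of K \<phi> \<psi> \<theta>] by (simp add: g_def field_simps)
  qed
  have p1R: "p1 \<in> QR"
  proof (rule ccontr)
    assume "p1 \<notin> QR"
    with p1 far[of \<phi>1 \<psi>1 \<theta>1 x1] show False by (simp add: p1_def \<delta>_def)
  qed
  have compact: "compact QR"
  proof -
    have "closed QR"
    proof -
      have c: "closed {p. 0 \<le> F p}" if "continuous_on UNIV F" for F :: "(real^'n) \<times> (real^'n) \<times> (real^'n) \<Rightarrow> real"
        using closed_Collect_le[OF continuous_on_const that] by simp
      have c0: "closed {p. F p = 0}" if "continuous_on UNIV F" for F :: "(real^'n) \<times> (real^'n) \<times> (real^'n) \<Rightarrow> real"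
        using closed_Collect_eq[OF that continuous_on_const] by simp
      have "QR = (\<Inter>i. {p. 0 \<le> fst p $ i}) \<inter> (\<Inter>i. {p. 0 \<le> snd (snd p) $ i}) \<inter> (\<Inter>i. {p. 0 \<le> \<Theta> - snd (snd p) $ i})
         \<inter> (\<Inter>i\<in>- Y. {p. fst p $ i = 0} \<inter> {p. fst (snd p) $ i = 0} \<inter> {p. snd (snd p) $ i = 0})
         \<inter> {p. 0 \<le> R - norm (fst p)} \<inter> {p. 0 \<le> R - norm (fst (snd p))}"
        unfolding QR_def Q_def by (auto simp: case_prod_unfold)
      also have "closed \<dots>"
        by (intro closed_Int closed_INT ballI c c0 continuous_intros)
      finally show ?thesis .
    qed
    moreover have "bounded QR"
    proof (rule boundedI)
      fix p assume p: "p \<in> QR"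
      obtain \<phi> \<psi> \<theta> where pe: "p = (\<phi>, \<psi>, \<theta>)" by (cases p)
      have "norm \<theta> \<le> (\<Sum>i\<in>UNIV. \<bar>\<theta> $ i\<bar>)" by (rule norm_le_l1_cart)
      also have "\<dots> \<le> (\<Sum>i\<in>(UNIV::'n set). \<Theta>)" using p by (intro sum_mono) (auto simp: pe QR_def Q_def)
      finally have "norm \<theta> \<le> CARD('n) * \<Theta>" by simp
      moreover have "norm \<phi> \<le> R" "norm \<psi> \<le> R" using p by (auto simp: pe QR_def)
      moreover have "norm p \<le> norm \<phi> + (norm \<psi> + norm \<theta>)"
        unfolding pe using norm_Pair_le[of \<phi> "(\<psi>, \<theta>)"] norm_Pair_le[of \<psi> \<theta>] by linarith
      ultimately show "norm p \<le> R + (R + CARD('n) * \<Theta>)" by linarith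
    qed
    ultimately show ?thesis by (simp add: compact_eq_bounded_closed)
  qed
  have "\<exists>p\<in>QR. \<forall>q\<in>QR. g x p \<le> g x q" for x
    using continuous_attains_inf[OF compact _ continuous_on_subset[OF g_cont]] p1R by blast
  then obtain P where P: "\<And>x. P x \<in> QR" "\<And>x q. q \<in> QR \<Longrightarrow> g x (P x) \<le> g x q" by metis
  \<comment> \<open>The minimum is also taken over the sites of \<open>Y\<close>: cooperativity
    needs every component above the same multiple of the barrier.\<close>
  obtain x0 where x0: "x0 \<in> Y" "\<And>x. x \<in> Y \<Longrightarrow> g x0 (P x0) \<le> g x (P x)"
  proof -
    let ?S = "(\<lambda>x. g x (P x)) ` Y"
    have S: "finite ?S" "?S \<noteq> {}" using x1 by auto
    obtain x0 where "x0 \<in> Y" "Min ?S = g x0 (P x0)" using Min_in[OF S] by blast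
    then show ?thesis using that[of x0] Min_le[OF S(1)] by (metis imageI)
  qed
  define \<epsilon> where "\<epsilon> = - g x0 (P x0)"
  have ge: "- \<epsilon> \<le> g x p" if "p \<in> Q" "x \<in> Y" for x p
  proof (cases "p \<in> QR")
    case True
    then show ?thesis using x0(2)[OF that(2)] P(2)[OF True, of x] by (simp add: \<epsilon>_def)
  next
    case False
    have "g x p > - \<delta>" using far that(1) False by (cases p) auto
    moreover have "g x0 (P x0) \<le> - \<delta>" using x0(2)[OF x1] P(2)[OF p1R, of x1] by (simp add: \<delta>_def)
    ultimately show ?thesis by (simp add: \<epsilon>_def)
  qed
  have \<epsilon>: "\<epsilon> > 0" using x0(2)[OF x1] P(2)[OF p1R, of x1] \<delta> by (simp add: \<epsilon>_def \<delta>_def)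
  have touch: "0 \<le> second_diff \<phi> \<psi> \<theta> x + \<epsilon> * barrier K \<phi> \<psi> \<theta>" if "(\<phi>, \<psi>, \<theta>) \<in> Q" "x \<in> Y" for \<phi> \<psi> \<theta> x
    using ge[OF that] barrier_pos[of K \<phi> \<psi> \<theta>] by (simp add: g_def field_simps)
  obtain \<phi> \<psi> \<theta> where Px: "P x0 = (\<phi>, \<psi>, \<theta>)" by (cases "P x0")
  have inQ: "(\<phi>, \<psi>, \<theta>) \<in> Q" using P(1)[of x0] by (simp add: Px QR_def)
  then have \<phi>: "\<And>i. 0 \<le> \<phi> $ i" and \<theta>: "\<And>i. 0 \<le> \<theta> $ i \<and> \<theta> $ i \<le> \<Theta>"
    and off: "\<And>i. i \<notin> Y \<Longrightarrow> \<phi> $ i = 0 \<and> \<psi> $ i = 0 \<and> \<theta> $ i = 0" by (auto simp: Q_def)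
  have eq: "second_diff \<phi> \<psi> \<theta> x0 + \<epsilon> * barrier K \<phi> \<psi> \<theta> = 0"
    using barrier_pos[of K \<phi> \<psi> \<theta>] by (simp add: \<epsilon>_def g_def Px)
  then have Eneg: "second_diff \<phi> \<psi> \<theta> x0 < 0" using \<epsilon> barrier_pos[of K \<phi> \<psi> \<theta>] by (smt (verit) mult_pos_pos)
  have "{i. \<theta> $ i \<noteq> 0} = Y"
  proof (rule ccontr)
    assume "{i. \<theta> $ i \<noteq> 0} \<noteq> Y"
    then have "{i. \<theta> $ i \<noteq> 0} \<subset> Y" using off by auto
    from IH[OF \<theta> this \<phi>] Eneg show False by (simp add: not_le[symmetric])
  qed
  then have pos: "\<theta> $ i > 0" if "i \<in> Y" for i using \<theta>[of i] that by (auto simp: less_le)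
  obtain y where y: "\<phi> $ y > 0"
  proof (cases "\<phi> = 0")
    case True
    then have "second_diff \<phi> \<psi> \<theta> x0 = 0" using v_uminus[of \<psi> \<theta> x0] by (simp add: second_diff_def v_0)
    then show ?thesis using Eneg by simp
  next
    case False
    then obtain y where "\<phi> $ y \<noteq> 0" by (auto simp: vec_eq_iff)
    then show ?thesis using \<phi>[of y] that[of y] by (auto simp: less_le)
  qed
  have yY: "y \<in> Y" using off[of y] y by auto
  show False
  proof (rule no_negative_touch[where K = K and \<Theta> = \<Theta> and \<theta> = \<theta> and \<phi> = \<phi> and \<psi> = \<psi> and x = x0 and y = y, OF vb Tb Kv K(1) _ _ pos[OF x0(1)] pos[OF yY] y \<epsilon> eq])
    show "0 \<le> second_diff \<phi> \<psi> \<theta> y + \<epsilon> * barrier K \<phi> \<psi> \<theta>" by (rule touch[OF inQ yY])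
    show "0 \<le> second_diff (\<phi> + s *\<^sub>R axis y 1) \<psi> \<theta> x0 + \<epsilon> * barrier K (\<phi> + s *\<^sub>R axis y 1) \<psi> \<theta>" if "- \<phi> $ y \<le> s" for s
      using that \<phi> \<theta> off yY by (intro touch x0) (auto simp: Q_def axis_def)
    show "0 \<le> second_diff \<phi> (\<psi> + s *\<^sub>R axis y 1) \<theta> x0 + \<epsilon> * barrier K \<phi> (\<psi> + s *\<^sub>R axis y 1) \<theta>" for s
      using \<phi> \<theta> off yY by (intro touch x0) (auto simp: Q_def axis_def)
    show "0 \<le> second_diff \<phi> \<psi> (\<chi> i. if i = y then 1 / sqrt (1 / (\<theta> $ y)\<^sup>2 + t) else \<theta> $ i) x0
        + \<epsilon> * barrier K \<phi> \<psi> (\<chi> i. if i = y then 1 / sqrt (1 / (\<theta> $ y)\<^sup>2 + t) else \<theta> $ i)" if t: "0 \<le> t" for t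
    proof (intro touch x0)
      have "sqrt (1 / (\<theta> $ y)\<^sup>2) \<le> sqrt (1 / (\<theta> $ y)\<^sup>2 + t)" using t by (intro real_sqrt_le_mono) simp
      then have "1 / \<theta> $ y \<le> sqrt (1 / (\<theta> $ y)\<^sup>2 + t)" using pos[OF yY] by (simp add: real_sqrt_divide)
      moreover have inv: "0 < 1 / \<theta> $ y" using pos[OF yY] by simp
      ultimately have le: "1 / \<theta> $ y \<le> sqrt (1 / (\<theta> $ y)\<^sup>2 + t)" "0 < sqrt (1 / (\<theta> $ y)\<^sup>2 + t)" by linarith+
      have "1 / sqrt (1 / (\<theta> $ y)\<^sup>2 + t) \<le> 1 / (1 / \<theta> $ y)"
        by (rule divide_left_mono[OF le(1) _ mult_pos_pos[OF le(2) inv]]) simp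
      then have "1 / sqrt (1 / (\<theta> $ y)\<^sup>2 + t) \<le> \<Theta>" using \<theta>[of y] by simp
      moreover have "0 \<le> 1 / sqrt (1 / (\<theta> $ y)\<^sup>2 + t)" using t by simp
      ultimately show "(\<phi>, \<psi>, \<chi> i. if i = y then 1 / sqrt (1 / (\<theta> $ y)\<^sup>2 + t) else \<theta> $ i) \<in> Q"
        using \<phi> \<theta> off yY by (auto simp: Q_def)
    qed
  qed (use \<theta> in auto)
qed

section \<open>Frozen sites and the induction on active sites\<close>

lemma v_frozen:
  assumes "\<theta> $ x = 0"
  shows "v \<phi> \<theta> x = (\<Sum>j\<in>UNIV. A $ x $ j * mean \<phi> \<theta> j) + f x (\<phi> $ x)"
proof -
  have g: "exp_growth (\<lambda>z. \<Sum>j\<in>UNIV. A $ x $ j * (\<phi> + \<theta> * z) $ j)"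
    by (intro exp_growth_sum exp_growth_mult exp_growth_const exp_growth_site)
  have "v \<phi> \<theta> x = expect \<phi> \<theta> (\<lambda>z. (\<Sum>j\<in>UNIV. A $ x $ j * (\<phi> + \<theta> * z) $ j) + f x (\<phi> $ x))"
    unfolding v_def dS_def using assms by (simp add: matrix_vector_mult_def)
  also have "\<dots> = (\<Sum>j\<in>UNIV. A $ x $ j * mean \<phi> \<theta> j) + f x (\<phi> $ x)"
    unfolding expect_add[OF g exp_growth_const] expect_const mean_def
    by (subst expect_sum) (intro exp_growth_mult exp_growth_const exp_growth_site, simp only: expect_cmult)
  finally show ?thesis .
qed

theorem second_diff_nonneg:
  assumes "\<And>i. 0 \<le> \<theta> $ i \<and> \<theta> $ i \<le> \<Theta>" "\<And>i. 0 \<le> \<phi> $ i"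
  shows "0 \<le> second_diff \<phi> \<psi> \<theta> x"
  using assms
proof (induction "card {i. \<theta> $ i \<noteq> 0}" arbitrary: \<theta> \<phi> \<psi> x rule: less_induct)
  case less
  define Y where "Y = {i. \<theta> $ i \<noteq> 0}"
  \<comment> \<open>The translation from \<open>mean_frozen\<close>. It is linear, hence compatible
    with second differences; it keeps \<open>\<phi>\<close> nonnegative, and it sets all frozen
    spins to 0.\<close>
  define h where "h \<phi> = (\<chi> i. if \<theta> $ i = 0 then 0 else \<phi> $ i - (\<theta> $ i)\<^sup>2 * (A *v (\<chi> i. if \<theta> $ i = 0 then \<phi> $ i else 0)) $ i)" for \<phi>
  have mean_h: "mean \<phi> \<theta> y = mean (h \<phi>) \<theta> y" if "y \<in> Y" for \<phi> y
    unfolding h_def using that by (intro mean_frozen) (simp add: Y_def)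
  define r where "r \<phi> = (\<chi> i. if \<theta> $ i = 0 then \<phi> $ i else 0)" for \<phi> :: "real^'n"
  have r: "r (\<phi> + \<psi>) = r \<phi> + r \<psi>" "r (\<phi> - \<psi>) = r \<phi> - r \<psi>" by (auto simp: r_def vec_eq_iff)
  have h_r: "h \<phi> = (\<chi> i. if \<theta> $ i = 0 then 0 else \<phi> $ i - (\<theta> $ i)\<^sup>2 * (A *v r \<phi>) $ i)" for \<phi>
    unfolding h_def r_def ..
  have h_add: "h (\<phi> + \<psi>) = h \<phi> + h \<psi>" and h_diff: "h (\<phi> - \<psi>) = h \<phi> - h \<psi>"
    unfolding vec_eq_iff h_r r matrix_vector_right_distrib matrix_vector_mult_diff_distrib
      vec_lambda_beta vector_add_component vector_minus_component distrib_left right_diff_distrib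
    by simp_all
  have h_nonneg: "0 \<le> h \<phi> $ i" for i
  proof (cases "\<theta> $ i = 0")
    case False
    have "(A *v (\<chi> i. if \<theta> $ i = 0 then \<phi> $ i else 0)) $ i \<le> 0"
      unfolding matrix_vector_mult_def vec_lambda_beta
    proof (rule sum_nonpos)
      fix j
      show "A $ i $ j * (if \<theta> $ j = 0 then \<phi> $ j else 0) \<le> 0"
      proof (cases "\<theta> $ j = 0")
        case True
        then have "A $ i $ j \<le> 0" using False by (intro A_ferro) auto
        then show ?thesis using less.prems(2)[of j] True by (simp add: mult_nonpos_nonneg)
      qed simp
    qed
    then have "(\<theta> $ i)\<^sup>2 * (A *v (\<chi> i. if \<theta> $ i = 0 then \<phi> $ i else 0)) $ i \<le> 0"
      by (intro mult_nonneg_nonpos) auto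
    then show ?thesis using less.prems(2)[of i] by (simp add: h_def)
  qed (simp add: h_def)
  have active: "0 \<le> second_diff \<phi> \<psi> \<theta> y" if y: "y \<in> Y" for y
  proof -
    have "0 \<le> second_diff (h \<phi>) (h \<psi>) \<theta> y"
    proof (rule second_diff_nonneg_active[where Y = Y and \<Theta> = \<Theta>])
      show "0 \<le> second_diff \<phi> \<psi> \<theta>' x" if "\<And>i. 0 \<le> \<theta>' $ i \<and> \<theta>' $ i \<le> \<Theta>" "{i. \<theta>' $ i \<noteq> 0} \<subset> Y" "\<And>i. 0 \<le> \<phi> $ i" for \<theta>' \<phi> \<psi> x
        using that by (intro less.hyps) (auto simp: Y_def intro: psubset_card_mono)
    qed (use less.prems h_nonneg y in \<open>auto simp: h_def Y_def\<close>)
    moreover have "(\<theta> $ y)\<^sup>2 * second_diff \<phi> \<psi> \<theta> y = (\<theta> $ y)\<^sup>2 * second_diff (h \<phi>) (h \<psi>) \<theta> y"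
      unfolding mean_second_difference[symmetric] mean_h[OF y, of \<phi>]
        mean_h[OF y, of "\<phi> + \<psi>"] mean_h[OF y, of "\<phi> - \<psi>"] h_add h_diff ..
    moreover have "(\<theta> $ y)\<^sup>2 > 0" using y by (simp add: Y_def)
    ultimately show ?thesis by (simp add: zero_le_mult_iff)
  qed
  show ?case
  proof (cases "x \<in> Y")
    case False
    then have \<theta>x: "\<theta> $ x = 0" by (simp add: Y_def)
    \<comment> \<open>At a frozen site the active neighbours enter through
      \<open>- A $ x $ j \<ge> 0\<close> times nonnegative second differences. Without active sites
      only the \<open>f\<close> terms are left, which is the base of the induction.\<close>
    have "second_diff \<phi> \<psi> \<theta> x = (\<Sum>j\<in>UNIV. A $ x $ j * - (2 * mean \<phi> \<theta> j - mean (\<phi> + \<psi>) \<theta> j - mean (\<phi> - \<psi>) \<theta> j))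
        + (f x (\<phi> $ x + \<psi> $ x) + f x (\<phi> $ x - \<psi> $ x) - 2 * f x (\<phi> $ x))"
    proof -
      have "(\<Sum>j\<in>UNIV. A $ x $ j * - (2 * a j - b j - c j)) = (\<Sum>j\<in>UNIV. A $ x $ j * b j) + (\<Sum>j\<in>UNIV. A $ x $ j * c j) - 2 * (\<Sum>j\<in>UNIV. A $ x $ j * a j)" for a b c
        unfolding sum_distrib_left sum.distrib[symmetric] sum_subtractf[symmetric]
        by (intro sum.cong refl) (simp add: algebra_simps)
      then show ?thesis unfolding second_diff_def v_frozen[OF \<theta>x] by simp
    qed
    also have "\<dots> \<ge> 0"
    proof (intro add_nonneg_nonneg sum_nonneg)
      fix j
      show "0 \<le> A $ x $ j * - (2 * mean \<phi> \<theta> j - mean (\<phi> + \<psi>) \<theta> j - mean (\<phi> - \<psi>) \<theta> j)"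
        unfolding mean_second_difference
      proof (cases "j \<in> Y")
        case True
        then have "A $ x $ j \<le> 0" using False by (intro A_ferro) auto
        then show "0 \<le> A $ x $ j * - ((\<theta> $ j)\<^sup>2 * second_diff \<phi> \<psi> \<theta> j)"
          using active[OF True] by (intro mult_nonpos_nonpos) auto
      qed (simp add: Y_def)
      show "0 \<le> f x (\<phi> $ x + \<psi> $ x) + f x (\<phi> $ x - \<psi> $ x) - 2 * f x (\<phi> $ x)"
        using f_second_difference_nonneg[OF less.prems(2)[of x], of x "\<psi> $ x"] by simp
    qed
    finally show ?thesis .
  qed (rule active)
qed

end

section \<open>Truncation of the potential and passage to the limit\<close>

text \<open>Where the pieces meet, the left and the right difference quotients have the same
  limit.\<close>

lemma DERIV_two_pieces:
  fixes G H :: "real \<Rightarrow> real"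
  assumes G: "\<And>s. (G has_real_derivative g s) (at s)" and H: "\<And>s. (H has_real_derivative h s) (at s)"
    and eq: "G a = H a" "g a = h a"
  shows "((\<lambda>s. if s > a then H s else G s) has_real_derivative (if s > a then h s else g s)) (at s)"
proof -
  let ?F = "\<lambda>s. if s > a then H s else G s"
  consider "s > a" | "s < a" | "s = a" by linarith
  then show ?thesis
  proof cases
    case 1
    have "(?F has_real_derivative h s) (at s)"
      by (rule has_field_derivative_transform_within_open[OF H, where S = "{a<..}"]) (use 1 in auto)
    then show ?thesis using 1 by simp
  next
    case 2
    have "(?F has_real_derivative g s) (at s)"
      by (rule has_field_derivative_transform_within_open[OF G, where S = "{..<a}"]) (use 2 in auto)
    then show ?thesis using 2 by simp
  next
    case 3
    have "((\<lambda>t. (?F t - ?F a) / (t - a)) \<longlongrightarrow> g a) (at a)"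
    proof (rule filterlim_split_at)
      have "((\<lambda>t. (G t - G a) / (t - a)) \<longlongrightarrow> g a) (at_left a)"
        using G[of a] unfolding has_field_derivative_iff by (rule filterlim_mono) (auto simp: at_le)
      then show "((\<lambda>t. (?F t - ?F a) / (t - a)) \<longlongrightarrow> g a) (at_left a)"
        by (rule Lim_transform_eventually) (auto simp: eventually_at_filter)
      have "((\<lambda>t. (H t - H a) / (t - a)) \<longlongrightarrow> g a) (at_right a)"
        unfolding eq using H[of a] unfolding has_field_derivative_iff by (rule filterlim_mono) (auto simp: at_le)
      then show "((\<lambda>t. (?F t - ?F a) / (t - a)) \<longlongrightarrow> g a) (at_right a)"
        by (rule Lim_transform_eventually) (auto simp: eventually_at_filter eq)
    qed
    then show ?thesis using 3 by (simp add: has_field_derivative_iff)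
  qed
qed

lemma DERIV_two_pieces_left:
  fixes G H :: "real \<Rightarrow> real"
  assumes G: "\<And>s. (G has_real_derivative g s) (at s)" and H: "\<And>s. (H has_real_derivative h s) (at s)"
    and eq: "G a = H a" "g a = h a"
  shows "((\<lambda>s. if s < a then H s else G s) has_real_derivative (if s < a then h s else g s)) (at s)"
proof -
  have "(\<lambda>s. if s < a then H s else G s) = (\<lambda>s. if s > a then G s else H s)"
       "(if s < a then h s else g s) = (if s > a then g s else h s)"
    using eq by (auto simp: fun_eq_iff not_less antisym)
  then show ?thesis using DERIV_two_pieces[OF H G eq[symmetric]] by simp
qed

text \<open>The one-site conditions of \<open>spin_system\<close>, with the constants still
  belonging to a single site.\<close>

definition admissible_potential ::
    "(real \<Rightarrow> real) \<Rightarrow> (real \<Rightarrow> real) \<Rightarrow> (real \<Rightarrow> real) \<Rightarrow> real \<Rightarrow> real \<Rightarrow> real \<Rightarrow> bool" where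
  "admissible_potential W w w' L B C \<longleftrightarrow>
     (\<forall>s. (W has_real_derivative w s) (at s)) \<and> (\<forall>s. (w has_real_derivative w' s) (at s)) \<and>
     continuous_on UNIV w' \<and> (\<forall>s. \<bar>w' s\<bar> \<le> L) \<and> (\<forall>s. W (- s) = W s) \<and> (\<forall>s. - C \<le> W s) \<and>
     (\<forall>s t. t \<le> s \<longrightarrow> w t - B \<le> w s) \<and> convex_on {0..} w"

text \<open>Outside \<open>[- k, k]\<close> the potential is replaced by its second order Taylor polynomials at \<open>k\<close> and \<open>- k\<close>;
  the lower bound \<open>C\<close> does not depend on \<open>k\<close>.\<close>

lemma potential_truncation:
  fixes V :: "real \<Rightarrow> real"
  assumes C3: "C_diff 3 V" and even: "\<And>s. V (- s) = V s" and unbounded: "\<not> bdd_above (range V)"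
    and convex: "convex_on {0..} (deriv V)"
  shows "\<exists>R C. \<forall>k\<ge>R. \<exists>W w w' L B. admissible_potential W w w' L B C \<and> (\<forall>s. \<bar>s\<bar> \<le> k \<longrightarrow> W s = V s)"
proof -
  define f where "f = deriv V"
  define d where "d = deriv f"
  have diff: "(deriv ^^ i) V differentiable_on UNIV" if "i < 3" for i
    using C3 that by (simp add: C_diff_def)
  have dV: "(V has_real_derivative f s) (at s)" for s
    using diff[of 0] by (auto simp: f_def differentiable_on_def DERIV_deriv_iff_real_differentiable)
  have df: "(f has_real_derivative d s) (at s)" for s
    using diff[of 1] by (auto simp: d_def f_def differentiable_on_def DERIV_deriv_iff_real_differentiable)
  have d_cont: "continuous_on UNIV d"
    using diff[of 2] by (auto simp: d_def f_def numeral_2_eq_2 intro: differentiable_imp_continuous_on)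
  have V_cont: "continuous_on S V" for S using dV by (meson DERIV_continuous_on has_field_derivative_at_within)
  have f_cont: "continuous_on S f" for S using df by (meson DERIV_continuous_on has_field_derivative_at_within)
  have f_odd: "f (- s) = - f s" for s
  proof -
    have "((\<lambda>s. V (- s)) has_real_derivative f (- s) * (- 1)) (at s)"
      by (rule DERIV_chain2[OF dV]) (auto intro!: derivative_eq_intros)
    then have "(V has_real_derivative - f (- s)) (at s)" by (simp add: even)
    from DERIV_unique[OF this dV] show ?thesis by simp
  qed
  have f0: "f 0 = 0" using f_odd[of 0] by simp
  have d_even: "d (- s) = d s" for s
  proof -
    have "((\<lambda>s. f (- s)) has_real_derivative d (- s) * (- 1)) (at s)"
      by (rule DERIV_chain2[OF df]) (auto intro!: derivative_eq_intros)
    moreover have "((\<lambda>s. - f s) has_real_derivative - d s) (at s)" by (intro DERIV_minus df)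
    ultimately show ?thesis using DERIV_unique by (fastforce simp: f_odd)
  qed
  have tangent: "f t - f s \<ge> d s * (t - s)" if "s > 0" "t \<ge> 0" for s t
    using convex_on_imp_above_tangent[OF convex, of s t "d s"] that df[of s]
    by (auto simp: f_def[symmetric] intro: has_field_derivative_at_within)
  have d_mono_pos: "d s \<le> d t" if "0 < s" "s \<le> t" for s t
  proof (cases "s = t")
    case False
    have "d s * (t - s) \<le> f t - f s" "d t * (s - t) \<le> f s - f t"
      using that by (auto intro!: tangent)
    then have "d s * (t - s) \<le> d t * (t - s)" by (simp add: algebra_simps)
    then show ?thesis using that False by simp
  qed simp
  \<comment> \<open>Tangents are available at positive points; the value at 0 is reached by
    continuity of \<open>d\<close> from the right.\<close>
  have d_mono: "d s \<le> d t" if "0 \<le> s" "s \<le> t" for s t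
  proof (cases "s = 0 \<and> t > 0")
    case True
    have "isCont d 0" using d_cont by (simp add: continuous_on_eq_continuous_at)
    then have "(d \<longlongrightarrow> d 0) (at_right 0)" by (simp add: isCont_def filterlim_at_split)
    moreover have "\<forall>\<^sub>F u in at_right 0. d u \<le> d t"
      unfolding eventually_at by (intro exI[of _ t]) (use True d_mono_pos in \<open>auto simp: dist_real_def\<close>)
    ultimately show ?thesis using True by (auto intro!: tendsto_upperbound)
  next
    case False
    then show ?thesis using that d_mono_pos[of s t] by (cases "s = 0") auto
  qed
  \<comment> \<open>If \<open>f\<close> were nonpositive on the positive half line, the even
    function \<open>V\<close> would be bounded above by \<open>V 0\<close>.\<close>
  have "\<exists>R>0. f R > 0"
  proof (rule ccontr)
    assume "\<not> (\<exists>R>0. f R > 0)"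
    then have neg: "f s \<le> 0" if "s > 0" for s using that by (meson not_le)
    have "V s \<le> V 0" if "s \<ge> 0" for s
      using that dV neg f0 by (intro DERIV_nonpos_imp_nonincreasing[of 0 s V]) (auto simp: le_less)
    then have "V s \<le> V 0" for s using even[of s] by (cases "s \<ge> 0") (auto simp: not_le, metis neg_0_le_iff_le less_imp_le)
    then show False using unbounded by (auto simp: bdd_above_def)
  qed
  then obtain R where R: "R > 0" "f R > 0" by blast
  \<comment> \<open>On \<open>[-R, R]\<close> the truncated potential equals \<open>V\<close>, and
    beyond \<open>R\<close> it increases; so the minimum over this interval bounds it below for
    every \<open>k\<close>.\<close>
  obtain C where C: "\<And>s. \<bar>s\<bar> \<le> R \<Longrightarrow> - C \<le> V s"
  proof -
    have "compact (V ` {-R..R})" by (intro compact_continuous_image V_cont) auto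
    then obtain C where C: "\<And>s. s \<in> {-R..R} \<Longrightarrow> norm (V s) \<le> C" by (meson compact_imp_bounded bounded_iff imageI)
    show ?thesis
    proof (rule that[of C])
      show "- C \<le> V s" if "\<bar>s\<bar> \<le> R" for s using C[of s] that by (auto simp: abs_le_iff)
    qed
  qed
  have "\<exists>W w w' L B. admissible_potential W w w' L B C \<and> (\<forall>s. \<bar>s\<bar> \<le> k \<longrightarrow> W s = V s)"
    if k: "R \<le> k" for k
  proof -
    have k0: "k > 0" using k R by simp
    define Wr where "Wr s = V k + f k * (s - k) + 1/2 * d k * (s - k)\<^sup>2" for s
    define wr where "wr s = f k + d k * (s - k)" for s
    define Wl where "Wl s = V (- k) + f (- k) * (s + k) + 1/2 * d (- k) * (s + k)\<^sup>2" for s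
    define wl where "wl s = f (- k) + d (- k) * (s + k)" for s
    define W where "W s = (if s > k then Wr s else if s < - k then Wl s else V s)" for s
    define w where "w s = (if s > k then wr s else if s < - k then wl s else f s)" for s
    define w' where "w' s = (if s > k then d k else if s < - k then d (- k) else d s)" for s
    have W: "(W has_real_derivative w s) (at s)" for s
      unfolding W_def w_def
    proof (rule DERIV_two_pieces)
      show "((\<lambda>s. if s < - k then Wl s else V s) has_real_derivative (if s < - k then wl s else f s)) (at s)" for s
        by (rule DERIV_two_pieces_left) (auto simp: Wl_def wl_def intro!: derivative_eq_intros dV)
      show "(Wr has_real_derivative wr s) (at s)" for s
        unfolding Wr_def wr_def by (auto intro!: derivative_eq_intros)
    qed (use k0 in \<open>auto simp: Wr_def wr_def\<close>)
    have w: "(w has_real_derivative w' s) (at s)" for s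
      unfolding w_def w'_def
    proof (rule DERIV_two_pieces)
      show "((\<lambda>s. if s < - k then wl s else f s) has_real_derivative (if s < - k then d (- k) else d s)) (at s)" for s
        by (rule DERIV_two_pieces_left) (auto simp: wl_def intro!: derivative_eq_intros df)
      show "(wr has_real_derivative d k) (at s)" for s
        unfolding wr_def by (auto intro!: derivative_eq_intros)
    qed (use k0 in \<open>auto simp: wr_def\<close>)
    have w'_clamp: "w' s = d (max (- k) (min k s))" for s using k0 by (auto simp: w'_def max_def min_def)
    have w'_cont: "continuous_on UNIV w'"
      unfolding w'_clamp[abs_def] by (intro continuous_on_compose2[OF d_cont] continuous_intros) auto
    have w'_abs: "w' s = d (min k \<bar>s\<bar>)" for s
    proof (cases "s \<ge> 0")
      case False
      then have "max (- k) (min k s) = - min k \<bar>s\<bar>" using k0 by (simp add: max_def min_def)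
      then show ?thesis by (simp add: w'_clamp d_even)
    qed (use k0 in \<open>simp add: w'_clamp max_def\<close>)
    have w'_mono: "w' s \<le> w' t" if "\<bar>s\<bar> \<le> \<bar>t\<bar>" for s t
      unfolding w'_abs using that k0 by (intro d_mono) auto
    obtain L where L: "\<And>s. \<bar>w' s\<bar> \<le> L"
    proof -
      have "\<bar>w' s\<bar> \<le> max \<bar>d 0\<bar> \<bar>d k\<bar>" for s
      proof -
        have "d 0 \<le> w' s" "w' s \<le> d k" unfolding w'_abs using k0 by (auto intro!: d_mono)
        then show ?thesis by (auto simp: max_def abs_if)
      qed
      then show ?thesis by (rule that)
    qed
    have W_even: "W (- s) = W s" for s
      using k0 by (auto simp: W_def Wr_def Wl_def even f_odd d_even power2_eq_square algebra_simps)
    have w_R: "w s = f s" "W s = V s" if "\<bar>s\<bar> \<le> k" for s using that by (auto simp: w_def W_def)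
    \<comment> \<open>The tangent at \<open>R\<close> lies below \<open>f\<close> at 0, where
      \<open>f\<close> vanishes, while \<open>f R > 0\<close>; so its slope is positive.\<close>
    have dR: "d R > 0"
    proof -
      have "f 0 - f R \<ge> d R * (0 - R)" using R by (intro tangent) auto
      then have "0 < d R * R" using R f0 by simp
      then show ?thesis using R by (simp add: zero_less_mult_iff)
    qed
    have w'_pos: "0 \<le> w' s" if "R \<le> \<bar>s\<bar>" for s
      using w'_mono[of R s] that R k dR w'_abs[of R] by simp
    have mono_right: "w t \<le> w s" if "R \<le> t" "t \<le> s" for s t
      using that w w'_pos R by (intro DERIV_nonneg_imp_nondecreasing[of t s w]) fastforce+
    have mono_left: "w t \<le> w s" if "t \<le> s" "s \<le> - R" for s t
      using that w w'_pos R by (intro DERIV_nonneg_imp_nondecreasing[of t s w]) fastforce+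
    have w_pos: "0 \<le> w s" if "R \<le> s" for s
      using mono_right[of R s] that w_R(1)[of R] R k by simp
    have W_lower: "- C \<le> W s" for s
    proof -
      have *: "- C \<le> W s" if "s \<ge> 0" for s
      proof (cases "s \<le> R")
        case True
        then show ?thesis using C[of s] w_R(2)[of s] k that by simp
      next
        case False
        have "W R \<le> W s" using False W w_pos by (intro DERIV_nonneg_imp_nondecreasing[of R s W]) auto
        then show ?thesis using C[of R] w_R(2)[of R] k R by simp
      qed
      show ?thesis using *[of s] *[of "- s"] W_even[of s] by (cases "s \<ge> 0") auto
    qed
    \<comment> \<open>Decreases of \<open>w\<close> can only happen inside \<open>[-R, R]\<close>,
      where its oscillation is at most \<open>2 * M\<close>; this becomes the constant
      \<open>B\<close>.\<close>
    obtain M where M: "\<And>s. \<bar>s\<bar> \<le> R \<Longrightarrow> \<bar>w s\<bar> \<le> M"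
    proof -
      have "compact (f ` {-R..R})" by (intro compact_continuous_image f_cont) auto
      then obtain M where M: "\<And>s. s \<in> {-R..R} \<Longrightarrow> norm (f s) \<le> M" by (meson compact_imp_bounded bounded_iff imageI)
      show ?thesis
      proof (rule that[of M])
        show "\<bar>w s\<bar> \<le> M" if "\<bar>s\<bar> \<le> R" for s using M[of s] that w_R(1)[of s] k by (auto simp: abs_le_iff)
      qed
    qed
    have w_lower: "w t - 2 * M \<le> w s" if ts: "t \<le> s" for s t
    proof -
      have M0: "M \<ge> 0" using order_trans[OF abs_ge_zero M[of 0]] R by simp
      consider "s \<le> - R" | "t \<ge> R" | "s > - R" "t < R" by linarith
      then show ?thesis
      proof cases
        case 3
        have "- M \<le> w s"
        proof (cases "s \<le> R")
          case True
          then show ?thesis using M[of s] 3 by (simp add: abs_le_iff)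
        next
          case False
          then show ?thesis using w_pos[of s] M0 by simp
        qed
        moreover have "w t \<le> M"
        proof (cases "t \<ge> - R")
          case True
          then show ?thesis using M[of t] 3 by (simp add: abs_le_iff)
        next
          case False
          then show ?thesis using mono_left[of t "- R"] M[of "- R"] R by (simp add: abs_le_iff)
        qed
        ultimately show ?thesis by simp
      qed (use mono_left[of t s] mono_right[of t s] ts M0 in auto)
    qed
    have "convex_on {0..} w"
      by (rule convex_on_realI[of _ _ w']) (use w w'_mono in auto)
    then have "admissible_potential W w w' L (2 * M) C"
      unfolding admissible_potential_def using W w w'_cont L W_even W_lower w_lower by blast
    then show ?thesis using w_R(2) by blast
  qed
  then show ?thesis by blast
qed

section \<open>Gibbs expectations, their Gaussian form and their limits\<close>

lemma integrable_exp_growth_gaussian: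
  fixes F :: "real^'n \<Rightarrow> real"
  assumes F: "exp_growth F" and c: "c > 0"
  shows "integrable lborel (\<lambda>z. F z * exp (- c * (norm z)\<^sup>2))"
proof -
  obtain D b where D: "continuous_on UNIV F" "D \<ge> 0" "b \<ge> 0" "\<And>z. \<bar>F z\<bar> \<le> D * exp (b * norm z)"
    using exp_growthE[OF F] by blast
  have [measurable]: "F \<in> borel_measurable borel" using F by (rule exp_growth_measurable)
  have bound: "\<bar>F z * exp (- c * (norm z)\<^sup>2)\<bar> \<le> D * exp (b\<^sup>2 / (2 * c)) * exp (- (c/2) * (norm z)\<^sup>2)" for z
  proof -
    have "0 \<le> (c * norm z - b)\<^sup>2 / (2 * c)" using c by simp
    also have "\<dots> = c / 2 * (norm z)\<^sup>2 - b * norm z + b\<^sup>2 / (2 * c)"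
      using c by (simp add: power2_eq_square field_simps)
    finally have "b * norm z + (- c * (norm z)\<^sup>2) \<le> b\<^sup>2 / (2 * c) + (- (c/2) * (norm z)\<^sup>2)" by simp
    then have le: "exp (b * norm z) * exp (- c * (norm z)\<^sup>2) \<le> exp (b\<^sup>2 / (2 * c)) * exp (- (c/2) * (norm z)\<^sup>2)"
      by (simp only: exp_add[symmetric] exp_le_cancel_iff)
    have "\<bar>F z * exp (- c * (norm z)\<^sup>2)\<bar> = \<bar>F z\<bar> * exp (- c * (norm z)\<^sup>2)" by (simp add: abs_mult)
    also have "\<dots> \<le> D * exp (b * norm z) * exp (- c * (norm z)\<^sup>2)" using D(4)[of z] by (rule mult_right_mono) simp
    also have "\<dots> \<le> D * (exp (b\<^sup>2 / (2 * c)) * exp (- (c/2) * (norm z)\<^sup>2))"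
      unfolding mult.assoc using le D(2) by (rule mult_left_mono)
    finally show ?thesis by (simp add: mult.assoc)
  qed
  show ?thesis
  proof (rule Bochner_Integration.integrable_bound)
    show "integrable lborel (\<lambda>z::real^'n. D * exp (b\<^sup>2 / (2 * c)) * exp (- (c/2) * (norm z)\<^sup>2))"
      using c by (intro integrable_mult_right integrable_exp_minus_norm_square) simp
    show "AE z in lborel. norm (F z * exp (- c * (norm z)\<^sup>2)) \<le> norm (D * exp (b\<^sup>2 / (2 * c)) * exp (- (c/2) * (norm z)\<^sup>2))"
      using bound D(2) by (intro AE_I2) (simp add: abs_mult)
  qed measurable
qed

lemma gibbs_weight_continuous:
  fixes V :: "'n::finite \<Rightarrow> real \<Rightarrow> real"
  assumes "\<And>x. continuous_on UNIV (V x)"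
  shows "continuous_on UNIV (gibbs_weight u A V)"
  unfolding gibbs_weight_def by (intro continuous_intros continuous_on_compose2[OF assms]) auto

lemma gibbs_expectation_eq:
  fixes V :: "'n::finite \<Rightarrow> real \<Rightarrow> real"
  assumes V: "\<And>x. continuous_on UNIV (V x)"
  shows "gibbs_expectation u A V (\<lambda>\<sigma>. \<sigma> $ x) =
    (LINT \<sigma>|lborel. \<sigma> $ x * gibbs_weight u A V \<sigma>) / (LINT \<sigma>|lborel. gibbs_weight u A V \<sigma>)"
proof -
  have [measurable]: "gibbs_weight u A V \<in> borel_measurable borel"
    by (intro borel_measurable_continuous_onI gibbs_weight_continuous V)
  have [measurable]: "(\<lambda>\<sigma>::real^'n. \<sigma> $ x) \<in> borel_measurable borel"
    by (intro borel_measurable_continuous_onI continuous_intros)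
  let ?Z = "LINT \<sigma>|lborel. gibbs_weight u A V \<sigma>"
  have nonneg: "0 \<le> gibbs_weight u A V \<sigma>" for \<sigma> by (simp add: gibbs_weight_def)
  then have "?Z \<ge> 0" by (rule Bochner_Integration.integral_nonneg)
  then have "gibbs_expectation u A V (\<lambda>\<sigma>. \<sigma> $ x) = (LINT \<sigma>|lborel. (gibbs_weight u A V \<sigma> / ?Z) * \<sigma> $ x)"
    unfolding gibbs_expectation_def gibbs_measure_def
    by (subst integral_density) (auto intro!: divide_nonneg_nonneg nonneg)
  also have "\<dots> = (LINT \<sigma>|lborel. (\<sigma> $ x * gibbs_weight u A V \<sigma>) / ?Z)" by (simp add: mult.commute)
  finally show ?thesis by simp
qed

lemma (in spin_system) gibbs_inequality:
  assumes c: "c > 0" and h: "\<And>y. 0 \<le> h $ y"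
  shows "gibbs_expectation (g + h) (A + mat c) V (\<lambda>\<sigma>. \<sigma> $ x) - gibbs_expectation (g - h) (A + mat c) V (\<lambda>\<sigma>. \<sigma> $ x)
       \<le> gibbs_expectation h (A + mat c) V (\<lambda>\<sigma>. \<sigma> $ x) - gibbs_expectation (- h) (A + mat c) V (\<lambda>\<sigma>. \<sigma> $ x)"
proof -
  define \<theta> :: "real^'n" where "\<theta> = (\<chi> i. 1 / sqrt c)"
  have \<theta>: "\<theta> $ i \<noteq> 0" "(\<theta> $ i)\<^sup>2 = 1 / c" "\<theta> $ i = 1 / sqrt c" for i using c by (auto simp: \<theta>_def power_divide)
  have mean: "gibbs_expectation u (A + mat c) V (\<lambda>\<sigma>. \<sigma> $ x) = mean ((1 / c) *\<^sub>R u) \<theta> x" for u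
  proof -
    let ?\<phi> = "(1 / c) *\<^sub>R u"
    let ?w = "gibbs_weight u (A + mat c) V"
    \<comment> \<open>Completing the square in the prior of mean \<open>u / c\<close> and precision
      \<open>c\<close>; the prefactor depends on \<open>u\<close> alone and cancels in the
      expectation.\<close>
    have weight: "?w (?\<phi> + \<theta> * z) = exp ((norm u)\<^sup>2 / (2 * c)) * (bw ?\<phi> \<theta> z * gauss z)" for z
    proof -
      let ?s = "?\<phi> + \<theta> * z"
      have m: "(A + mat c) *v ?s = A *v ?s + c *\<^sub>R ?s"
        by (simp add: vec_eq_iff matrix_vector_mult_def mat_def sum.distrib distrib_right if_distrib[of "\<lambda>y. y * _"] cong: if_cong)
      have "\<theta> * z = (1 / sqrt c) *\<^sub>R z" by (simp add: vec_eq_iff \<theta>(3))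
      then have "z = sqrt c *\<^sub>R (?s - ?\<phi>)" using c by simp
      then have "(norm z)\<^sup>2 = c * (norm (?s - ?\<phi>))\<^sup>2" using c by (metis norm_scaleR abs_of_nonneg power_mult_distrib real_sqrt_ge_zero real_sqrt_pow2 less_imp_le)
      also have "\<dots> = c * (?s \<bullet> ?s) - 2 * (?s \<bullet> u) + (norm u)\<^sup>2 / c"
      proof -
        have "c * (norm (s - ?\<phi>))\<^sup>2 = c * (s \<bullet> s) - 2 * (s \<bullet> u) + (norm u)\<^sup>2 / c" for s
          using c unfolding power2_norm_eq_inner by (simp add: inner_diff_left inner_diff_right inner_commute field_simps)
        then show ?thesis .
      qed
      finally have nz: "(norm z)\<^sup>2 = c * (?s \<bullet> ?s) - 2 * (?s \<bullet> u) + (norm u)\<^sup>2 / c" .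
      show ?thesis
        unfolding gibbs_weight_def bw_def gauss_def S_def m nz exp_add[symmetric]
        using c by (simp add: inner_add_right field_simps)
    qed
    have gint: "(LINT \<sigma>|lborel. F \<sigma> * ?w \<sigma>) = ((\<Prod>i\<in>UNIV. \<bar>\<theta> $ i\<bar>) * exp ((norm u)\<^sup>2 / (2 * c))) * gint ?\<phi> \<theta> (\<lambda>z. F (?\<phi> + \<theta> * z))" if F: "continuous_on UNIV F" for F
    proof -
      have "(\<lambda>\<sigma>. F \<sigma> * ?w \<sigma>) \<in> borel_measurable borel"
        by (intro borel_measurable_continuous_onI continuous_intros F gibbs_weight_continuous V_cont)
      then have "(LINT \<sigma>|lborel. F \<sigma> * ?w \<sigma>) = (\<Prod>i\<in>UNIV. \<bar>\<theta> $ i\<bar>) * (LINT z|lborel. F (?\<phi> + \<theta> * z) * ?w (?\<phi> + \<theta> * z))"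
        by (intro lborel_integral_affine_vec \<theta>)
      also have "(\<lambda>z. F (?\<phi> + \<theta> * z) * ?w (?\<phi> + \<theta> * z)) = (\<lambda>z. exp ((norm u)\<^sup>2 / (2 * c)) * (F (?\<phi> + \<theta> * z) * bw ?\<phi> \<theta> z * gauss z))"
        unfolding weight by (simp add: mult_ac)
      finally show ?thesis by (simp add: gint_def)
    qed
    have pos: "(\<Prod>i\<in>UNIV. \<bar>\<theta> $ i\<bar>) > 0" using \<theta>(1) by (intro prod_pos) auto
    have "(LINT \<sigma>|lborel. ?w \<sigma>) = ((\<Prod>i\<in>UNIV. \<bar>\<theta> $ i\<bar>) * exp ((norm u)\<^sup>2 / (2 * c))) * gint ?\<phi> \<theta> (\<lambda>_. 1)"
      using gint[of "\<lambda>_. 1"] by simp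
    moreover have "(LINT \<sigma>|lborel. \<sigma> $ x * ?w \<sigma>) = ((\<Prod>i\<in>UNIV. \<bar>\<theta> $ i\<bar>) * exp ((norm u)\<^sup>2 / (2 * c))) * gint ?\<phi> \<theta> (\<lambda>z. (?\<phi> + \<theta> * z) $ x)"
      by (rule gint) (intro continuous_intros)
    ultimately show ?thesis
      unfolding gibbs_expectation_eq[OF V_cont] mean_def expect_def using pos \<theta>(1) by simp
  qed
  have mean_odd: "mean (- \<phi>) \<theta> x = - mean \<phi> \<theta> x" for \<phi>
    by (simp add: mean_eq v_uminus)
  have "0 \<le> second_diff ((1 / c) *\<^sub>R h) ((1 / c) *\<^sub>R g) \<theta> x"
    by (rule second_diff_nonneg[of \<theta> "1 / sqrt c"]) (use c h \<theta>(3) in auto)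
  then have "0 \<le> (\<theta> $ x)\<^sup>2 * second_diff ((1 / c) *\<^sub>R h) ((1 / c) *\<^sub>R g) \<theta> x" by simp
  then have "0 \<le> 2 * mean ((1 / c) *\<^sub>R h) \<theta> x - mean ((1 / c) *\<^sub>R (h + g)) \<theta> x - mean ((1 / c) *\<^sub>R (h - g)) \<theta> x"
    unfolding mean_second_difference[symmetric] by (simp add: scaleR_add_right scaleR_diff_right)
  moreover have "mean ((1 / c) *\<^sub>R (g - h)) \<theta> x = - mean ((1 / c) *\<^sub>R (h - g)) \<theta> x"
    using mean_odd[of "(1 / c) *\<^sub>R (h - g)"] by (simp add: scaleR_diff_right)
  moreover have "mean ((1 / c) *\<^sub>R (- h)) \<theta> x = - mean ((1 / c) *\<^sub>R h) \<theta> x"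
    using mean_odd[of "(1 / c) *\<^sub>R h"] by simp
  ultimately show ?thesis unfolding mean by (simp add: add.commute)
qed

text \<open>\<open>c\<close> is the minimum of the quadratic form on the unit sphere, that is, the
  smallest eigenvalue; homogeneity extends the bound to all vectors.\<close>

lemma pos_definite_split:
  fixes A :: "real^'n^'n"
  assumes "pos_definite A"
  obtains c where "c > 0" "\<And>v. c * (norm v)\<^sup>2 \<le> v \<bullet> (A *v v)"
proof -
  have "\<exists>x\<in>sphere 0 1. \<forall>y\<in>sphere (0::real^'n) 1. x \<bullet> (A *v x) \<le> y \<bullet> (A *v y)"
    by (rule continuous_attains_inf) (auto intro!: continuous_intros)
  then obtain x where x: "norm x = 1" "\<And>y. norm y = 1 \<Longrightarrow> x \<bullet> (A *v x) \<le> y \<bullet> (A *v y)" by auto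
  define c where "c = x \<bullet> (A *v x)"
  have "x \<noteq> 0" using x(1) by auto
  then have c: "c > 0" using assms by (simp add: c_def pos_definite_def)
  have "c * (norm v)\<^sup>2 \<le> v \<bullet> (A *v v)" for v
  proof (cases "v = 0")
    case False
    let ?y = "(1 / norm v) *\<^sub>R v"
    have "c \<le> ?y \<bullet> (A *v ?y)" unfolding c_def by (rule x) (use False in simp)
    also have "\<dots> = (v \<bullet> (A *v v)) / (norm v)\<^sup>2"
      by (simp add: matrix_vector_mult_scaleR power2_eq_square)
    finally show ?thesis using False by (simp add: field_simps)
  qed simp
  with c show ?thesis by (rule that)
qed

text \<open>At each fixed \<open>\<sigma>\<close> the weights agree with the limit weight as soon as
  \<open>n\<close> exceeds \<open>norm \<sigma>\<close>. The common lower bound \<open>- D\<close>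
  and the quadratic form give a Gaussian majorant. The limit of the denominators is positive, so the
  quotients converge.\<close>

lemma gibbs_expectation_limit:
  fixes A :: "real^'n^'n" and V :: "'n \<Rightarrow> real \<Rightarrow> real" and W :: "nat \<Rightarrow> 'n \<Rightarrow> real \<Rightarrow> real"
  assumes c: "c > 0" "\<And>v. c * (norm v)\<^sup>2 \<le> v \<bullet> (A *v v)"
    and V: "\<And>x. continuous_on UNIV (V x)" and W: "\<And>n x. continuous_on UNIV (W n x)"
    and lower: "\<And>n x s. - D \<le> W n x s"
    and conv: "\<And>n x s. \<bar>s\<bar> \<le> real n \<Longrightarrow> W n x s = V x s"
  shows "(\<lambda>n. gibbs_expectation u A (W n) (\<lambda>\<sigma>. \<sigma> $ x)) \<longlonglongrightarrow> gibbs_expectation u A V (\<lambda>\<sigma>. \<sigma> $ x)"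
proof -
  define N where "N = real CARD('n) * D"
  have lowerV: "- D \<le> V x s" for x s
  proof -
    have "\<bar>s\<bar> \<le> real (nat \<lceil>\<bar>s\<bar>\<rceil>)" by linarith
    from conv[OF this, of x] lower[of "nat \<lceil>\<bar>s\<bar>\<rceil>" x s] show ?thesis by simp
  qed
  have weight_le: "gibbs_weight u A U \<sigma> \<le> exp N * exp (\<sigma> \<bullet> u) * exp (- (c/2) * (norm \<sigma>)\<^sup>2)"
    if "\<And>x s. - D \<le> U x s" for U :: "'n \<Rightarrow> real \<Rightarrow> real" and \<sigma>
  proof -
    have "(\<Sum>x\<in>(UNIV::'n set). - D) \<le> (\<Sum>x\<in>UNIV. U x (\<sigma> $ x))" by (intro sum_mono that)
    then have "- (1/2) * (\<sigma> \<bullet> (A *v \<sigma>)) + \<sigma> \<bullet> u - (\<Sum>x\<in>UNIV. U x (\<sigma> $ x)) \<le> N + \<sigma> \<bullet> u + (- (c/2) * (norm \<sigma>)\<^sup>2)"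
      using c(2)[of \<sigma>] by (simp add: N_def)
    then show ?thesis unfolding gibbs_weight_def exp_add[symmetric] by simp
  qed
  have gr: "exp_growth (\<lambda>\<sigma>::real^'n. exp (\<sigma> \<bullet> u))"
  proof (rule exp_growthI[of _ 1 "norm u"])
    show "\<bar>exp (\<sigma> \<bullet> u)\<bar> \<le> 1 * exp (norm u * norm \<sigma>)" for \<sigma> :: "real^'n"
      using norm_cauchy_schwarz[of \<sigma> u] by (simp add: mult.commute)
  qed (intro continuous_intros)
  have dom: "integrable lborel (\<lambda>\<sigma>. \<bar>F \<sigma>\<bar> * (exp N * exp (\<sigma> \<bullet> u) * exp (- (c/2) * (norm \<sigma>)\<^sup>2)))" if F: "exp_growth F" for F
  proof -
    have "integrable lborel (\<lambda>\<sigma>. (\<bar>F \<sigma>\<bar> * (exp N * exp (\<sigma> \<bullet> u))) * exp (- (c/2) * (norm \<sigma>)\<^sup>2))"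
      using c(1) by (intro integrable_exp_growth_gaussian exp_growth_mult exp_growth_abs exp_growth_const F gr) simp
    then show ?thesis by (simp add: mult.assoc)
  qed
  have meas: "(\<lambda>\<sigma>. F \<sigma> * gibbs_weight u A U \<sigma>) \<in> borel_measurable lborel"
    if "exp_growth F" "\<And>x. continuous_on UNIV (U x)" for F and U :: "'n \<Rightarrow> real \<Rightarrow> real"
    using borel_measurable_continuous_onI[OF continuous_on_mult[OF exp_growth_continuous[OF that(1)] gibbs_weight_continuous[OF that(2)]], of u A]
    by simp
  have lim: "(\<lambda>n. LINT \<sigma>|lborel. F \<sigma> * gibbs_weight u A (W n) \<sigma>) \<longlonglongrightarrow> (LINT \<sigma>|lborel. F \<sigma> * gibbs_weight u A V \<sigma>)"
    if F: "exp_growth F" for F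
  proof (rule integral_dominated_convergence[OF _ _ dom[OF F]])
    show "AE \<sigma> in lborel. (\<lambda>n. F \<sigma> * gibbs_weight u A (W n) \<sigma>) \<longlonglongrightarrow> F \<sigma> * gibbs_weight u A V \<sigma>"
    proof (rule AE_I2)
      fix \<sigma> :: "real^'n"
      have "F \<sigma> * gibbs_weight u A (W n) \<sigma> = F \<sigma> * gibbs_weight u A V \<sigma>" if n: "n \<ge> nat \<lceil>norm \<sigma>\<rceil>" for n
      proof -
        have "\<bar>\<sigma> $ x\<bar> \<le> real n" for x
          using component_le_norm_cart[of \<sigma> x] n by linarith
        then show ?thesis by (simp add: gibbs_weight_def conv)
      qed
      then show "(\<lambda>n. F \<sigma> * gibbs_weight u A (W n) \<sigma>) \<longlonglongrightarrow> F \<sigma> * gibbs_weight u A V \<sigma>"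
        by (intro tendsto_eventually eventually_sequentiallyI[of "nat \<lceil>norm \<sigma>\<rceil>"])
    qed
    show "AE \<sigma> in lborel. norm (F \<sigma> * gibbs_weight u A (W n) \<sigma>) \<le> \<bar>F \<sigma>\<bar> * (exp N * exp (\<sigma> \<bullet> u) * exp (- (c/2) * (norm \<sigma>)\<^sup>2))" for n
    proof (rule AE_I2)
      fix \<sigma> :: "real^'n"
      have "0 \<le> gibbs_weight u A (W n) \<sigma>" by (simp add: gibbs_weight_def)
      then show "norm (F \<sigma> * gibbs_weight u A (W n) \<sigma>) \<le> \<bar>F \<sigma>\<bar> * (exp N * exp (\<sigma> \<bullet> u) * exp (- (c/2) * (norm \<sigma>)\<^sup>2))"
        using weight_le[of "W n" \<sigma>, OF lower] by (simp add: abs_mult mult_left_mono)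
    qed
  qed (intro meas F V W)+
  have int1: "integrable lborel (\<lambda>\<sigma>. 1 * gibbs_weight u A V \<sigma>)"
  proof (rule Bochner_Integration.integrable_bound[OF dom[OF exp_growth_const[of 1]]])
    show "AE \<sigma> in lborel. norm (1 * gibbs_weight u A V \<sigma>) \<le> norm (\<bar>1\<bar> * (exp N * exp (\<sigma> \<bullet> u) * exp (- (c/2) * (norm \<sigma>)\<^sup>2)))"
    proof (rule AE_I2)
      fix \<sigma> :: "real^'n"
      have "0 \<le> gibbs_weight u A V \<sigma>" by (simp add: gibbs_weight_def)
      then show "norm (1 * gibbs_weight u A V \<sigma>) \<le> norm (\<bar>1\<bar> * (exp N * exp (\<sigma> \<bullet> u) * exp (- (c/2) * (norm \<sigma>)\<^sup>2)))"
        using weight_le[of V \<sigma>, OF lowerV] by simp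
    qed
  qed (intro meas exp_growth_const V)
  have Z: "(LINT \<sigma>|lborel. 1 * gibbs_weight u A V \<sigma>) \<noteq> 0"
  proof
    assume "(LINT \<sigma>|lborel. 1 * gibbs_weight u A V \<sigma>) = 0"
    then have "AE \<sigma> in lborel. 1 * gibbs_weight u A V \<sigma> = 0"
      by (subst (asm) integral_nonneg_eq_0_iff_AE[OF int1]) (auto simp: gibbs_weight_def)
    then have "AE \<sigma> in (lborel :: (real^'n) measure). False" by (simp add: gibbs_weight_def)
    then have "emeasure lborel (UNIV :: (real^'n) set) = 0" by (simp add: AE_iff_measurable[OF _ refl])
    then show False by simp
  qed
  have "(\<lambda>n. (LINT \<sigma>|lborel. \<sigma> $ x * gibbs_weight u A (W n) \<sigma>) / (LINT \<sigma>|lborel. 1 * gibbs_weight u A (W n) \<sigma>))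
    \<longlonglongrightarrow> (LINT \<sigma>|lborel. \<sigma> $ x * gibbs_weight u A V \<sigma>) / (LINT \<sigma>|lborel. 1 * gibbs_weight u A V \<sigma>)"
    by (intro tendsto_divide lim exp_growth_component exp_growth_const Z)
  then show ?thesis by (simp add: gibbs_expectation_eq V W)
qed

theorem theorem1p1:
  fixes A :: "real^'n^'n"
    and V :: "'n \<Rightarrow> real \<Rightarrow> real"
    and g h :: "real^'n"
    and x :: 'n
  assumes "pos_definite A"
    and "ferromagnetic A"
    and "\<And>y. C_diff 3 (V y)"
    and "\<And>y s. V y (- s) = V y s"
    and "\<And>y. \<not> bdd_above (range (V y))"
    and "\<And>y. convex_on {0..} (deriv (V y))"
    and "\<And>y. 0 \<le> h $ y"
  shows "gibbs_expectation (g + h) A V (\<lambda>\<sigma>. \<sigma> $ x) - gibbs_expectation (g - h) A V (\<lambda>\<sigma>. \<sigma> $ x)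
       \<le> gibbs_expectation h A V (\<lambda>\<sigma>. \<sigma> $ x) - gibbs_expectation (- h) A V (\<lambda>\<sigma>. \<sigma> $ x)"
proof -
  obtain c where c: "c > 0" "\<And>v. c * (norm v)\<^sup>2 \<le> v \<bullet> (A *v v)"
    using pos_definite_split[OF assms(1)] by blast
  define A' where "A' = A - mat c"
  have A: "A = A' + mat c" by (simp add: A'_def)
  have A'v: "A' *v v = A *v v - c *\<^sub>R v" for v
    by (simp add: A'_def vec_eq_iff matrix_vector_mult_def mat_def sum_subtractf left_diff_distrib if_distrib[of "\<lambda>y. y * _"] cong: if_cong)
  obtain R C where RC: "\<And>y k. R y \<le> k \<Longrightarrow>
      \<exists>W w w' L B. admissible_potential W w w' L B (C y) \<and> (\<forall>s. \<bar>s\<bar> \<le> k \<longrightarrow> W s = V y s)"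
    using potential_truncation[OF assms(3-6)] by metis
  define D where "D = (\<Sum>y\<in>UNIV. \<bar>C y\<bar>)"
  have D: "C y \<le> D" for y
    using member_le_sum[of y UNIV "\<lambda>y. \<bar>C y\<bar>"] by (auto simp: D_def)
  \<comment> \<open>The level is at least \<open>R y\<close>, so that the truncation is admissible,
    and at least \<open>n\<close>, so that the potentials converge pointwise.\<close>
  define good where "good n y = (\<lambda>(W, w, w', L, B). admissible_potential W w w' L B (C y) \<and>
      (\<forall>s. \<bar>s\<bar> \<le> max (R y) (real n) \<longrightarrow> W s = V y s))" for n y
  have "\<exists>p. good n y p" for n y
  proof -
    obtain W w w' L B where "admissible_potential W w w' L B (C y)" "\<forall>s. \<bar>s\<bar> \<le> max (R y) (real n) \<longrightarrow> W s = V y s"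
      using RC[OF max.cobounded1] by blast
    then show ?thesis by (intro exI[of _ "(W, w, w', L, B)"]) (simp add: good_def)
  qed
  then obtain p where p: "\<And>n y. good n y (p n y)" by metis
  define W where "W n y = fst (p n y)" for n y
  define w where "w n y = fst (snd (p n y))" for n y
  define w' where "w' n y = fst (snd (snd (p n y)))" for n y
  define L where "L n y = fst (snd (snd (snd (p n y))))" for n y
  define B where "B n y = snd (snd (snd (snd (p n y))))" for n y
  have adm: "admissible_potential (W n y) (w n y) (w' n y) (L n y) (B n y) (C y)"
    and agree: "\<bar>s\<bar> \<le> max (R y) (real n) \<Longrightarrow> W n y s = V y s" for n y s
    using p[of n y] by (simp_all add: good_def W_def w_def w'_def L_def B_def case_prod_unfold)
  note W = adm[unfolded admissible_potential_def, THEN conjunct1, rule_format]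
    adm[unfolded admissible_potential_def, THEN conjunct2, THEN conjunct1, rule_format]
  have W': "continuous_on UNIV (w' n y)" "\<bar>w' n y s\<bar> \<le> L n y" "W n y (- s) = W n y s" "- C y \<le> W n y s"
     "t \<le> s \<Longrightarrow> w n y t - B n y \<le> w n y s" "convex_on {0..} (w n y)" for n y s t
    using adm[of n y] by (auto simp: admissible_potential_def)
  \<comment> \<open>Sums over the sites make the constants common to all of them. The bounds for
    \<open>L\<close> and \<open>B\<close> may grow with \<open>n\<close>, but \<open>D\<close> is
    the same for all \<open>n\<close>, as the limit requires.\<close>
  have sys: "spin_system A' (W n) (w n) (w' n) (\<Sum>y\<in>UNIV. \<bar>L n y\<bar>) (\<Sum>y\<in>UNIV. \<bar>B n y\<bar>) D" for n
  proof
    show "A' $ x $ y = A' $ y $ x" for x y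
    proof -
      have "A $ x $ y = transpose A $ x $ y" using assms(1) by (simp add: pos_definite_def)
      then show ?thesis by (simp add: A'_def mat_def transpose_def)
    qed
    show "0 \<le> v \<bullet> (A' *v v)" for v
      using c(2)[of v] by (simp add: A'v inner_diff_right power2_norm_eq_inner)
    show "A' $ x $ y \<le> 0" if "x \<noteq> y" for x y
      using assms(2) that by (simp add: ferromagnetic_def A'_def mat_def)
    show "\<bar>w' n y s\<bar> \<le> (\<Sum>y\<in>UNIV. \<bar>L n y\<bar>)" for y s
      using W'(2)[of n y s] member_le_sum[of y UNIV "\<lambda>y. \<bar>L n y\<bar>"] by simp
    show "w n y t - (\<Sum>y\<in>UNIV. \<bar>B n y\<bar>) \<le> w n y s" if "t \<le> s" for y s t
      using W'(5)[OF that, of n y] member_le_sum[of y UNIV "\<lambda>y. \<bar>B n y\<bar>"] by simp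
    show "- D \<le> W n y s" for y s using W'(4)[of y n s] D[of y] by linarith
  qed (use W W' in auto)
  have V_cont: "continuous_on UNIV (V y)" for y
    using assms(3)[of y] by (auto simp: C_diff_def dest!: spec[of _ 0] intro: differentiable_imp_continuous_on)
  have W_cont: "continuous_on UNIV (W n y)" for n y
    using W(1) by (meson DERIV_continuous_on has_field_derivative_at_within)
  have lim: "(\<lambda>n. gibbs_expectation u A (W n) (\<lambda>\<sigma>. \<sigma> $ x)) \<longlonglongrightarrow> gibbs_expectation u A V (\<lambda>\<sigma>. \<sigma> $ x)" for u
  proof (rule gibbs_expectation_limit[OF c V_cont W_cont])
    show "- D \<le> W n y s" for n y s using W'(4)[of y n s] D[of y] by linarith
    show "W n y s = V y s" if "\<bar>s\<bar> \<le> real n" for n y s using agree[of s y n] that by simp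
  qed
  show ?thesis
  proof (rule LIMSEQ_le[OF tendsto_diff[OF lim lim] tendsto_diff[OF lim lim]], intro exI allI impI)
    fix n
    show "gibbs_expectation (g + h) A (W n) (\<lambda>\<sigma>. \<sigma> $ x) - gibbs_expectation (g - h) A (W n) (\<lambda>\<sigma>. \<sigma> $ x)
       \<le> gibbs_expectation h A (W n) (\<lambda>\<sigma>. \<sigma> $ x) - gibbs_expectation (- h) A (W n) (\<lambda>\<sigma>. \<sigma> $ x)"
      unfolding A by (rule spin_system.gibbs_inequality[OF sys c(1) assms(7)])
  qed
qed

end
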